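(* Let $k$ be a fixed integer and let $\varepsilon>0$ be an arbitrary small positive number. Then for all sufficiently large real numbers $H$, $$S_3(H,k)=\prod_p\left(1-\frac{\lambda(p^2;k)}{p^{6}}\right)H^3+O\left(H^{9/4+\varepsilon}\right),$$ where the product runs over all primes $p$ and the implied constant depends at most on $k$ and $\varepsilon$.
   Context: $S_3(H,k)=\sum_{1\le x,y,z\le H}\mu^2(x^2+y^2+z^2+k)$, the sum being over integers $x,y,z$, where $\mu$ is the Möbius function and $\mu^2(n)$ is understood as the indicator function of square-free integers $n$ (that is, $\mu^2(n)=1$ if $p^2\nmid n$ for all primes $p$, and $\mu^2(n)=0$ otherwise; in particular $\mu^2(0)=0$, and negative $n$ are allowed). For a positive integer $q$, $\lambda(q;k)$ denotes the number of integer triples $(x,y,z)$ with $1\le x,y,z\le q$ and $x^2+y^2+z^2+k\equiv 0\pmod q$. *)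

theory Defs
  imports
    "HOL-Analysis.Analysis"
    "HOL-Library.Landau_Symbols"
    "HOL-Computational_Algebra.Squarefree"
    "HOL-Number_Theory.Cong"
begin

(* The squared Moebius function on the integers: squarefree is invariant under sign
   and false at 0. *)
definition moebius_sq :: "int \<Rightarrow> nat" where
  "moebius_sq n = (if squarefree n then 1 else 0)"

definition S3 :: "real \<Rightarrow> int \<Rightarrow> nat" where
  "S3 H k = (\<Sum>x\<in>{1..\<lfloor>H\<rfloor>}. \<Sum>y\<in>{1..\<lfloor>H\<rfloor>}. \<Sum>z\<in>{1..\<lfloor>H\<rfloor>}. moebius_sq (x\<^sup>2 + y\<^sup>2 + z\<^sup>2 + k))"

definition lambda_count :: "nat \<Rightarrow> int \<Rightarrow> nat" where
  "lambda_count q k =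
     card {(x, y, z). x \<in> {1..int q} \<and> y \<in> {1..int q} \<and> z \<in> {1..int q} \<and>
                      [x\<^sup>2 + y\<^sup>2 + z\<^sup>2 + k = 0] (mod int q)}"

(* A product over the primes is an infinite product over nat whose factors at
   non-primes are 1. *)
definition euler_factor :: "int \<Rightarrow> nat \<Rightarrow> real" where
  "euler_factor k p =
     (if prime p then 1 - real (lambda_count (p\<^sup>2) k) / real p ^ 6 else 1)"

end

theory Submission
  imports Defs
begin

text \<open>Expand the indicator of square-free integers as \<open>\<Sum>d\<^sup>2 | F(x). \<mu>(d)\<close> with \<open>F(x) = |x|\<^sup>2 + k\<close>,
  \<open>x\<close> in the cube \<open>{1..N}\<^sup>3\<close>, and cut at \<open>D = N powr (3/4)\<close>.

  For \<open>d > D\<close> write \<open>F(x) = d\<^sup>2 m\<close>; since \<open>n\<close> has \<open>O(N powr (1 + \<delta>))\<close> representations as a sum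
  of three squares from \<open>{1..N}\<close>, these \<open>d\<close> contribute \<open>O(N powr (3 + \<delta>) / D)\<close>.

  For \<open>d \<le> D\<close> the number of \<open>x\<close> with \<open>d\<^sup>2 | F(x)\<close> is evaluated by finite Fourier analysis modulo
  \<open>q = d\<^sup>2\<close>. The zero frequency gives the main term. At a frequency \<open>a \<noteq> 0\<close> the complete sum over
  \<open>q | F(y)\<close> of \<open>e(a \<bullet> y / q)\<close> is elementary because the modulus is a square: with \<open>y = u + d v\<close> the
  condition is linear in \<open>v\<close>, and the sum is at most \<open>d\<^sup>2\<close> times the number of solutions \<open>(u, t)\<close>
  modulo \<open>d\<close> of \<open>F(u) \<equiv> 0\<close>, \<open>2 t u \<equiv> -a\<close>. Up to divisor functions this is
  \<open>g\<^sup>2 + [d dvd |a|\<^sup>2] d g\<close> with \<open>g = gcd a d\<close>; the second term, needed for \<open>k = 0\<close> only, is small on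
  average over \<open>d\<close>, since \<open>|a|\<^sup>2\<close> has few divisors. Altogether the errors for \<open>d \<le> D\<close> are
  \<open>O(D\<^sup>3 N powr \<delta>)\<close>, which balances the contribution of the large \<open>d\<close>.\<close>

section \<open>The divisor bound\<close>

text \<open>The exponent 9/4 comes from \<open>D ^ 4 = N ^ 3\<close>, which equates
  \<open>N ^ 3 / D\<close> with \<open>D ^ 3\<close>. At modulus \<open>d\<^sup>2\<close> a complete
  sum is about \<open>d\<^sup>2\<close> when gcds are ignored, and summing over the frequencies
  costs only logarithms, so one \<open>d\<close> contributes about \<open>d\<^sup>2\<close> and all
  of them about \<open>D ^ 3\<close>. Frequencies with one or two zero coordinates cost
  \<open>N * D\<close> and \<open>N ^ 2\<close> in total instead, both below \<open>D ^ 3\<close>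
  for this \<open>D\<close>.

  The obstacle is \<open>k = 0\<close>. Eliminating \<open>u\<close> from the conditions on
  \<open>(u, t)\<close> leaves \<open>4 * k * t\<^sup>2 + |a|\<^sup>2\<close> divisible by
  \<open>d\<close>. For nonzero \<open>k\<close> this has few roots \<open>t\<close>; for
  \<open>k = 0\<close> it does not involve \<open>t\<close>, and about \<open>d\<close> values may
  survive whenever \<open>d\<close> divides \<open>|a|\<^sup>2\<close>. No pointwise bound in
  \<open>d\<close> suffices then.

  For this reason the estimates are kept as sums over all common divisors \<open>e\<close> of
  \<open>a\<close> and \<open>d\<close>, not evaluated at their gcd: with \<open>a = e * b\<close>
  the ranges of \<open>e\<close> and \<open>b\<close> can be made independent of \<open>d\<close>,
  and the sum over \<open>d\<close> can be carried out first.

  Only square-free \<open>d\<close> carry a Moebius value. Then \<open>e\<close> and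
  \<open>d div e\<close> are coprime, which is what lets divisors count the roots of quadratic
  congruences.\<close>

definition tau :: "int \<Rightarrow> nat" where
  "tau n = card {e. 0 < e \<and> e dvd n}"

lemma finite_pos_divisors: "n \<noteq> 0 \<Longrightarrow> finite {e::int. 0 < e \<and> e dvd n}"
  by (rule finite_subset[OF _ finite_divisors_int[of n]]) auto

lemma tau_pos: "n \<noteq> 0 \<Longrightarrow> 0 < tau n"
  unfolding tau_def by (subst card_gt_0_iff) (auto intro!: finite_pos_divisors exI[of _ 1])

lemma tau_dvd_mono: "m dvd n \<Longrightarrow> n \<noteq> 0 \<Longrightarrow> tau m \<le> tau n"
  unfolding tau_def by (intro card_mono finite_pos_divisors) (auto intro: dvd_trans)

lemma tau_of_nat: "tau (int n) = card {e::nat. e dvd n}" if "n > 0"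
proof -
  have "{e. 0 < e \<and> e dvd int n} = int ` {e::nat. e dvd n}"
  proof (intro set_eqI iffI)
    fix e assume "e \<in> {e. 0 < e \<and> e dvd int n}"
    then have "e = int (nat e)" "nat e dvd n" using int_dvd_int_iff[of "nat e" n] by auto
    then show "e \<in> int ` {e::nat. e dvd n}" by blast
  qed (use that in \<open>auto intro!: Nat.gr0I\<close>)
  then show ?thesis unfolding tau_def by (simp add: card_image)
qed

lemma card_divisors_prime_power_mult_le:
  fixes p a m :: nat
  assumes "prime p" "m > 0"
  shows "card {e. e dvd p ^ a * m} \<le> (a + 1) * card {e. e dvd m}"
proof -
  have "{e. e dvd p ^ a * m} \<subseteq> (\<lambda>(i, f). p ^ i * f) ` ({..a} \<times> {e. e dvd m})"
  proof
    fix e assume "e \<in> {e. e dvd p ^ a * m}"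
    then obtain b c where "e = b * c" "b dvd p ^ a" "c dvd m"
      using division_decomp[of e "p ^ a" m] by auto
    moreover from this obtain i where "i \<le> a" "b = p ^ i"
      using divides_primepow_nat[OF assms(1)] by auto
    ultimately show "e \<in> (\<lambda>(i, f). p ^ i * f) ` ({..a} \<times> {e. e dvd m})" by force
  qed
  then have "card {e. e dvd p ^ a * m} \<le> card ({..a} \<times> {e. e dvd m})"
    using assms(2) by (intro surj_card_le) auto
  then show ?thesis by (simp add: card_cartesian_product)
qed

text \<open>If \<open>p powr \<delta>\<close> exceeds 2, then \<open>a + 1 \<le> 2 ^ a\<close>
  suffices and nothing is lost; for the remaining, boundedly many primes
  \<open>1 + x \<le> exp x\<close> loses a constant factor.\<close>

lemma prime_power_powr_ge:
  fixes \<delta> :: real and p a :: nat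
  assumes \<delta>: "\<delta> > 0" and p: "prime p"
  shows "real (a + 1) \<le> (if real p \<le> 2 powr (1 / \<delta>) then 1 + 1 / (\<delta> * ln 2) else 1) * (real p ^ a) powr \<delta>"
proof -
  have p2: "p \<ge> 2" using p prime_ge_2_nat by auto
  have eq: "(real p ^ a) powr \<delta> = (real p powr \<delta>) ^ a"
    using p2 by (simp add: powr_powr mult.commute flip: powr_realpow)
  show ?thesis
  proof (cases "real p \<le> 2 powr (1 / \<delta>)")
    case True
    have "1 + a * (\<delta> * ln 2) \<le> exp (a * (\<delta> * ln 2))" by (rule exp_ge_add_one_self)
    also have "\<dots> = (2 powr \<delta>) ^ a" by (simp add: powr_def exp_of_nat_mult)
    also have "\<dots> \<le> (real p powr \<delta>) ^ a" using p2 \<delta> by (intro power_mono powr_mono2) auto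
    finally have le: "1 + a * (\<delta> * ln 2) \<le> (real p ^ a) powr \<delta>" using eq by simp
    have "real (a + 1) \<le> (1 + 1 / (\<delta> * ln 2)) * (1 + a * (\<delta> * ln 2))"
      using \<delta> by (simp add: field_simps)
    also have "\<dots> \<le> (1 + 1 / (\<delta> * ln 2)) * (real p ^ a) powr \<delta>"
      using \<delta> le by (intro mult_left_mono) auto
    finally show ?thesis using True by simp
  next
    case False
    then have "(2 powr (1 / \<delta>)) powr \<delta> \<le> real p powr \<delta>" using \<delta> by (intro powr_mono2) auto
    then have "2 \<le> real p powr \<delta>" using \<delta> by (simp add: powr_powr)
    then have "2 ^ a \<le> (real p powr \<delta>) ^ a" by (intro power_mono) auto
    moreover have "a + 1 \<le> 2 ^ a" by (induction a) auto
    then have "real (a + 1) \<le> 2 ^ a" using of_nat_le_iff[of "a + 1" "2 ^ a", where 'a=real] by (simp del: of_nat_le_iff)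
    ultimately show ?thesis using False eq by simp
  qed
qed

text \<open>Prime powers are split off one at a time. Only primes up to \<open>B\<close> lose a
  factor \<open>K\<close>, so the total loss is bounded independently of \<open>n\<close>.\<close>

lemma tau_le_powr:
  fixes \<delta> :: real
  assumes \<delta>: "\<delta> > 0"
  shows "\<exists>C\<ge>1. \<forall>n>0. real (tau n) \<le> C * real_of_int n powr \<delta>"
proof -
  define B where "B = 2 powr (1 / \<delta>)"
  define K where "K = 1 + 1 / (\<delta> * ln 2)"
  define c where "c p = (if real p \<le> B then K else 1)" for p :: nat
  have K1: "K \<ge> 1" using \<delta> by (simp add: K_def)
  then have c1: "c p \<ge> 1" for p by (simp add: c_def)
  have main: "real (card {e::nat. e dvd n}) \<le> (\<Prod>p\<in>prime_factors n. c p) * real n powr \<delta>" if "n > 0" for n :: nat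
    using that
  proof (induction n rule: less_induct)
    case (less n)
    show ?case
    proof (cases "n = 1")
      case False
      then obtain p where p: "prime p" "p dvd n" by (metis prime_factor_nat)
      from less.prems p obtain a m where nm: "n = p ^ a * m" "\<not> p dvd m"
        by (metis multiplicity_decompose' not_prime_unit less_numeral_extra(3))
      have a: "a > 0" using nm p by (cases a) auto
      have m: "m > 0" using nm less.prems by (auto intro: Nat.gr0I)
      have "p ^ a > 1" using a prime_gt_1_nat[OF p(1)] by (intro one_less_power)
      then have "m < n" using m nm by simp
      have pf: "prime_factors n = insert p (prime_factors m)"
        unfolding nm(1) using m p a by (simp add: prime_factorization_mult prime_factorization_prime_power)
      have np: "p \<notin> prime_factors m" using nm by auto
      have "real (card {e. e dvd n}) \<le> real (a + 1) * real (card {e. e dvd m})"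
        using card_divisors_prime_power_mult_le[OF p(1) m, of a] nm(1)
        by (simp only: of_nat_le_iff flip: of_nat_mult)
      also have "\<dots> \<le> (c p * (real p ^ a) powr \<delta>) * ((\<Prod>p\<in>prime_factors m. c p) * real m powr \<delta>)"
        using prime_power_powr_ge[OF \<delta> p(1), of a] less.IH[OF \<open>m < n\<close> m] c1[of p]
        by (intro mult_mono) (auto simp: c_def B_def K_def)
      also have "\<dots> = (\<Prod>p\<in>prime_factors n. c p) * real n powr \<delta>"
        unfolding pf using np by (simp add: nm powr_mult)
      finally show ?thesis .
    qed auto
  qed
  \<comment> \<open>The exponent is the size of \<open>{..nat \<lfloor>B\<rfloor>}\<close>, a crude
    bound for the number of primes up to \<open>B\<close>.\<close>
  define C where "C = K ^ (nat \<lfloor>B\<rfloor> + 1)"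
  have prodC: "(\<Prod>p\<in>prime_factors n. c p) \<le> C" for n :: nat
  proof -
    have "(\<Prod>p\<in>prime_factors n. c p) = (\<Prod>p\<in>{p \<in> prime_factors n. real p \<le> B}. K)"
      by (subst prod.inter_filter) (auto simp: c_def)
    also have "\<dots> = K ^ card {p \<in> prime_factors n. real p \<le> B}" by simp
    also have "card {p \<in> prime_factors n. real p \<le> B} \<le> card {..nat \<lfloor>B\<rfloor>}"
      by (intro card_mono) (auto simp: le_nat_floor)
    then have "K ^ card {p \<in> prime_factors n. real p \<le> B} \<le> C"
      unfolding C_def using K1 by (intro power_increasing) auto
    finally show ?thesis .
  qed
  have "real (tau n) \<le> C * real_of_int n powr \<delta>" if "n > 0" for n
  proof -
    have n: "nat n > 0" "int (nat n) = n" "real (nat n) = real_of_int n" using that by auto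
    have "real (tau n) = real (card {e::nat. e dvd nat n})" using tau_of_nat[OF n(1)] n by simp
    also have "\<dots> \<le> (\<Prod>p\<in>prime_factors (nat n). c p) * real (nat n) powr \<delta>" using main n by blast
    also have "\<dots> \<le> C * real (nat n) powr \<delta>" using prodC by (intro mult_right_mono) auto
    finally show ?thesis using n by simp
  qed
  moreover have "C \<ge> 1" unfolding C_def using K1 by (rule one_le_power)
  ultimately show ?thesis by blast
qed

section \<open>Sums of two and three squares\<close>

text \<open>Fix one root \<open>s\<^sub>0\<close>. A root \<open>s\<close> is determined modulo \<open>n / 2\<close> by the divisor \<open>gcd (s - s\<^sub>0) n\<close>,
  because \<open>s - s\<^sub>0\<close> and \<open>s + s\<^sub>0\<close> have no common factor with \<open>n\<close> beyond 2.\<close>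
lemma card_sqrt_minus_one_le:
  fixes n :: int
  assumes n: "n > 0"
  shows "card {s. 0 \<le> s \<and> s < n \<and> n dvd s\<^sup>2 + 1} \<le> 2 * tau n"
proof (cases "{s. 0 \<le> s \<and> s < n \<and> n dvd s\<^sup>2 + 1} = {}")
  case False
  define R where "R = {s. 0 \<le> s \<and> s < n \<and> n dvd s\<^sup>2 + 1}"
  obtain s0 where s0: "n dvd s0\<^sup>2 + 1" using False by auto
  \<comment> \<open>The gcd fixes \<open>s\<close> only modulo \<open>n / 2\<close>; the Boolean
    tells the two halves of the residue range apart.\<close>
  define f where "f s = (n \<le> 2 * s, gcd (s - s0) n)" for s
  have "inj_on f R"
  proof (rule inj_onI)
    fix s s' assume s: "s \<in> R" "s' \<in> R" and eq: "f s = f s'"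
    define u where "u = gcd (s - s0) n"
    have u': "u = gcd (s' - s0) n" and half: "n \<le> 2 * s \<longleftrightarrow> n \<le> 2 * s'" using eq by (auto simp: f_def u_def)
    have u0: "u > 0" using n by (simp add: u_def)
    obtain v where v: "n = u * v" using u_def by (metis dvd_def gcd_dvd2)
    have vdvd: "v dvd t + s0" if t1: "n dvd t\<^sup>2 + 1" and t2: "u = gcd (t - s0) n" for t
    proof -
      obtain w where w: "t - s0 = u * w" using t2 by (metis dvd_def gcd_dvd1)
      have "gcd (u * w) (u * v) = u * gcd w v" using u0 by (simp add: gcd_mult_left)
      then have "u * gcd w v = u * 1" using t2 unfolding w[symmetric] v[symmetric] by (metis mult.right_neutral)
      then have cop: "gcd w v = 1" using u0 by (metis mult_cancel_left less_irrefl)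
      have "n dvd (t\<^sup>2 + 1) - (s0\<^sup>2 + 1)" using t1 s0 by (rule dvd_diff)
      also have "(t\<^sup>2 + 1) - (s0\<^sup>2 + 1) = (t - s0) * (t + s0)"
        by (simp add: power2_eq_square algebra_simps)
      also have "\<dots> = u * (w * (t + s0))" using w by (simp add: mult.assoc)
      finally have "v dvd w * (t + s0)" using v u0 by simp
      then show ?thesis using cop by (metis coprime_commute coprime_dvd_mult_right_iff coprime_iff_gcd_eq_1)
    qed
    have "v dvd s + s0" by (rule vdvd[OF _ u_def]) (use s in \<open>auto simp: R_def\<close>)
    moreover have "v dvd s' + s0" by (rule vdvd[OF _ u']) (use s in \<open>auto simp: R_def\<close>)
    ultimately have v2: "v dvd s - s'" "v dvd s + s0" using dvd_diff[of v "s + s0" "s' + s0"] by auto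
    have "u dvd s - s0" by (simp add: u_def)
    moreover have "u dvd s' - s0" by (subst u') simp
    ultimately have u2: "u dvd s - s'" "u dvd s - s0" using dvd_diff[of u "s - s0" "s' - s0"] by auto
    have "gcd u v dvd (s + s0) - (s - s0)" using u2 v2 by (meson dvd_diff dvd_trans gcd_dvd1 gcd_dvd2)
    then have g1: "gcd u v dvd 2 * s0" by simp
    have "gcd u v dvd n" using v by (simp add: dvd_mult2)
    then have "gcd u v dvd s0\<^sup>2 + 1" using s0 dvd_trans by blast
    then have "gcd u v dvd 2 * (s0\<^sup>2 + 1) - s0 * (2 * s0)" using g1
      by (meson dvd_diff dvd_mult)
    then have g2: "gcd u v dvd 2" by (simp add: power2_eq_square algebra_simps)
    have "n dvd lcm u v * gcd u v" using v by (simp add: lcm_gcd_prod flip: abs_mult)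
    also have "lcm u v * gcd u v dvd (s - s') * 2" using u2 v2 g2 by (intro mult_dvd_mono lcm_least) auto
    finally have "n dvd 2 * (s - s')" by (simp add: mult.commute)
    moreover have "\<bar>2 * (s - s')\<bar> < n" using s half by (auto simp: R_def)
    ultimately have "2 * (s - s') = 0" using dvd_imp_le_int[of "2 * (s - s')" n] n by linarith
    then show "s = s'" by simp
  qed
  moreover have "f ` R \<subseteq> UNIV \<times> {e. 0 < e \<and> e dvd n}" using n by (auto simp: f_def)
  ultimately have "card R \<le> card ((UNIV::bool set) \<times> {e. 0 < e \<and> e dvd n})"
    using finite_pos_divisors[of n] n by (intro card_inj_on_le) auto
  then show ?thesis by (simp add: R_def tau_def card_cartesian_product card_UNIV_bool)
next
  case True
  show ?thesis unfolding True by simp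
qed

lemma finite_sum_two_squares: "finite {(x::int, y::int). x > 0 \<and> y > 0 \<and> x\<^sup>2 + y\<^sup>2 = n}"
proof (rule finite_subset)
  show "{(x::int, y::int). x > 0 \<and> y > 0 \<and> x\<^sup>2 + y\<^sup>2 = n} \<subseteq> {0..n} \<times> {0..n}"
  proof clarify
    fix x y :: int assume "x > 0" "y > 0"
    then have "x \<le> x * x" "y \<le> y * y" "0 \<le> x * x" "0 \<le> y * y" by (auto simp: mult_le_cancel_left1)
    then have "x \<le> x * x + y * y" "y \<le> x * x + y * y" by linarith+
    then show "x \<in> {0..x\<^sup>2 + y\<^sup>2} \<and> y \<in> {0..x\<^sup>2 + y\<^sup>2}"
      using \<open>x > 0\<close> \<open>y > 0\<close> by (simp add: power2_eq_square)
  qed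
qed auto

text \<open>A coprime representation yields the root \<open>s = x / y\<close> of
  \<open>s\<^sup>2 + 1\<close> modulo \<open>n\<close>, and different representations yield
  different roots.\<close>

lemma card_coprime_sum_two_squares_le:
  fixes n :: int
  assumes n: "n > 0"
  shows "card {(x, y). x > 0 \<and> y > 0 \<and> coprime x y \<and> x\<^sup>2 + y\<^sup>2 = n} \<le> 2 * tau n"
proof -
  define P where "P = {(x, y). x > 0 \<and> y > 0 \<and> coprime x y \<and> x\<^sup>2 + y\<^sup>2 = n}"
  define R where "R = {s. 0 \<le> s \<and> s < n \<and> n dvd s\<^sup>2 + 1}"
  define good where "good = (\<lambda>(x, y) s. s \<in> R \<and> n dvd s * y - x)"
  have ex: "\<exists>s. good p s" if pP: "p \<in> P" for p
  proof -
    obtain x y where p: "p = (x, y)" "x > 0" "y > 0" "coprime x y" "x\<^sup>2 + y\<^sup>2 = n" using pP by (auto simp: P_def)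
    have "coprime y (x\<^sup>2)" using p(4) by (simp add: coprime_commute)
    moreover have "gcd y n = gcd y (x\<^sup>2)"
      using p(5) gcd_add_mult[of y y "x\<^sup>2"] by (simp add: power2_eq_square add.commute)
    ultimately have cop: "coprime y n" by (simp add: coprime_iff_gcd_eq_1)
    then obtain z where z: "[y * z = 1] (mod n)" using cong_solve_coprime_int by blast
    define s where "s = (x * z) mod n"
    have "[s * y = x * z * y] (mod n)" unfolding s_def by (metis cong_mod_left cong_refl cong_scalar_right)
    also have "[x * z * y = x * 1] (mod n)" using cong_scalar_left[OF z, of x] by (simp add: ac_simps)
    finally have sy: "n dvd s * y - x" by (simp add: cong_iff_dvd_diff)
    have "n dvd (s * y - x) * (s * y + x) + n" using sy by simp
    also have "(s * y - x) * (s * y + x) + n = y\<^sup>2 * (s\<^sup>2 + 1)"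
      using p(5) by (simp add: power2_eq_square algebra_simps)
    finally have "n dvd s\<^sup>2 + 1" using cop
      by (metis coprime_commute coprime_dvd_mult_right_iff coprime_power_right_iff)
    then have "good p s" using sy p n by (auto simp: good_def R_def s_def)
    then show ?thesis by blast
  qed
  define f where "f p = (SOME s. good p s)" for p
  have f: "good p (f p)" if "p \<in> P" for p unfolding f_def using ex[OF that] by (rule someI_ex)
  have "inj_on f P"
  proof (rule inj_onI)
    fix p p' assume pp: "p \<in> P" "p' \<in> P" "f p = f p'"
    obtain x y where p: "p = (x, y)" "x > 0" "y > 0" "coprime x y" "x\<^sup>2 + y\<^sup>2 = n" using pp by (auto simp: P_def)
    obtain x' y' where p': "p' = (x', y')" "x' > 0" "y' > 0" "coprime x' y'" "x'\<^sup>2 + y'\<^sup>2 = n" using pp by (auto simp: P_def)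
    define s where "s = f p"
    have "n dvd s * y - x" "n dvd s * y' - x'" using f[OF pp(1)] f[OF pp(2)] pp(3) p p' by (auto simp: good_def s_def)
    then have "n dvd y * (s * y' - x') - y' * (s * y - x)" by (meson dvd_diff dvd_mult)
    then have dv: "n dvd x * y' - x' * y" by (simp add: algebra_simps)
    \<comment> \<open>Brahmagupta's identity. As all coordinates are positive, the first square is
      nonzero, so \<open>x * y' - x' * y\<close> is a multiple of \<open>n\<close> of absolute value
      below \<open>n\<close>.\<close>
    have "(x * x' + y * y')\<^sup>2 + (x * y' - x' * y)\<^sup>2 = (x\<^sup>2 + y\<^sup>2) * (x'\<^sup>2 + y'\<^sup>2)"
      by (simp add: power2_eq_square algebra_simps)
    then have "(x * x' + y * y')\<^sup>2 + (x * y' - x' * y)\<^sup>2 = n\<^sup>2" using p p' by (simp add: power2_eq_square)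
    moreover have "x * x' + y * y' > 0" using p p' by (simp add: add_pos_pos)
    then have "(x * x' + y * y')\<^sup>2 > 0" by simp
    ultimately have "(x * y' - x' * y)\<^sup>2 < n\<^sup>2" by linarith
    then have "\<bar>x * y' - x' * y\<bar> < n" using n by (metis abs_of_pos abs_le_square_iff linorder_not_le)
    then have "x * y' - x' * y = 0" using dv n by (metis abs_ge_self abs_of_pos dvd_imp_le_int linorder_not_less)
    then have eq: "x * y' = x' * y" by simp
    have "x dvd x'" using eq p(4) by (metis coprime_dvd_mult_left_iff dvd_triv_left)
    moreover have "x' dvd x" using eq p'(4) by (metis coprime_dvd_mult_left_iff dvd_triv_left)
    ultimately have "x = x'" using p p' by (simp add: zdvd_antisym_nonneg)
    then show "p = p'" using eq p p' by simp
  qed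
  moreover have "f ` P \<subseteq> R" using f by (fastforce simp: good_def)
  moreover have "finite R" by (rule finite_subset[of _ "{0..n}"]) (auto simp: R_def)
  ultimately have "card P \<le> card R" by (rule card_inj_on_le)
  also have "\<dots> \<le> 2 * tau n" unfolding R_def by (rule card_sqrt_minus_one_le[OF n])
  finally show ?thesis by (simp add: P_def)
qed

text \<open>Sorting by \<open>g = gcd x y\<close> gives at most \<open>tau n\<close> classes, each
  made of coprime representations of \<open>n div g\<^sup>2\<close>.\<close>

lemma card_sum_two_squares_le:
  fixes n :: int
  assumes n: "n > 0"
  shows "card {(x, y). x > 0 \<and> y > 0 \<and> x\<^sup>2 + y\<^sup>2 = n} \<le> 2 * (tau n)\<^sup>2"
proof -
  define P where "P n = {(x, y). x > 0 \<and> y > 0 \<and> coprime x y \<and> x\<^sup>2 + y\<^sup>2 = n}" for n :: int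
  define G where "G = {g. 0 < g \<and> g\<^sup>2 dvd n}"
  have GD: "G \<subseteq> {e. 0 < e \<and> e dvd n}" by (auto simp: G_def power2_eq_square intro: dvd_mult_left)
  then have finG: "finite G" using finite_pos_divisors[of n] n by (simp add: finite_subset)
  have finP: "finite (P n)" for n by (rule finite_subset[OF _ finite_sum_two_squares[of n]]) (auto simp: P_def)
  have "{(x, y). x > 0 \<and> y > 0 \<and> x\<^sup>2 + y\<^sup>2 = n} \<subseteq> (\<lambda>(g, x, y). (g * x, g * y)) ` (SIGMA g:G. P (n div g\<^sup>2))"
  proof clarify
    fix x y :: int assume xy: "x > 0" "y > 0" "n = x\<^sup>2 + y\<^sup>2"
    define g where "g = gcd x y"
    have g0: "g > 0" using xy by (simp add: g_def)
    define x' y' where "x' = x div g" and "y' = y div g"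
    have x': "x = g * x'" and y': "y = g * y'" by (auto simp: x'_def y'_def g_def)
    have cop: "coprime x' y'" unfolding x'_def y'_def g_def using xy by (intro div_gcd_coprime) auto
    have nn: "n = g\<^sup>2 * (x'\<^sup>2 + y'\<^sup>2)" using xy x' y' by (simp add: algebra_simps power_mult_distrib)
    have "(g, x', y') \<in> (SIGMA g:G. P (n div g\<^sup>2))"
      using nn g0 cop xy x' y' by (auto simp: G_def P_def zero_less_mult_iff)
    then show "(x, y) \<in> (\<lambda>(g, x, y). (g * x, g * y)) ` (SIGMA g:G. P ((x\<^sup>2 + y\<^sup>2) div g\<^sup>2))"
      using x' y' unfolding xy(3)[symmetric] by (intro image_eqI[of _ _ "(g, x', y')"]) simp_all
  qed
  then have "card {(x, y). x > 0 \<and> y > 0 \<and> x\<^sup>2 + y\<^sup>2 = n} \<le> card (SIGMA g:G. P (n div g\<^sup>2))"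
    using finG finP by (intro surj_card_le) auto
  also have "\<dots> = (\<Sum>g\<in>G. card (P (n div g\<^sup>2)))" using finG finP by simp
  also have "\<dots> \<le> (\<Sum>g\<in>G. 2 * tau n)"
  proof (rule sum_mono)
    fix g assume g: "g \<in> G"
    then have "n div g\<^sup>2 dvd n" "n div g\<^sup>2 > 0" using n
      by (auto simp: G_def dvd_def zero_less_mult_iff)
    then have "tau (n div g\<^sup>2) \<le> tau n" using n by (intro tau_dvd_mono) auto
    then show "card (P (n div g\<^sup>2)) \<le> 2 * tau n"
      using card_coprime_sum_two_squares_le[OF \<open>n div g\<^sup>2 > 0\<close>] by (simp add: P_def)
  qed
  also have "\<dots> = card G * (2 * tau n)" by simp
  also have "\<dots> \<le> tau n * (2 * tau n)" unfolding tau_def[of n]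
    using GD finite_pos_divisors[of n] n by (intro mult_right_mono card_mono) auto
  finally show ?thesis by (simp add: power2_eq_square)
qed

text \<open>The coordinate \<open>z\<close> is free, which costs the factor \<open>N\<close>; the
  rest is a count for two squares.\<close>

lemma card_sum_three_squares_le:
  fixes \<delta> :: real
  assumes \<delta>: "\<delta> > 0"
  shows "\<exists>C\<ge>0. \<forall>N>0. \<forall>n. real (card {(x, y, z). x \<in> {1..int N} \<and> y \<in> {1..int N} \<and> z \<in> {1..int N} \<and>
                                x\<^sup>2 + y\<^sup>2 + z\<^sup>2 = n}) \<le> C * real N powr (1 + \<delta>)"
proof -
  \<comment> \<open>With \<open>n\<close> up to \<open>2 * N ^ 2\<close> and the divisor function
    squared, the exponent \<open>\<delta> / 4\<close> becomes
    \<open>N powr \<delta>\<close>.\<close>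
  obtain C where C: "C \<ge> 1" "\<And>n. n > 0 \<Longrightarrow> real (tau n) \<le> C * real_of_int n powr (\<delta> / 4)"
    using tau_le_powr[of "\<delta> / 4"] \<delta> by auto
  have "real (card {(x, y, z). x \<in> {1..int N} \<and> y \<in> {1..int N} \<and> z \<in> {1..int N} \<and> x\<^sup>2 + y\<^sup>2 + z\<^sup>2 = n})
     \<le> 2 * C\<^sup>2 * 2 powr (\<delta> / 2) * real N powr (1 + \<delta>)" if N: "N > 0" for N n
  proof -
    define Q where "Q z = {(x, y). x \<in> {1..int N} \<and> y \<in> {1..int N} \<and> x\<^sup>2 + y\<^sup>2 = n - z\<^sup>2}" for z
    have finQ: "finite (Q z)" for z
      by (rule finite_subset[of _ "{1..int N} \<times> {1..int N}"]) (auto simp: Q_def)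
    have cQ: "real (card (Q z)) \<le> 2 * C\<^sup>2 * 2 powr (\<delta> / 2) * real N powr \<delta>" for z
    proof (cases "Q z = {}")
      case False
      then obtain x y where xy: "x \<in> {1..int N}" "y \<in> {1..int N}" "x\<^sup>2 + y\<^sup>2 = n - z\<^sup>2" by (auto simp: Q_def)
      then have "x\<^sup>2 \<le> (int N)\<^sup>2" "y\<^sup>2 \<le> (int N)\<^sup>2" "0 < x\<^sup>2" "0 < y\<^sup>2" by (auto intro!: power_mono)
      then have m: "0 < n - z\<^sup>2" "n - z\<^sup>2 \<le> 2 * (int N)\<^sup>2" using xy(3) by linarith+
      have "real_of_int (n - z\<^sup>2) \<le> real_of_int (2 * (int N)\<^sup>2)" using m(2) by (simp only: of_int_le_iff)
      then have m2: "real_of_int (n - z\<^sup>2) \<le> 2 * real N ^ 2" by simp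
      have "card (Q z) \<le> card {(x, y). x > 0 \<and> y > 0 \<and> x\<^sup>2 + y\<^sup>2 = n - z\<^sup>2}"
        by (intro card_mono finite_sum_two_squares) (auto simp: Q_def)
      also have "\<dots> \<le> 2 * (tau (n - z\<^sup>2))\<^sup>2" by (rule card_sum_two_squares_le[OF m(1)])
      finally have "real (card (Q z)) \<le> real (2 * (tau (n - z\<^sup>2))\<^sup>2)" by (simp only: of_nat_le_iff)
      then have "real (card (Q z)) \<le> 2 * real (tau (n - z\<^sup>2)) ^ 2" by simp
      also have "\<dots> \<le> 2 * (C * real_of_int (n - z\<^sup>2) powr (\<delta> / 4)) ^ 2"
        using C(2)[OF m(1)] by (intro mult_left_mono power_mono) auto
      also have "\<dots> \<le> 2 * (C * (2 * real N ^ 2) powr (\<delta> / 4)) ^ 2"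
        using m m2 C(1) \<delta> by (intro mult_left_mono power_mono powr_mono2) auto
      also have "(2 * real N ^ 2) powr (\<delta> / 4) = 2 powr (\<delta> / 4) * real N powr (\<delta> / 2)"
        using N by (simp add: powr_mult powr_powr flip: powr_numeral)
      also have "2 * (C * (2 powr (\<delta> / 4) * real N powr (\<delta> / 2))) ^ 2 = 2 * C\<^sup>2 * 2 powr (\<delta> / 2) * real N powr \<delta>"
        using N by (simp add: power_mult_distrib powr_power)
      finally show ?thesis .
    qed auto
    have "{(x, y, z). x \<in> {1..int N} \<and> y \<in> {1..int N} \<and> z \<in> {1..int N} \<and> x\<^sup>2 + y\<^sup>2 + z\<^sup>2 = n}
        \<subseteq> (\<lambda>(z, x, y). (x, y, z)) ` (SIGMA z:{1..int N}. Q z)"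
      by (force simp: Q_def)
    then have "card {(x, y, z). x \<in> {1..int N} \<and> y \<in> {1..int N} \<and> z \<in> {1..int N} \<and> x\<^sup>2 + y\<^sup>2 + z\<^sup>2 = n}
        \<le> card (SIGMA z:{1..int N}. Q z)" using finQ by (intro surj_card_le) auto
    also have "\<dots> = (\<Sum>z\<in>{1..int N}. card (Q z))" using finQ by simp
    finally have "real (card {(x, y, z). x \<in> {1..int N} \<and> y \<in> {1..int N} \<and> z \<in> {1..int N} \<and> x\<^sup>2 + y\<^sup>2 + z\<^sup>2 = n})
        \<le> (\<Sum>z\<in>{1..int N}. real (card (Q z)))" by (simp only: of_nat_le_iff flip: of_nat_sum)
    also have "\<dots> \<le> (\<Sum>z\<in>{1..int N}. 2 * C\<^sup>2 * 2 powr (\<delta> / 2) * real N powr \<delta>)" using cQ by (intro sum_mono)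
    also have "\<dots> = 2 * C\<^sup>2 * 2 powr (\<delta> / 2) * real N powr (1 + \<delta>)" using N by (simp add: powr_add)
    finally show ?thesis .
  qed
  moreover have "0 \<le> 2 * C\<^sup>2 * 2 powr (\<delta> / 2)" by simp
  ultimately show ?thesis by (intro exI[of _ "2 * C\<^sup>2 * 2 powr (\<delta> / 2)"]) auto
qed

section \<open>Quadratic congruences to square-free moduli\<close>

lemma squarefree_imp_coprime_factors:
  fixes u v :: int
  assumes "squarefree (u * v)"
  shows "coprime u v"
proof (rule coprimeI)
  fix c assume "c dvd u" "c dvd v"
  then have "c\<^sup>2 dvd u * v" unfolding power2_eq_square by (rule mult_dvd_mono)
  then show "is_unit c" using assms by (simp add: squarefree_def)
qed

lemma squarefree_dvd_int: "squarefree (d::int) \<Longrightarrow> e dvd d \<Longrightarrow> squarefree e"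
  by (meson dvd_trans squarefree_def)

text \<open>As for \<open>card_sqrt_minus_one_le\<close>: after dividing by \<open>gcd A d\<close>, a root \<open>t\<close> is determined
  by the divisor \<open>gcd (t - t\<^sub>0) m\<close>, the two cofactors being coprime for square-free moduli.\<close>
lemma card_quadratic_congruence_le:
  fixes d A c :: int
  assumes d: "d > 0" "squarefree d"
  shows "real (card {t. 0 \<le> t \<and> t < d \<and> d dvd A * t\<^sup>2 + c}) \<le> real_of_int (gcd A d) * tau d"
proof (cases "{t. 0 \<le> t \<and> t < d \<and> d dvd A * t\<^sup>2 + c} = {}")
  case False
  define R where "R = {t. 0 \<le> t \<and> t < d \<and> d dvd A * t\<^sup>2 + c}"
  obtain t0 where t0: "d dvd A * t0\<^sup>2 + c" using False by auto
  define h where "h = gcd A d"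
  define m where "m = d div h"
  have h0: "h > 0" using d by (simp add: h_def)
  have dm: "d = h * m" by (simp add: m_def h_def)
  have m0: "m > 0" using d(1) h0 dm by (simp add: zero_less_mult_iff)
  define B where "B = A div h"
  have A: "A = h * B" by (simp add: B_def h_def)
  have cop: "coprime B m" unfolding B_def m_def h_def using d(1) by (intro div_gcd_coprime) auto
  have sqm: "squarefree m" by (rule squarefree_dvd_int[OF d(2)]) (simp add: dm)
  have m_dvd: "m dvd (t - t0) * (t + t0)" if t: "t \<in> R" for t
  proof -
    have "d dvd (A * t\<^sup>2 + c) - (A * t0\<^sup>2 + c)" using t t0 by (intro dvd_diff) (auto simp: R_def)
    also have "(A * t\<^sup>2 + c) - (A * t0\<^sup>2 + c) = h * (B * ((t - t0) * (t + t0)))"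
      unfolding A by (simp add: power2_eq_square algebra_simps)
    finally have "m dvd B * ((t - t0) * (t + t0))" using h0 by (simp add: dm)
    then show ?thesis using cop by (metis coprime_commute coprime_dvd_mult_right_iff)
  qed
  \<comment> \<open>The first component says in which of the \<open>h\<close> blocks of length
    \<open>m\<close> the root lies, the second determines it modulo \<open>m\<close>.\<close>
  define f where "f t = (t div m, gcd (t - t0) m)" for t
  have "inj_on f R"
  proof (rule inj_onI)
    fix t t' assume t: "t \<in> R" "t' \<in> R" and eq: "f t = f t'"
    define u where "u = gcd (t - t0) m"
    have u': "u = gcd (t' - t0) m" and dv: "t div m = t' div m" using eq by (auto simp: f_def u_def)
    have u0: "u > 0" using m0 by (simp add: u_def)
    define v where "v = m div u"
    have v: "m = u * v" by (simp add: v_def u_def)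
    have uv: "coprime u v" using sqm v squarefree_imp_coprime_factors by blast
    have vdvd: "v dvd s + t0" if s: "s \<in> R" and us: "u = gcd (s - t0) m" for s
    proof -
      define w where "w = (s - t0) div u"
      have w: "s - t0 = u * w" by (simp add: w_def us)
      have "coprime w v" unfolding w_def v_def us using m0 by (intro div_gcd_coprime) auto
      moreover have "u * v dvd u * (w * (s + t0))" using m_dvd[OF s] unfolding w v by (simp add: mult.assoc)
      then have "v dvd w * (s + t0)" using u0 by simp
      ultimately show ?thesis by (metis coprime_commute coprime_dvd_mult_right_iff)
    qed
    have "v dvd t - t'" using dvd_diff[OF vdvd[OF t(1) u_def] vdvd[OF t(2) u']] by simp
    moreover have "u dvd t - t0" by (simp add: u_def)
    moreover have "u dvd t' - t0" by (subst u') simp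
    ultimately have "m dvd t - t'" using uv dvd_diff[of u "t - t0" "t' - t0"] unfolding v
      by (intro divides_mult) auto
    then have "t mod m = t' mod m" by (simp add: mod_eq_dvd_iff)
    then show "t = t'" using dv by (metis div_mult_mod_eq)
  qed
  moreover have "f ` R \<subseteq> {0..<h} \<times> {e. 0 < e \<and> e dvd m}"
  proof
    fix p assume "p \<in> f ` R"
    then obtain t where t: "0 \<le> t" "t < h * m" "p = f t" by (auto simp: R_def dm)
    have "t div m * m \<le> t" using m0 by (simp flip: minus_mod_eq_div_mult)
    then have "t div m < h" using t(2) m0 by (metis mult_less_cancel_right_pos order_le_less_trans)
    then show "p \<in> {0..<h} \<times> {e. 0 < e \<and> e dvd m}" using t m0 by (auto simp: f_def pos_imp_zdiv_nonneg_iff)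
  qed
  ultimately have "card R \<le> card ({0..<h} \<times> {e. 0 < e \<and> e dvd m})"
    using finite_pos_divisors[of m] m0 by (intro card_inj_on_le) auto
  also have "\<dots> = nat h * tau m" by (simp add: tau_def card_cartesian_product)
  also have "\<dots> \<le> nat h * tau d" using d dm by (intro mult_left_mono tau_dvd_mono) auto
  finally have "real (card R) \<le> real (nat h * tau d)" by (simp only: of_nat_le_iff)
  then show ?thesis using h0 by (simp add: R_def h_def)
next
  case True
  show ?thesis unfolding True using d by simp
qed

section \<open>Frequency vectors and the number of surviving pairs\<close>

definition norm_sq :: "int \<times> int \<times> int \<Rightarrow> int" where
  "norm_sq = (\<lambda>(x, y, z). x\<^sup>2 + y\<^sup>2 + z\<^sup>2)"

text \<open>Frequencies enter only through their common divisors, so this predicate takes the place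
  of the gcd of a vector.\<close>

definition dvd3 :: "int \<Rightarrow> int \<times> int \<times> int \<Rightarrow> bool" where
  "dvd3 e = (\<lambda>(a, b, c). e dvd a \<and> e dvd b \<and> e dvd c)"

definition box :: "int \<Rightarrow> (int \<times> int \<times> int) set" where
  "box n = {0..<n} \<times> {0..<n} \<times> {0..<n}"

lemma finite_box [simp]: "finite (box n)"
  by (simp add: box_def)

text \<open>The pairs \<open>(u, t)\<close> which survive when the twisted sum over \<open>d\<^sup>2 | |y|\<^sup>2 + k\<close> is evaluated
  by writing \<open>y = u + d v\<close> and summing over \<open>v\<close>; see \<open>norm_exp_sum_le\<close>.\<close>
definition survivors :: "int \<Rightarrow> int \<Rightarrow> int \<times> int \<times> int \<Rightarrow> ((int \<times> int \<times> int) \<times> int) set" where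
  "survivors k d = (\<lambda>(a1, a2, a3). {((u1, u2, u3), t). (u1, u2, u3) \<in> box d \<and> t \<in> {0..<d} \<and>
     d dvd u1\<^sup>2 + u2\<^sup>2 + u3\<^sup>2 + k \<and> dvd3 d (a1 + 2 * t * u1, a2 + 2 * t * u2, a3 + 2 * t * u3)})"

text \<open>For fixed \<open>t\<close> the linear congruences fix \<open>u\<close> modulo
  \<open>d div e\<close>, hence \<open>u\<close> is determined by its residue modulo
  \<open>e\<close>. That residue must still satisfy the quadratic congruence modulo
  \<open>e\<close>: two coordinates are free and the third has at most \<open>tau e\<close>
  values.\<close>

lemma card_survivors_fibre_le:
  fixes d e t k :: int
  assumes d: "d > 0" "squarefree d" and e: "e = gcd (2 * t) d"
  shows "real (card {(u1, u2, u3). (u1, u2, u3) \<in> box d \<and> d dvd u1\<^sup>2 + u2\<^sup>2 + u3\<^sup>2 + k \<and>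
      dvd3 d (a1 + 2 * t * u1, a2 + 2 * t * u2, a3 + 2 * t * u3)}) \<le> real_of_int (e\<^sup>2) * tau d"
proof -
  define U where "U = {(u1, u2, u3). (u1, u2, u3) \<in> box d \<and> d dvd u1\<^sup>2 + u2\<^sup>2 + u3\<^sup>2 + k \<and>
      dvd3 d (a1 + 2 * t * u1, a2 + 2 * t * u2, a3 + 2 * t * u3)}"
  have e0: "e > 0" using d by (simp add: e)
  define m where "m = d div e"
  have dm: "d = e * m" by (simp add: m_def e)
  have cop: "coprime e m" using d(2) dm squarefree_imp_coprime_factors by blast
  have sqe: "squarefree e" by (rule squarefree_dvd_int[OF d(2)]) (simp add: dm)
  define Z where "Z x y = {z. 0 \<le> z \<and> z < e \<and> e dvd 1 * z\<^sup>2 + (x\<^sup>2 + y\<^sup>2 + k)}" for x y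
  have finZ: "finite (Z x y)" for x y by (rule finite_subset[of _ "{0..<e}"]) (auto simp: Z_def)
  define f where "f = (\<lambda>(u1, u2, u3). (u1 mod e, u2 mod e, u3 mod e))"
  have eqI: "u = u'" if u: "d dvd a + 2 * t * u" "d dvd a + 2 * t * u'" "u mod e = u' mod e"
    "u \<in> {0..<d}" "u' \<in> {0..<d}" for a u u'
  proof -
    define w where "w = 2 * t div e"
    have w: "2 * t = e * w" by (simp add: w_def e)
    have "coprime w m" unfolding w_def m_def e using d(1) by (intro div_gcd_coprime) auto
    moreover have "d dvd 2 * t * (u - u')" using dvd_diff[OF u(1,2)] by (simp add: algebra_simps)
    then have "m dvd w * (u - u')" using e0 unfolding w dm by (simp add: mult.assoc)
    ultimately have "m dvd u - u'" by (metis coprime_commute coprime_dvd_mult_right_iff)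
    moreover have "e dvd u - u'" using u(3) by (simp add: mod_eq_dvd_iff)
    ultimately have "d dvd u - u'" unfolding dm using cop by (intro divides_mult)
    then have "u mod d = u' mod d" by (simp add: mod_eq_dvd_iff)
    then show ?thesis using u(4,5) by simp
  qed
  have "inj_on f U"
    unfolding f_def U_def inj_on_def box_def dvd3_def by (auto intro: eqI)
  moreover have "f ` U \<subseteq> (SIGMA x:{0..<e}. SIGMA y:{0..<e}. Z x y)"
  proof
    fix p assume "p \<in> f ` U"
    then obtain u1 u2 u3 where p: "p = (u1 mod e, u2 mod e, u3 mod e)" "d dvd u1\<^sup>2 + u2\<^sup>2 + u3\<^sup>2 + k"
      by (auto simp: f_def U_def)
    have "e dvd u1\<^sup>2 + u2\<^sup>2 + u3\<^sup>2 + k" using p(2) by (rule dvd_trans[rotated]) (simp add: dm)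
    moreover have "[1 * (u3 mod e)\<^sup>2 + ((u1 mod e)\<^sup>2 + (u2 mod e)\<^sup>2 + k) = 1 * u3\<^sup>2 + (u1\<^sup>2 + u2\<^sup>2 + k)] (mod e)"
      by (intro cong_add cong_mult cong_pow cong_refl) (simp_all add: cong_def)
    ultimately have "e dvd 1 * (u3 mod e)\<^sup>2 + ((u1 mod e)\<^sup>2 + (u2 mod e)\<^sup>2 + k)"
      by (simp add: cong_dvd_iff add_ac)
    then show "p \<in> (SIGMA x:{0..<e}. SIGMA y:{0..<e}. Z x y)" using e0 p by (simp add: Z_def)
  qed
  ultimately have "card U \<le> card (SIGMA x:{0..<e}. SIGMA y:{0..<e}. Z x y)"
    using finZ by (intro card_inj_on_le) auto
  also have "\<dots> = (\<Sum>x\<in>{0..<e}. \<Sum>y\<in>{0..<e}. card (Z x y))" using finZ by simp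
  finally have "real (card U) \<le> (\<Sum>x\<in>{0..<e}. \<Sum>y\<in>{0..<e}. real (card (Z x y)))"
    by (simp only: of_nat_le_iff flip: of_nat_sum)
  also have "\<dots> \<le> (\<Sum>x\<in>{0..<e}. \<Sum>y\<in>{0..<e}. real (tau d))"
  proof (intro sum_mono)
    fix x y
    have "real (card (Z x y)) \<le> real_of_int (gcd 1 e) * tau e"
      unfolding Z_def by (rule card_quadratic_congruence_le[OF e0 sqe])
    also have "tau e \<le> tau d" by (rule tau_dvd_mono) (use d(1) dm in auto)
    then have "real_of_int (gcd 1 e) * tau e \<le> real (tau d)" by simp
    finally show "real (card (Z x y)) \<le> real (tau d)" .
  qed
  also have "\<dots> = real_of_int (e\<^sup>2) * tau d" using e0 by (simp add: power2_eq_square)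
  finally show ?thesis by (simp add: U_def)
qed

text \<open>The values \<open>t\<close> are sorted by \<open>e = gcd (2 * t) d\<close>, which must
  divide \<open>a\<close>. Each \<open>t\<close> carries about \<open>e\<^sup>2\<close> vectors
  \<open>u\<close>. For nonzero \<open>k\<close> boundedly many \<open>t\<close> occur up to
  \<open>tau d\<close>, giving \<open>e\<^sup>2\<close>; for \<open>k = 0\<close> there are at most
  \<open>2 * d / e\<close> of them, and only if \<open>d\<close> divides \<open>norm_sq a\<close>,
  giving \<open>d * e\<close>.\<close>

lemma card_survivors_le:
  fixes d k :: int and a :: "int \<times> int \<times> int"
  assumes d: "d > 0" "squarefree d"
  shows "real (card (survivors k d a)) \<le> (4 * \<bar>k\<bar> + 2) * (real (tau d))\<^sup>2 *
     (\<Sum>e | 0 < e \<and> e dvd d \<and> dvd3 e a. real_of_int (e\<^sup>2 + of_bool (d dvd norm_sq a) * d * e))"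
proof -
  obtain a1 a2 a3 where a: "a = (a1, a2, a3)" by (cases a)
  define A where "A = norm_sq a"
  define U where "U t = {(u1, u2, u3). (u1, u2, u3) \<in> box d \<and> d dvd u1\<^sup>2 + u2\<^sup>2 + u3\<^sup>2 + k \<and>
      dvd3 d (a1 + 2 * t * u1, a2 + 2 * t * u2, a3 + 2 * t * u3)}" for t
  have finU: "finite (U t)" for t by (rule finite_subset[OF _ finite_box[of d]]) (auto simp: U_def)
  define E where "E = {e. 0 < e \<and> e dvd d \<and> dvd3 e a}"
  have finE: "finite E" by (rule finite_subset[OF _ finite_pos_divisors[of d]]) (use d in \<open>auto simp: E_def\<close>)
  define T where "T e = {t \<in> {0..<d}. gcd (2 * t) d = e \<and> U t \<noteq> {}}" for e
  have finT: "finite (T e)" for e by (rule finite_subset[of _ "{0..<d}"]) (auto simp: T_def)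
  have congr: "d dvd 4 * k * t\<^sup>2 + A" if ne: "U t \<noteq> {}" for t
  proof -
    obtain u1 u2 u3 where u: "d dvd u1\<^sup>2 + u2\<^sup>2 + u3\<^sup>2 + k" "d dvd a1 + 2 * t * u1" "d dvd a2 + 2 * t * u2" "d dvd a3 + 2 * t * u3"
      using ne by (auto simp: U_def dvd3_def)
    \<comment> \<open>Elimination of \<open>u\<close>: modulo \<open>d\<close> each
      \<open>2 * t * u\<close> is the negative of the corresponding coordinate of
      \<open>a\<close>.\<close>
    have eq: "4 * k * t\<^sup>2 + A = 4 * t\<^sup>2 * (u1\<^sup>2 + u2\<^sup>2 + u3\<^sup>2 + k) + (a1 + 2 * t * u1) * (a1 - 2 * t * u1)
       + (a2 + 2 * t * u2) * (a2 - 2 * t * u2) + (a3 + 2 * t * u3) * (a3 - 2 * t * u3)"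
      by (simp add: A_def norm_sq_def a power2_eq_square algebra_simps)
    show ?thesis unfolding eq using u by (meson dvd_add dvd_mult dvd_mult2)
  qed
  have gcd_E: "gcd (2 * t) d \<in> E" if ne: "U t \<noteq> {}" for t
  proof -
    define e where "e = gcd (2 * t) d"
    have "e dvd a'" if "d dvd a' + 2 * t * u" for a' u
    proof -
      have "e dvd a' + 2 * t * u" using that by (rule dvd_trans[rotated]) (simp add: e_def)
      moreover have "e dvd 2 * t * u" by (rule dvd_mult2) (simp add: e_def)
      ultimately show ?thesis by (metis dvd_add_left_iff)
    qed
    then have "dvd3 e a" using ne by (auto simp: U_def dvd3_def a)
    then show ?thesis using d(1) by (simp add: E_def e_def)
  qed
  \<comment> \<open>The constant serves both cases: \<open>gcd (4 * k) d\<close> is at most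
    \<open>4 * \<bar>k\<bar>\<close> for nonzero \<open>k\<close>, and for \<open>k = 0\<close> the
    summand 2 covers the \<open>2 * d / e\<close> solutions of \<open>e dvd 2 * t\<close>.\<close>
  have cardT: "real (card (T e)) * real_of_int (e\<^sup>2) \<le> (4 * \<bar>k\<bar> + 2) * real (tau d) * real_of_int (e\<^sup>2 + of_bool (d dvd A) * d * e)"
    if e: "e \<in> E" for e
  proof -
    have e0: "e > 0" "e dvd d" using e by (auto simp: E_def)
    have tau1: "real (tau d) \<ge> 1" using tau_pos[of d] d(1) by simp
    show ?thesis
    proof (cases "k = 0")
      case False
      have "card (T e) \<le> card {t. 0 \<le> t \<and> t < d \<and> d dvd 4 * k * t\<^sup>2 + A}"
      proof (rule card_mono)
        show "finite {t. 0 \<le> t \<and> t < d \<and> d dvd 4 * k * t\<^sup>2 + A}"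
          by (rule finite_subset[of _ "{0..d}"]) auto
      qed (use congr in \<open>auto simp: T_def\<close>)
      then have "real (card (T e)) \<le> real (card {t. 0 \<le> t \<and> t < d \<and> d dvd 4 * k * t\<^sup>2 + A})" by simp
      also have "\<dots> \<le> real_of_int (gcd (4 * k) d) * tau d" by (rule card_quadratic_congruence_le[OF d])
      also have "gcd (4 * k) d \<le> 4 * \<bar>k\<bar> + 2" using dvd_imp_le_int[of "4 * k" "gcd (4 * k) d"] False by simp
      then have "real_of_int (gcd (4 * k) d) * tau d \<le> real_of_int (4 * \<bar>k\<bar> + 2) * tau d"
        by (intro mult_right_mono) (simp_all only: of_int_le_iff)
      finally have "real (card (T e)) \<le> (4 * \<bar>k\<bar> + 2) * real (tau d)" by simp
      then have "real (card (T e)) * real_of_int (e\<^sup>2) \<le> (4 * \<bar>k\<bar> + 2) * real (tau d) * real_of_int (e\<^sup>2)"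
        by (intro mult_right_mono) auto
      also have "\<dots> \<le> (4 * \<bar>k\<bar> + 2) * real (tau d) * real_of_int (e\<^sup>2 + of_bool (d dvd A) * d * e)"
        using d(1) e0 by (intro mult_left_mono) auto
      finally show ?thesis .
    next
      case True
      show ?thesis
      proof (cases "d dvd A")
        case False
        then have "T e = {}" using congr True by (auto simp: T_def)
        then show ?thesis using d(1) e0 by simp
      next
        case dA: True
        define m where "m = d div e"
        have dm: "d = e * m" using e0 by (simp add: m_def)
        have m0: "m > 0" using d(1) e0 dm by (simp add: zero_less_mult_iff)
        have "T e \<subseteq> {t. 0 \<le> t \<and> t < d \<and> e dvd 2 * t}" by (auto simp: T_def)
        moreover have "card {t. 0 \<le> t \<and> t < d \<and> e dvd 2 * t} \<le> card {0..<2 * m}"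
        proof (rule card_inj_on_le[of "\<lambda>t. 2 * t div e"])
          show "inj_on (\<lambda>t. 2 * t div e) {t. 0 \<le> t \<and> t < d \<and> e dvd 2 * t}"
            by (rule inj_onI) (auto simp: dvd_div_eq_iff dest: dvd_div_eq_cancel)
          show "(\<lambda>t. 2 * t div e) ` {t. 0 \<le> t \<and> t < d \<and> e dvd 2 * t} \<subseteq> {0..<2 * m}"
          proof clarify
            fix t assume t: "0 \<le> t" "t < d" "e dvd 2 * t"
            then obtain s where s: "2 * t = e * s" by (auto simp: dvd_def)
            have "e * s < e * (2 * m)" "0 \<le> e * s" using t s dm by auto
            then show "2 * t div e \<in> {0..<2 * m}" using e0 s by (simp add: zero_le_mult_iff)
          qed
        qed simp
        moreover have "finite {t. 0 \<le> t \<and> t < d \<and> e dvd 2 * t}" by (rule finite_subset[of _ "{0..d}"]) auto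
        ultimately have "card (T e) \<le> nat (2 * m)" by (metis card_atLeastLessThan_int card_mono diff_zero le_trans)
        then have "real (card (T e)) \<le> real_of_int (2 * m)" using m0 by linarith
        then have "real (card (T e)) * real_of_int (e\<^sup>2) \<le> real_of_int (2 * m) * real_of_int (e\<^sup>2)"
          by (intro mult_right_mono) auto
        also have "\<dots> = 2 * 1 * (real_of_int (d * e))" by (simp add: dm power2_eq_square)
        also have "\<dots> \<le> 2 * real (tau d) * real_of_int (e\<^sup>2 + d * e)"
          using tau1 d(1) e0 by (intro mult_mono) auto
        finally show ?thesis using True dA by simp
      qed
    qed
  qed
  have "survivors k d a \<subseteq> (\<lambda>(e, t, u). (u, t)) ` (SIGMA e:E. SIGMA t:T e. U t)"
  proof
    fix p assume "p \<in> survivors k d a"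
    then obtain u1 u2 u3 t where p: "p = ((u1, u2, u3), t)" "(u1, u2, u3) \<in> U t" "t \<in> {0..<d}"
      by (auto simp: survivors_def U_def a)
    then have "(gcd (2 * t) d, t, (u1, u2, u3)) \<in> (SIGMA e:E. SIGMA t:T e. U t)"
      using gcd_E[of t] by (auto simp: T_def)
    then show "p \<in> (\<lambda>(e, t, u). (u, t)) ` (SIGMA e:E. SIGMA t:T e. U t)" unfolding p(1)
      by (intro image_eqI[of _ _ "(gcd (2 * t) d, t, (u1, u2, u3))"]) simp_all
  qed
  then have "card (survivors k d a) \<le> card (SIGMA e:E. SIGMA t:T e. U t)"
    using finE finT finU by (intro surj_card_le) auto
  also have "\<dots> = (\<Sum>e\<in>E. \<Sum>t\<in>T e. card (U t))" using finE finT finU by simp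
  finally have "real (card (survivors k d a)) \<le> (\<Sum>e\<in>E. \<Sum>t\<in>T e. real (card (U t)))"
    by (simp only: of_nat_le_iff flip: of_nat_sum)
  also have "\<dots> \<le> (\<Sum>e\<in>E. \<Sum>t\<in>T e. real_of_int (e\<^sup>2) * tau d)"
    unfolding U_def by (intro sum_mono card_survivors_fibre_le[OF d]) (auto simp: T_def)
  also have "\<dots> = (\<Sum>e\<in>E. (real (card (T e)) * real_of_int (e\<^sup>2)) * tau d)" by (simp add: mult.assoc)
  also have "\<dots> \<le> (\<Sum>e\<in>E. ((4 * \<bar>k\<bar> + 2) * real (tau d) * real_of_int (e\<^sup>2 + of_bool (d dvd A) * d * e)) * tau d)"
    by (intro sum_mono mult_right_mono cardT) auto
  also have "\<dots> = (4 * \<bar>k\<bar> + 2) * (real (tau d))\<^sup>2 * (\<Sum>e\<in>E. real_of_int (e\<^sup>2 + of_bool (d dvd A) * d * e))"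
    by (simp add: sum_distrib_left power2_eq_square mult_ac)
  finally show ?thesis by (simp add: E_def A_def)
qed

section \<open>Additive characters\<close>

text \<open>The additive character usually written e(n/q), with e(x) = exp(2 pi i x).\<close>

definition add_char :: "int \<Rightarrow> int \<Rightarrow> complex" where
  "add_char q n = cis (2 * pi * (real_of_int n / real_of_int q))"

lemma add_char_0 [simp]: "add_char q 0 = 1"
  by (simp add: add_char_def)

lemma norm_add_char [simp]: "norm (add_char q n) = 1"
  by (simp add: add_char_def)

lemma add_char_add: "add_char q (m + n) = add_char q m * add_char q n"
  by (simp add: add_char_def cis_mult add_divide_distrib distrib_left)

lemma add_char_eq_1_iff:
  assumes "q > 0"
  shows "add_char q n = 1 \<longleftrightarrow> q dvd n"
proof
  assume "add_char q n = 1"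
  then have "cos (2 * pi * (real_of_int n / real_of_int q)) = 1" by (simp add: add_char_def complex_eq_iff)
  then obtain m :: int where "2 * pi * (real_of_int n / real_of_int q) = of_int m * 2 * pi"
    using cos_one_2pi_int by auto
  then have "2 * pi * (real_of_int n / real_of_int q) = 2 * pi * of_int m" by (simp only: mult_ac)
  then have "real_of_int n / real_of_int q = of_int m" by (rule mult_left_cancel[THEN iffD1, rotated]) simp
  then have "real_of_int n = real_of_int (q * m)" using assms by (simp add: field_simps)
  then have "n = q * m" by linarith
  then show "q dvd n" by simp
next
  assume "q dvd n"
  then obtain m where "n = q * m" by (elim dvdE)
  then show "add_char q n = 1" using assms cis_multiple_2pi[of "of_int m"] by (simp add: add_char_def)
qed

lemma add_char_mult_cancel: "d > 0 \<Longrightarrow> add_char (d * q) (d * n) = add_char q n"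
  by (simp add: add_char_def)

lemma add_char_nat_mult: "add_char q (int j * n) = add_char q n ^ j"
proof -
  have "add_char q n ^ j = cis (real j * (2 * pi * (real_of_int n / real_of_int q)))"
    by (simp only: add_char_def Complex.DeMoivre)
  also have "\<dots> = add_char q (int j * n)" unfolding add_char_def by (rule arg_cong[of _ _ cis]) simp
  finally show ?thesis ..
qed

lemma sum_add_char:
  assumes "d > 0"
  shows "(\<Sum>t\<in>{0..<d}. add_char d (t * n)) = of_bool (d dvd n) * of_int d"
proof -
  define z where "z = add_char d n"
  have "(\<Sum>t\<in>{0..<d}. add_char d (t * n)) = (\<Sum>j<nat d. z ^ j)"
    by (rule sum.reindex_bij_witness[of _ int nat]) (use assms in \<open>auto simp: z_def simp flip: add_char_nat_mult\<close>)
  also have "\<dots> = of_bool (d dvd n) * of_int d"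
  proof (cases "d dvd n")
    case True
    then have "z = 1" using assms add_char_eq_1_iff z_def by simp
    then show ?thesis using True assms by simp
  next
    case False
    then have "z \<noteq> 1" using assms add_char_eq_1_iff z_def by simp
    moreover have "z ^ nat d = 1" unfolding z_def add_char_nat_mult[symmetric]
      using assms by (simp add: add_char_eq_1_iff)
    ultimately show ?thesis using False by (simp add: geometric_sum)
  qed
  finally show ?thesis .
qed

lemma sum_periodic_shift:
  fixes f :: "int \<Rightarrow> 'a::comm_monoid_add"
  assumes q: "q > 0" and per: "\<And>n. f (n mod q) = f n"
  shows "(\<Sum>a\<in>{c..<c + q}. f a) = (\<Sum>a\<in>{0..<q}. f a)"
proof (rule sum.reindex_bij_witness[of _ "\<lambda>a. c + (a - c) mod q" "\<lambda>a. a mod q"])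
  fix a assume a: "a \<in> {c..<c + q}"
  have "(a mod q - c) mod q = (a - c) mod q" by (simp add: mod_simps)
  also have "\<dots> = a - c" using a by simp
  finally show "c + (a mod q - c) mod q = a" by simp
next
  fix a assume a: "a \<in> {0..<q}"
  have "(c + (a - c) mod q) mod q = (c + (a - c)) mod q" by (simp only: mod_add_right_eq)
  then show "(c + (a - c) mod q) mod q = a" using a by simp
qed (use q per in auto)

text \<open>Orthogonality over an arbitrary window of length \<open>q\<close>, needed because the
  frequencies are taken from a window around 0.\<close>

lemma sum_add_char_shift:
  assumes "q > 0"
  shows "(\<Sum>t\<in>{c..<c + q}. add_char q (t * n)) = of_bool (q dvd n) * of_int q"
proof -
  have "add_char q (t mod q * n) = add_char q (t * n)" for t
  proof -
    have "add_char q (t * n) = add_char q (t mod q * n + q * (t div q * n))"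
      by (metis (no_types, opaque_lifting) mult.assoc distrib_right mod_mult_div_eq)
    also have "\<dots> = add_char q (t mod q * n)" unfolding add_char_add using assms by (simp add: add_char_eq_1_iff)
    finally show ?thesis ..
  qed
  then show ?thesis using sum_periodic_shift[of q "\<lambda>t. add_char q (t * n)" c] sum_add_char[of q n] assms by simp
qed

section \<open>Incomplete geometric sums\<close>

text \<open>Up to \<open>pi / 3\<close> the function \<open>sin t - t / 2\<close> increases, as its
  derivative is \<open>cos t - 1 / 2\<close>; beyond, \<open>sin x\<close> is at least 0.85 while
  \<open>x / 2\<close> stays below 0.8.\<close>

lemma sin_ge_half:
  fixes x :: real
  assumes "0 \<le> x" "x \<le> pi / 2"
  shows "x / 2 \<le> sin x"
proof (cases "x \<le> pi / 3")
  case True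
  have "sin 0 - 0 / 2 \<le> sin x - x / 2"
  proof (rule DERIV_nonneg_imp_nondecreasing[of 0 x "\<lambda>t. sin t - t / 2"])
    fix t assume t: "0 \<le> t" "t \<le> x"
    have "cos (pi / 3) \<le> cos t" using t True by (intro cos_monotone_0_pi_le) auto
    then have "0 \<le> cos t - 1 / 2" by (simp add: cos_60)
    moreover have "((\<lambda>t. sin t - t / 2) has_real_derivative (cos t - 1 / 2)) (at t)"
      by (auto intro!: derivative_eq_intros)
    ultimately show "\<exists>y. ((\<lambda>t. sin t - t / 2) has_real_derivative y) (at t) \<and> 0 \<le> y" by blast
  qed (use assms in auto)
  then show ?thesis by simp
next
  case False
  have "sin (pi / 3) \<le> sin x" using False assms by (intro sin_monotone_2pi_le) auto
  moreover have "sin (pi / 3) = sqrt 3 / 2" by (rule sin_60)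
  moreover have "sqrt 3 \<ge> 17 / 10" by (rule real_le_rsqrt) (simp add: power2_eq_square)
  moreover have "pi < 3.2" using pi_less_4 pi_approx by simp
  ultimately show ?thesis using assms by simp
qed

text \<open>A geometric sum with ratio \<open>z\<close> is at most \<open>2 / norm (z - 1)\<close>,
  and \<open>norm (z - 1)\<close> is twice the sine of \<open>pi * \<bar>a\<bar> / q\<close>. The
  hypothesis on \<open>a\<close> keeps this angle at most \<open>pi / 2\<close>.\<close>

lemma norm_sum_add_char_le:
  fixes q a :: int
  assumes a: "a \<noteq> 0" "2 * \<bar>a\<bar> \<le> q"
  shows "norm (\<Sum>x\<in>{1..int N}. add_char q (a * x)) \<le> real_of_int q / \<bar>real_of_int a\<bar>"
proof -
  have q: "q > 0" using a by simp
  define z where "z = add_char q a"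
  define \<theta> where "\<theta> = pi * (\<bar>real_of_int a\<bar> / real_of_int q)"
  have "real_of_int (2 * \<bar>a\<bar>) \<le> real_of_int q" using a(2) by (simp only: of_int_le_iff)
  then have aq: "\<bar>real_of_int a\<bar> / real_of_int q \<le> 1 / 2" using q by (simp add: field_simps)
  have "norm (z - 1) = 2 * \<bar>sin (2 * pi * (real_of_int a / real_of_int q) / 2)\<bar>"
    using dist_exp_i_1[of "2 * pi * (real_of_int a / real_of_int q)"]
    by (simp add: z_def add_char_def cis_conv_exp)
  also have "\<bar>sin (2 * pi * (real_of_int a / real_of_int q) / 2)\<bar> = \<bar>sin \<theta>\<bar>"
    by (cases "a \<ge> 0") (auto simp: \<theta>_def)
  finally have nz: "norm (z - 1) = 2 * \<bar>sin \<theta>\<bar>" .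
  have "\<theta> / 2 \<le> sin \<theta>"
  proof (rule sin_ge_half)
    show "\<theta> \<le> pi / 2" using mult_left_mono[OF aq, of pi] by (simp add: \<theta>_def)
  qed (use q in \<open>simp add: \<theta>_def\<close>)
  moreover have "\<theta> \<ge> 2 * (\<bar>real_of_int a\<bar> / real_of_int q)"
    unfolding \<theta>_def using pi_ge_two q by (intro mult_right_mono) auto
  ultimately have nz2: "norm (z - 1) \<ge> 2 * (\<bar>real_of_int a\<bar> / real_of_int q)" using nz by linarith
  have pos: "\<bar>real_of_int a\<bar> / real_of_int q > 0" using a q by simp
  then have z1: "z \<noteq> 1" using nz2 by auto
  have term_eq: "add_char q (a * x) = z * z ^ nat (x - 1)" if "x \<ge> 1" for x
  proof -
    have "a * x = a + int (nat (x - 1)) * a" using that by (simp add: algebra_simps)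
    then show ?thesis by (simp only: add_char_add add_char_nat_mult z_def)
  qed
  have "(\<Sum>x\<in>{1..int N}. add_char q (a * x)) = (\<Sum>j<N. z * z ^ j)"
    by (rule sum.reindex_bij_witness[of _ "\<lambda>j. int j + 1" "\<lambda>x. nat (x - 1)"]) (auto simp: term_eq)
  also have "\<dots> = z * ((z ^ N - 1) / (z - 1))" using z1 by (simp add: geometric_sum flip: sum_distrib_left)
  also have "norm \<dots> \<le> 2 / norm (z - 1)"
  proof -
    have "norm (z ^ N - 1) \<le> norm (z ^ N) + norm (1::complex)" by (rule norm_triangle_ineq4)
    then have "norm (z ^ N - 1) \<le> 2" by (simp add: norm_power z_def)
    then show ?thesis by (simp add: norm_mult norm_divide z_def divide_right_mono)
  qed
  also have "\<dots> \<le> 2 / (2 * (\<bar>real_of_int a\<bar> / real_of_int q))" using nz2 pos by (intro frac_le) linarith+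
  also have "\<dots> = real_of_int q / \<bar>real_of_int a\<bar>" by simp
  finally show ?thesis .
qed

section \<open>Complete exponential sums modulo a square\<close>

definition dot :: "int \<times> int \<times> int \<Rightarrow> int \<times> int \<times> int \<Rightarrow> int" where
  "dot = (\<lambda>(a, b, c) (x, y, z). a * x + b * y + c * z)"

lemma sum_triple_mult:
  fixes f g h :: "'b \<Rightarrow> 'a::comm_semiring_0"
  shows "(\<Sum>(x, y, z)\<in>A \<times> B \<times> C. f x * (g y * h z)) = sum f A * (sum g B * sum h C)"
proof -
  have "sum g B * sum h C = (\<Sum>(y, z)\<in>B \<times> C. g y * h z)"
    by (simp add: sum_product sum.cartesian_product)
  then have "sum f A * (sum g B * sum h C) = (\<Sum>x\<in>A. \<Sum>p\<in>B \<times> C. f x * (case p of (y, z) \<Rightarrow> g y * h z))"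
    by (simp add: sum_product)
  also have "\<dots> = (\<Sum>(x, y, z)\<in>A \<times> B \<times> C. f x * (g y * h z))"
    by (simp add: sum.cartesian_product split_def)
  finally show ?thesis ..
qed

lemma sum_add_char_dot:
  "(\<Sum>v\<in>A \<times> B \<times> C. add_char d (dot v (x, y, z))) =
     (\<Sum>a\<in>A. add_char d (a * x)) * ((\<Sum>a\<in>B. add_char d (a * y)) * (\<Sum>a\<in>C. add_char d (a * z)))"
  by (subst sum_triple_mult[symmetric]) (auto intro!: sum.cong simp: dot_def add_char_add mult.assoc)

text \<open>Writing \<open>y = u + d v\<close>, the condition \<open>d\<^sup>2 | |y|\<^sup>2 + k\<close> becomes linear in \<open>v\<close>; detecting it by
  additive characters leaves a complete sum over \<open>v\<close>.\<close>
lemma norm_exp_sum_le: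
  fixes d k :: int
  assumes d: "d > 0"
  shows "norm (\<Sum>y | y \<in> box (d\<^sup>2) \<and> d\<^sup>2 dvd norm_sq y + k. add_char (d\<^sup>2) (dot b y))
     \<le> real_of_int (d\<^sup>2) * card (survivors k d b)"
proof -
  obtain b1 b2 b3 where b: "b = (b1, b2, b3)" by (cases b)
  define W where "W = {u \<in> box d. d dvd norm_sq u + k}"
  have finW: "finite W" by (simp add: W_def)
  define shift where "shift = (\<lambda>(u1, u2, u3) (v1, v2, v3). (u1 + d * v1, u2 + d * v2, u3 + d * v3))"
  \<comment> \<open>The total frequency of \<open>v\<close>: \<open>b\<close> from the phase, and
    \<open>2 * t * u\<close> from the character that detects the linear condition.\<close>
  define lin where "lin u t = (\<lambda>(u1, u2, u3). (b1 + 2 * t * u1, b2 + 2 * t * u2, b3 + 2 * t * u3)) u" for u t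
  define f where "f u = (norm_sq u + k) div d" for u
  have F_shift: "norm_sq (shift u v) + k = (norm_sq u + k) + d * (2 * dot u v) + d\<^sup>2 * norm_sq v" for u v
    by (cases u; cases v) (simp add: norm_sq_def shift_def dot_def power2_eq_square algebra_simps)
  have dvd_shift: "d\<^sup>2 dvd norm_sq (shift u v) + k \<longleftrightarrow> u \<in> W \<and> d dvd f u + 2 * dot u v" if u: "u \<in> box d" for u v
  proof (cases "d dvd norm_sq u + k")
    case True
    then have eq: "norm_sq u + k = d * f u" by (simp add: f_def)
    have "norm_sq (shift u v) + k = d\<^sup>2 * norm_sq v + d * (f u + 2 * dot u v)"
      unfolding F_shift eq by (simp add: algebra_simps)
    then have "d\<^sup>2 dvd norm_sq (shift u v) + k \<longleftrightarrow> d\<^sup>2 dvd d * (f u + 2 * dot u v)"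
      by (simp add: dvd_add_right_iff)
    also have "\<dots> \<longleftrightarrow> d dvd f u + 2 * dot u v" using d by (simp add: power2_eq_square)
    finally show ?thesis using True u by (simp add: W_def)
  next
    case False
    have "\<not> d\<^sup>2 dvd norm_sq (shift u v) + k"
    proof
      assume "d\<^sup>2 dvd norm_sq (shift u v) + k"
      then have "d dvd norm_sq (shift u v) + k" by (rule dvd_trans[rotated]) (simp add: power2_eq_square)
      then show False using False unfolding F_shift
        by (metis add.assoc distrib_left dvd_add_left_iff dvd_triv_left mult.assoc power2_eq_square)
    qed
    then show ?thesis using False by (simp add: W_def)
  qed
  have char_shift: "add_char (d\<^sup>2) (dot b (shift u v)) = add_char (d\<^sup>2) (dot b u) * add_char d (dot b v)" for u v
  proof -
    have "dot b (shift u v) = dot b u + d * dot b v"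
      by (cases u; cases v) (simp add: shift_def dot_def b algebra_simps)
    then show ?thesis using add_char_mult_cancel[OF d, of d] by (simp add: add_char_add power2_eq_square)
  qed
  \<comment> \<open>Splitting off the last digit in base \<open>d\<close> inverts
    \<open>shift\<close>.\<close>
  define digits where "digits = (\<lambda>(y1, y2, y3). ((y1 mod d, y2 mod d, y3 mod d), (y1 div d, y2 div d, y3 div d)))"
  define S where "S = {y. y \<in> box (d\<^sup>2) \<and> d\<^sup>2 dvd norm_sq y + k}"
  define T where "T = {(u, v). (u, v) \<in> W \<times> box d \<and> d dvd f u + 2 * dot u v}"
  have digits: "case_prod shift (digits y) = y \<and> digits y \<in> T" if yS: "y \<in> S" for y
  proof -
    obtain y1 y2 y3 where y123: "y = (y1, y2, y3)" by (cases y)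
    define u v where "u = (y1 mod d, y2 mod d, y3 mod d)" and "v = (y1 div d, y2 div d, y3 div d)"
    have sp: "digits y = (u, v)" by (simp add: digits_def u_def v_def y123)
    have sh: "shift u v = y" by (simp add: shift_def u_def v_def y123)
    have vdiv: "n div d \<in> {0..<d}" if n: "n \<in> {0..<d\<^sup>2}" for n
    proof -
      have "d * (n div d) \<le> n" using d by (simp flip: minus_mod_eq_mult_div)
      then have "d * (n div d) < d * d" using n by (simp add: power2_eq_square)
      then show ?thesis using d n by (simp add: pos_imp_zdiv_nonneg_iff)
    qed
    have ub: "u \<in> box d" using d by (simp add: box_def u_def)
    have vb: "v \<in> box d" using yS vdiv by (simp add: box_def v_def S_def y123)
    have "d\<^sup>2 dvd norm_sq (shift u v) + k" unfolding sh using yS by (simp add: S_def)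
    then have "u \<in> W \<and> d dvd f u + 2 * dot u v" by (simp only: dvd_shift[OF ub])
    then show ?thesis using sh vb by (simp add: T_def sp)
  qed
  have join: "digits (case_prod shift p) = p \<and> case_prod shift p \<in> S" if pT: "p \<in> T" for p
  proof -
    obtain u v where p: "p = (u, v)" by (cases p)
    obtain u1 u2 u3 where u: "u = (u1, u2, u3)" by (cases u)
    obtain v1 v2 v3 where v: "v = (v1, v2, v3)" by (cases v)
    have uv: "u \<in> W" "v \<in> box d" "d dvd f u + 2 * dot u v" using pT by (auto simp: T_def p)
    then have ub: "u \<in> box d" by (simp add: W_def)
    have u': "u1 \<in> {0..<d}" "u2 \<in> {0..<d}" "u3 \<in> {0..<d}" using ub by (auto simp: box_def u)
    have md: "x mod d = x" "(x + d * v) mod d = x" "(x + d * v) div d = v" if "x \<in> {0..<d}" for x v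
      using that by auto
    have rng: "x + d * v \<in> {0..<d\<^sup>2}" if x: "x \<in> {0..<d}" "v \<in> {0..<d}" for x v
    proof -
      have "d * (v + 1) \<le> d * d" using x d by (intro mult_left_mono) auto
      then have "x + d * v < d\<^sup>2" using x by (simp add: power2_eq_square distrib_left)
      then show ?thesis using x d by simp
    qed
    have "digits (shift u v) = (u, v)" using u' by (simp add: shift_def digits_def md u v del: atLeastLessThan_iff)
    moreover have "shift u v \<in> box (d\<^sup>2)"
      using u' uv(2) by (simp add: shift_def box_def rng u v del: atLeastLessThan_iff)
    ultimately show ?thesis using dvd_shift[OF ub] uv by (simp add: S_def p)
  qed
  have reindex: "(\<Sum>y\<in>S. add_char (d\<^sup>2) (dot b y)) = (\<Sum>(u, v)\<in>T. add_char (d\<^sup>2) (dot b (shift u v)))"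
  proof (rule sum.reindex_bij_witness[of _ "case_prod shift" digits])
    fix y assume "y \<in> S"
    then have "case_prod shift (digits y) = y" using digits by blast
    then show "(case digits y of (u, v) \<Rightarrow> add_char (d\<^sup>2) (dot b (shift u v))) = add_char (d\<^sup>2) (dot b y)"
      by (cases "digits y") simp
  qed (use digits join in blast)+
  have "(\<Sum>y\<in>S. add_char (d\<^sup>2) (dot b y)) =
      (\<Sum>u\<in>W. \<Sum>v\<in>box d. of_bool (d dvd f u + 2 * dot u v) * (add_char (d\<^sup>2) (dot b u) * add_char d (dot b v)))"
    unfolding reindex sum.cartesian_product
    by (rule sum.mono_neutral_cong_left) (use finW in \<open>auto simp: char_shift T_def\<close>)
  \<comment> \<open>The factor \<open>d\<close> turns the indicator of the linear condition into a
    full character sum over \<open>t\<close>.\<close>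
  then have "of_int d * (\<Sum>y\<in>S. add_char (d\<^sup>2) (dot b y)) =
      (\<Sum>u\<in>W. \<Sum>v\<in>box d. (of_bool (d dvd f u + 2 * dot u v) * of_int d) * (add_char (d\<^sup>2) (dot b u) * add_char d (dot b v)))"
    by (simp add: sum_distrib_left mult_ac)
  also have "\<dots> = (\<Sum>u\<in>W. \<Sum>v\<in>box d. (\<Sum>t\<in>{0..<d}. add_char d (t * (f u + 2 * dot u v))) * (add_char (d\<^sup>2) (dot b u) * add_char d (dot b v)))"
    by (simp add: sum_add_char[OF d])
  also have "\<dots> = (\<Sum>u\<in>W. \<Sum>v\<in>box d. \<Sum>t\<in>{0..<d}. (add_char (d\<^sup>2) (dot b u) * add_char d (t * f u)) * add_char d (dot v (lin u t)))"
  proof (intro sum.cong refl)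
    fix u v
    have "add_char d (t * (f u + 2 * dot u v)) * (add_char (d\<^sup>2) (dot b u) * add_char d (dot b v)) =
       (add_char (d\<^sup>2) (dot b u) * add_char d (t * f u)) * add_char d (dot v (lin u t))" for t
    proof -
      have "dot v (lin u t) = t * (2 * dot u v) + dot b v"
        by (cases u; cases v) (simp add: dot_def lin_def b algebra_simps)
      then have "add_char d (dot v (lin u t)) = add_char d (t * (2 * dot u v)) * add_char d (dot b v)"
        by (simp only: add_char_add)
      then show ?thesis by (simp add: distrib_left add_char_add)
    qed
    then show "(\<Sum>t\<in>{0..<d}. add_char d (t * (f u + 2 * dot u v))) * (add_char (d\<^sup>2) (dot b u) * add_char d (dot b v)) =
      (\<Sum>t\<in>{0..<d}. (add_char (d\<^sup>2) (dot b u) * add_char d (t * f u)) * add_char d (dot v (lin u t)))"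
      by (simp only: sum_distrib_right)
  qed
  also have "\<dots> = (\<Sum>u\<in>W. \<Sum>t\<in>{0..<d}. (add_char (d\<^sup>2) (dot b u) * add_char d (t * f u)) * (\<Sum>v\<in>box d. add_char d (dot v (lin u t))))"
    by (subst sum.swap) (simp add: sum_distrib_left)
  \<comment> \<open>The complete sum over \<open>v\<close> is \<open>d ^ 3\<close> if
    \<open>d\<close> divides every coordinate of \<open>lin u t\<close> and 0 otherwise, so exactly
    the pairs in \<open>survivors k d b\<close> remain. Cancelling the factor \<open>d\<close>
    leaves \<open>d\<^sup>2\<close> for each of them.\<close>
  also have "\<dots> = (\<Sum>u\<in>W. \<Sum>t\<in>{0..<d}. (add_char (d\<^sup>2) (dot b u) * add_char d (t * f u)) * (of_bool (dvd3 d (lin u t)) * of_int d ^ 3))"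
  proof -
    have "(\<Sum>v\<in>box d. add_char d (dot v w)) = of_bool (dvd3 d w) * of_int d ^ 3" for w
      by (cases w) (auto simp: box_def sum_add_char_dot sum_add_char[OF d] dvd3_def power3_eq_cube)
    then show ?thesis by simp
  qed
  finally have expand: "of_int d * (\<Sum>y\<in>S. add_char (d\<^sup>2) (dot b y)) = \<dots>" .
  have "norm (of_int d * (\<Sum>y\<in>S. add_char (d\<^sup>2) (dot b y)))
     \<le> (\<Sum>u\<in>W. \<Sum>t\<in>{0..<d}. of_bool (dvd3 d (lin u t)) * real_of_int d ^ 3)"
    unfolding expand by (intro sum_norm_le) (use d in \<open>simp add: norm_mult norm_power\<close>)
  also have "\<dots> = real (card (survivors k d b)) * real_of_int d ^ 3"
  proof -
    have "(\<Sum>u\<in>W. \<Sum>t\<in>{0..<d}. of_bool (dvd3 d (lin u t)) * real_of_int d ^ 3) =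
       (\<Sum>p\<in>W \<times> {0..<d}. of_bool (dvd3 d (lin (fst p) (snd p))) * real_of_int d ^ 3)"
      by (simp only: sum.cartesian_product split_def)
    also have "\<dots> = (\<Sum>p\<in>survivors k d b. real_of_int d ^ 3)"
      by (rule sum.mono_neutral_cong_right)
         (use finW in \<open>auto simp: survivors_def W_def lin_def b norm_sq_def\<close>)
    finally show ?thesis by simp
  qed
  finally have "real_of_int d * norm (\<Sum>y\<in>S. add_char (d\<^sup>2) (dot b y))
      \<le> real_of_int d * (real_of_int (d\<^sup>2) * card (survivors k d b))"
    using d by (simp add: norm_mult power2_eq_square power3_eq_cube mult_ac)
  then show ?thesis using d by (simp add: S_def)
qed

section \<open>Fourier expansion of the counting function\<close>

definition cube_count :: "nat \<Rightarrow> int \<Rightarrow> int \<Rightarrow> nat" where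
  "cube_count N k q = card {x \<in> {1..int N} \<times> {1..int N} \<times> {1..int N}. q dvd norm_sq x + k}"

definition residue_count :: "int \<Rightarrow> int \<Rightarrow> nat" where
  "residue_count k q = card {y \<in> box q. q dvd norm_sq y + k}"

text \<open>A residue system modulo \<open>q\<close> centred at 0 for either parity of
  \<open>q\<close>, so that the bound \<open>q / \<bar>a\<bar>\<close> for geometric sums applies to
  every nonzero member.\<close>

definition freqs :: "int \<Rightarrow> int set" where
  "freqs q = {- ((q - 1) div 2)..<- ((q - 1) div 2) + q}"

lemma abs_freqs_le: "a \<in> freqs q \<Longrightarrow> 2 * \<bar>a\<bar> \<le> q"
  by (auto simp: freqs_def)

lemma finite_freqs [simp]: "finite (freqs q)"
  by (simp add: freqs_def)

lemma zero_in_freqs: "q > 0 \<Longrightarrow> 0 \<in> freqs q"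
  by (auto simp: freqs_def)

text \<open>The bound for the sum of characters over \<open>{1..N}\<close>, divided by
  \<open>q\<close>: trivial at frequency 0, geometric elsewhere.\<close>

definition weight :: "nat \<Rightarrow> int \<Rightarrow> int \<Rightarrow> real" where
  "weight N q a = (if a = 0 then real N / real_of_int q else 1 / \<bar>real_of_int a\<bar>)"

lemma weight_nonneg: "q > 0 \<Longrightarrow> weight N q a \<ge> 0"
  by (simp add: weight_def)

definition weight3 :: "nat \<Rightarrow> int \<Rightarrow> int \<times> int \<times> int \<Rightarrow> real" where
  "weight3 N q = (\<lambda>(a, b, c). weight N q a * (weight N q b * weight N q c))"

lemma norm_sum_add_char_le_weight:
  assumes "a \<in> freqs q" "q > 0"
  shows "norm (\<Sum>x\<in>{1..int N}. add_char q (x * - a)) \<le> real_of_int q * weight N q a"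
proof (cases "a = 0")
  case False
  have "norm (\<Sum>x\<in>{1..int N}. add_char q (- a * x)) \<le> real_of_int q / \<bar>real_of_int (- a)\<bar>"
    using False abs_freqs_le[OF assms(1)] by (intro norm_sum_add_char_le) auto
  then show ?thesis using False by (simp add: weight_def mult.commute)
qed (use assms in \<open>simp add: weight_def\<close>)

text \<open>Each \<open>x\<close> is matched with its residue \<open>y\<close> modulo
  \<open>q = d\<^sup>2\<close> by orthogonality in all three coordinates. Frequency 0 gives the main
  term; at every other one a complete sum over \<open>y\<close> meets a product of three incomplete
  sums over \<open>x\<close>.\<close>

lemma cube_count_error_le:
  fixes d k :: int
  assumes d: "d > 0"
  shows "\<bar>real (cube_count N k (d\<^sup>2)) - real (residue_count k (d\<^sup>2)) / real_of_int d ^ 6 * real N ^ 3\<bar>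
    \<le> (\<Sum>a\<in>freqs (d\<^sup>2) \<times> freqs (d\<^sup>2) \<times> freqs (d\<^sup>2) - {(0, 0, 0)}.
         weight3 N (d\<^sup>2) a * (real_of_int (d\<^sup>2) * card (survivors k d a)))"
proof -
  define q where "q = d\<^sup>2"
  have q: "q > 0" using d by (simp add: q_def)
  define A where "A = freqs q \<times> freqs q \<times> freqs q"
  have finA: "finite A" by (simp add: A_def)
  define X where "X = {1..int N} \<times> {1..int N} \<times> {1..int N}"
  have finX: "finite X" by (simp add: X_def)
  define Y where "Y = {y \<in> box q. q dvd norm_sq y + k}"
  have finY: "finite Y" by (simp add: Y_def)
  define neg where "neg = (\<lambda>(a1::int, a2::int, a3::int). (- a1, - a2, - a3))"
  define G where "G a = (\<Sum>x\<in>X. add_char q (dot x (neg a)))" for a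
  define S where "S a = (\<Sum>y\<in>Y. add_char q (dot a y))" for a
  have sum_freqs: "(\<Sum>a\<in>freqs q. add_char q (a * n)) = of_bool (q dvd n) * of_int q" for n
    unfolding freqs_def by (rule sum_add_char_shift[OF q])
  \<comment> \<open>Orthogonality: the sum over all frequencies singles out the one \<open>y\<close>
    in the box congruent to \<open>x\<close>.\<close>
  have detect: "(\<Sum>a\<in>A. add_char q (dot a y) * add_char q (dot x (neg a))) = of_bool (y = (\<lambda>(x1, x2, x3). (x1 mod q, x2 mod q, x3 mod q)) x) * of_int q ^ 3"
    if y: "y \<in> box q" for x y
  proof -
    obtain x1 x2 x3 where x: "x = (x1, x2, x3)" by (cases x)
    obtain y1 y2 y3 where y123: "y = (y1, y2, y3)" by (cases y)
    have "add_char q (dot a y) * add_char q (dot x (neg a)) = add_char q (dot a (y1 - x1, y2 - x2, y3 - x3))" for a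
      by (cases a) (simp add: dot_def neg_def x y123 algebra_simps flip: add_char_add)
    then have "(\<Sum>a\<in>A. add_char q (dot a y) * add_char q (dot x (neg a)))
        = of_bool (q dvd y1 - x1 \<and> q dvd y2 - x2 \<and> q dvd y3 - x3) * of_int q ^ 3"
      by (simp add: A_def sum_add_char_dot sum_freqs power3_eq_cube)
    moreover have "q dvd yi - xi \<longleftrightarrow> yi = xi mod q" if "yi \<in> {0..<q}" for xi yi
      using that by (auto simp flip: mod_eq_dvd_iff)
    ultimately show ?thesis using y by (simp add: x y123 box_def)
  qed
  have "{x \<in> X. q dvd norm_sq x + k} = X \<inter> {x. q dvd norm_sq x + k}" by blast
  then have "cube_count N k q = card (X \<inter> {x. q dvd norm_sq x + k})" by (simp only: cube_count_def X_def)
  then have "of_int q ^ 3 * complex_of_real (real (cube_count N k q)) = (\<Sum>x\<in>X. of_bool (q dvd norm_sq x + k) * of_int q ^ 3)"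
    using finX by (simp flip: sum_distrib_right)
  also have "\<dots> = (\<Sum>x\<in>X. \<Sum>y\<in>Y. \<Sum>a\<in>A. add_char q (dot a y) * add_char q (dot x (neg a)))"
  proof (rule sum.cong[OF refl])
    fix x
    define r where "r = (\<lambda>(x1, x2, x3). (x1 mod q, x2 mod q, x3 mod q)) x"
    obtain x1 x2 x3 where x: "x = (x1, x2, x3)" by (cases x)
    have "[(x1 mod q)\<^sup>2 + (x2 mod q)\<^sup>2 + (x3 mod q)\<^sup>2 + k = x1\<^sup>2 + x2\<^sup>2 + x3\<^sup>2 + k] (mod q)"
      by (intro cong_add cong_pow cong_refl) (simp_all add: cong_def)
    then have "q dvd norm_sq r + k \<longleftrightarrow> q dvd norm_sq x + k"
      by (simp add: r_def x norm_sq_def cong_dvd_iff)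
    moreover have "r \<in> box q" using q by (simp add: r_def x box_def)
    ultimately have rY: "r \<in> Y \<longleftrightarrow> q dvd norm_sq x + k" by (simp add: Y_def)
    have "(\<Sum>y\<in>Y. \<Sum>a\<in>A. add_char q (dot a y) * add_char q (dot x (neg a))) = (\<Sum>y\<in>Y. if y = r then of_int q ^ 3 else 0)"
      by (intro sum.cong refl) (auto simp: detect r_def Y_def)
    also have "\<dots> = of_bool (q dvd norm_sq x + k) * of_int q ^ 3" using finY rY by simp
    finally show "of_bool (q dvd norm_sq x + k) * of_int q ^ 3 =
      (\<Sum>y\<in>Y. \<Sum>a\<in>A. add_char q (dot a y) * add_char q (dot x (neg a)))" ..
  qed
  also have "\<dots> = (\<Sum>x\<in>X. \<Sum>a\<in>A. S a * add_char q (dot x (neg a)))"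
    by (subst sum.swap) (simp add: S_def sum_distrib_right)
  also have "\<dots> = (\<Sum>a\<in>A. S a * G a)"
    by (subst sum.swap) (simp add: G_def sum_distrib_left)
  also have "\<dots> = S (0, 0, 0) * G (0, 0, 0) + (\<Sum>a\<in>A - {(0, 0, 0)}. S a * G a)"
    using finA zero_in_freqs[OF q] by (intro sum.remove) (auto simp: A_def)
  also have "S (0, 0, 0) * G (0, 0, 0) = of_nat (card Y) * of_nat N ^ 3"
  proof -
    have "dot (0, 0, 0) y = 0" for y by (cases y) (simp add: dot_def)
    moreover have "dot y (neg (0, 0, 0)) = 0" for y by (cases y) (simp add: dot_def neg_def)
    ultimately show ?thesis by (simp add: S_def G_def X_def card_cartesian_product power3_eq_cube)
  qed
  finally have "of_int q ^ 3 * complex_of_real (real (cube_count N k q)) - of_nat (card Y) * of_nat N ^ 3 = (\<Sum>a\<in>A - {(0, 0, 0)}. S a * G a)"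
    by simp
  then have "norm (complex_of_real (real_of_int q ^ 3 * real (cube_count N k q) - real (card Y) * real N ^ 3)) = norm (\<Sum>a\<in>A - {(0, 0, 0)}. S a * G a)"
    by simp
  then have "\<bar>real_of_int q ^ 3 * real (cube_count N k q) - real (card Y) * real N ^ 3\<bar> = norm (\<Sum>a\<in>A - {(0, 0, 0)}. S a * G a)"
    by (simp only: norm_of_real)
  also have "\<dots> \<le> (\<Sum>a\<in>A - {(0, 0, 0)}. (real_of_int (d\<^sup>2) * card (survivors k d a)) * (real_of_int q ^ 3 * weight3 N q a))"
  proof (rule sum_norm_le)
    fix a assume a: "a \<in> A - {(0, 0, 0)}"
    obtain a1 a2 a3 where a123: "a = (a1, a2, a3)" by (cases a)
    have aq: "a1 \<in> freqs q" "a2 \<in> freqs q" "a3 \<in> freqs q" using a by (auto simp: A_def a123)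
    have "norm (S a) \<le> real_of_int (d\<^sup>2) * card (survivors k d a)"
      using norm_exp_sum_le[OF d, where k=k and b=a] by (simp add: S_def Y_def q_def)
    moreover have "norm (G a) \<le> (real_of_int q * weight N q a1) * ((real_of_int q * weight N q a2) * (real_of_int q * weight N q a3))"
      unfolding G_def a123 neg_def X_def prod.case sum_add_char_dot norm_mult
      using aq q by (intro mult_mono norm_sum_add_char_le_weight) (auto simp: weight_nonneg)
    ultimately have "norm (S a) * norm (G a) \<le> (real_of_int (d\<^sup>2) * card (survivors k d a)) * ((real_of_int q * weight N q a1) * ((real_of_int q * weight N q a2) * (real_of_int q * weight N q a3)))"
      by (intro mult_mono) auto
    then show "norm (S a * G a) \<le> (real_of_int (d\<^sup>2) * card (survivors k d a)) * (real_of_int q ^ 3 * weight3 N q a)"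
      by (simp add: norm_mult weight3_def a123 power3_eq_cube mult_ac)
  qed
  also have "\<dots> = real_of_int q ^ 3 * (\<Sum>a\<in>A - {(0, 0, 0)}. weight3 N q a * (real_of_int (d\<^sup>2) * card (survivors k d a)))"
    by (simp add: sum_distrib_left mult_ac)
  finally have main: "\<bar>real_of_int q ^ 3 * real (cube_count N k q) - real (card Y) * real N ^ 3\<bar> \<le> \<dots>" .
  have "real_of_int q ^ 3 * \<bar>real (cube_count N k q) - real (card Y) / real_of_int q ^ 3 * real N ^ 3\<bar>
      = \<bar>real_of_int q ^ 3 * (real (cube_count N k q) - real (card Y) / real_of_int q ^ 3 * real N ^ 3)\<bar>"
    using q by (simp add: abs_mult)
  also have "real_of_int q ^ 3 * (real (cube_count N k q) - real (card Y) / real_of_int q ^ 3 * real N ^ 3)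
      = real_of_int q ^ 3 * real (cube_count N k q) - real (card Y) * real N ^ 3"
    using q by (simp add: right_diff_distrib)
  also note main
  finally have "\<bar>real (cube_count N k q) - real (card Y) / real_of_int q ^ 3 * real N ^ 3\<bar>
      \<le> (\<Sum>a\<in>A - {(0, 0, 0)}. weight3 N q a * (real_of_int (d\<^sup>2) * card (survivors k d a)))"
    using q by simp
  then show ?thesis by (simp add: q_def A_def residue_count_def Y_def flip: power_mult)
qed

section \<open>The error term on average over the modulus\<close>

definition hsum :: "int \<Rightarrow> real" where
  "hsum n = (\<Sum>j\<in>{1..n}. 1 / real_of_int j)"

lemma hsum_nonneg: "hsum n \<ge> 0"
  unfolding hsum_def by (intro sum_nonneg) auto

lemma hsum_mono: "m \<le> n \<Longrightarrow> hsum m \<le> hsum n"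
  unfolding hsum_def by (intro sum_mono2) auto

lemma hsum_ge_1: "n \<ge> 1 \<Longrightarrow> hsum n \<ge> 1"
  using hsum_mono[of 1 n] by (simp add: hsum_def)

text \<open>The value at 0 is 1, so zero and nonzero coordinates can be summed together; the factor
  that distinguishes them is split off in \<open>weight_scale\<close>.\<close>

definition recip_max :: "int \<Rightarrow> real" where
  "recip_max b = 1 / max 1 \<bar>real_of_int b\<bar>"

lemma recip_max_nonneg: "recip_max b \<ge> 0"
  by (simp add: recip_max_def)

text \<open>One harmonic sum for each sign, and a third one that absorbs the term 1 at
  \<open>b = 0\<close>.\<close>

lemma sum_recip_max_le:
  assumes "Q \<ge> 1"
  shows "(\<Sum>b\<in>{-Q..Q}. recip_max b) \<le> 3 * hsum Q"
proof -
  have "{-Q..Q} = uminus ` {1..Q} \<union> ({0} \<union> {1..Q})"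
  proof (intro set_eqI iffI)
    fix b assume b: "b \<in> {-Q..Q}"
    show "b \<in> uminus ` {1..Q} \<union> ({0} \<union> {1..Q})"
    proof (cases "b < 0")
      case True
      then have "b = - (- b)" "- b \<in> {1..Q}" using b by auto
      then show ?thesis by blast
    qed (use b in auto)
  qed (use assms in auto)
  then have "(\<Sum>b\<in>{-Q..Q}. recip_max b) = (\<Sum>b\<in>uminus ` {1..Q} \<union> ({0} \<union> {1..Q}). recip_max b)" by simp
  also have "\<dots> = (\<Sum>b\<in>uminus ` {1..Q}. recip_max b) + (recip_max 0 + (\<Sum>b\<in>{1..Q}. recip_max b))"
    by (subst sum.union_disjoint; (subst sum.union_disjoint)?) auto
  also have "(\<Sum>b\<in>uminus ` {1..Q}. recip_max b) = (\<Sum>b\<in>{1..Q}. recip_max b)"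
    by (subst sum.reindex) (auto simp: inj_on_def recip_max_def)
  also have "(\<Sum>b\<in>{1..Q}. recip_max b) = hsum Q"
    unfolding hsum_def by (intro sum.cong) (auto simp: recip_max_def max_def)
  finally show ?thesis using hsum_ge_1[OF assms] by (simp add: recip_max_def)
qed

definition recip_max3 :: "int \<times> int \<times> int \<Rightarrow> real" where
  "recip_max3 = (\<lambda>(a, b, c). recip_max a * (recip_max b * recip_max c))"

lemma recip_max3_nonneg: "recip_max3 b \<ge> 0"
  by (cases b) (simp add: recip_max3_def recip_max_nonneg)

definition scale3 :: "int \<Rightarrow> int \<times> int \<times> int \<Rightarrow> int \<times> int \<times> int" where
  "scale3 e = (\<lambda>(a, b, c). (e * a, e * b, e * c))"

lemma norm_sq_scale3: "norm_sq (scale3 e b) = e\<^sup>2 * norm_sq b"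
  by (cases b) (simp add: norm_sq_def scale3_def power_mult_distrib algebra_simps)

lemma norm_sq_pos: "b \<noteq> (0, 0, 0) \<Longrightarrow> norm_sq b > 0"
  by (cases b) (auto simp: norm_sq_def add_nonneg_pos add_pos_nonneg)

lemma weight_scale:
  assumes "d > 0" "e > 0"
  shows "weight N (d\<^sup>2) (e * b) = (if b = 0 then real N / real_of_int d ^ 2 else 1 / real_of_int e) * recip_max b"
proof (cases "b = 0")
  case False
  then have "\<bar>real_of_int b\<bar> \<ge> 1" by linarith
  then have "recip_max b = 1 / \<bar>real_of_int b\<bar>" by (simp add: recip_max_def max_def)
  then show ?thesis using assms False by (simp add: weight_def abs_mult)
qed (simp add: weight_def recip_max_def)

text \<open>The admissible frequencies have at least one nonzero coordinate, so of the eight products of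
  the factors \<open>N / d\<^sup>2\<close> (zero coordinate) and \<open>1 / e\<close> (nonzero coordinate) only three kinds occur.\<close>
lemma weight3_scale_le:
  fixes d e :: int and D :: real
  assumes de: "0 < e" "e \<le> d" "real_of_int d \<le> D" and D: "real N ^ 2 \<le> D ^ 3" "real N * D \<le> D ^ 3"
    and b: "b \<noteq> (0, 0, 0)"
  shows "weight3 N (d\<^sup>2) (scale3 e b) * (real_of_int d ^ 2 * real_of_int e ^ 2) \<le> D ^ 3 / real_of_int d * recip_max3 b"
    and "weight3 N (d\<^sup>2) (scale3 e b) * (real_of_int d ^ 2 * (real_of_int d * real_of_int e)) \<le> D ^ 3 / real_of_int e * recip_max3 b"
proof -
  define x y where "x = real_of_int d" and "y = real_of_int e"
  have xy: "0 < y" "y \<le> x" "x \<le> D" "0 < x" using de by (auto simp: x_def y_def)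
  obtain b1 b2 b3 where b123: "b = (b1, b2, b3)" by (cases b)
  define \<alpha> \<beta> where "\<alpha> = real N / x ^ 2" and "\<beta> = 1 / y"
  define \<omega> where "\<omega> t = (if t = 0 then \<alpha> else \<beta>)" for t :: int
  define P where "P = \<omega> b1 * (\<omega> b2 * \<omega> b3)"
  have ws: "weight N (d\<^sup>2) (e * t) = \<omega> t * recip_max t" for t
    using weight_scale[of d e N t] de by (simp only: \<omega>_def \<alpha>_def \<beta>_def x_def y_def)
  have w3: "weight3 N (d\<^sup>2) (scale3 e b) = P * recip_max3 b"
    unfolding weight3_def scale3_def b123 prod.case ws recip_max3_def P_def by (simp only: mult_ac)
  have cases: "P = \<alpha> ^ 2 * \<beta> \<or> P = \<alpha> * \<beta> ^ 2 \<or> P = \<beta> ^ 3"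
    using b by (auto simp: b123 P_def \<omega>_def power2_eq_square power3_eq_cube)
  have x3: "x ^ 3 \<le> D ^ 3" using xy by (intro power_mono) auto
  have Nx: "real N * x \<le> D ^ 3" using mult_left_mono[OF xy(3), of "real N"] D(2) by simp
  have D0: "D ^ 3 \<ge> 0" using xy by simp
  \<comment> \<open>Two zero coordinates are controlled by \<open>N ^ 2 \<le> D ^ 3\<close>, one by
    \<open>N * D \<le> D ^ 3\<close>, none by \<open>d \<le> D\<close>.\<close>
  have "P * (x ^ 2 * y ^ 2) \<le> D ^ 3 / x \<and> P * (x ^ 2 * (x * y)) \<le> D ^ 3 / y"
    using cases
  proof (elim disjE)
    assume P: "P = \<alpha> ^ 2 * \<beta>"
    have "P * (x ^ 2 * y ^ 2) = real N ^ 2 * y / x ^ 2" "P * (x ^ 2 * (x * y)) = real N ^ 2 / x"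
      using xy by (simp_all add: P \<alpha>_def \<beta>_def field_simps power2_eq_square)
    moreover have "real N ^ 2 * y / x ^ 2 \<le> D ^ 3 * x / x ^ 2"
      using xy D D0 by (intro divide_right_mono mult_mono) auto
    moreover have "D ^ 3 * x / x ^ 2 = D ^ 3 / x" using xy by (simp add: power2_eq_square)
    moreover have "real N ^ 2 / x \<le> D ^ 3 / y" using xy D by (intro frac_le) auto
    ultimately show ?thesis by simp
  next
    assume P: "P = \<alpha> * \<beta> ^ 2"
    have "P * (x ^ 2 * y ^ 2) = (real N * x) / x" "P * (x ^ 2 * (x * y)) = (real N * x) / y"
      using xy by (simp_all add: P \<alpha>_def \<beta>_def field_simps power2_eq_square)
    moreover have "(real N * x) / x \<le> D ^ 3 / x" "(real N * x) / y \<le> D ^ 3 / y"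
      using xy Nx by (intro divide_right_mono; simp)+
    ultimately show ?thesis by simp
  next
    assume P: "P = \<beta> ^ 3"
    have "P * (x ^ 2 * y ^ 2) = x ^ 3 / y / x" "P * (x ^ 2 * (x * y)) = x ^ 3 / y / y"
      using xy by (simp_all add: P \<beta>_def field_simps power2_eq_square power3_eq_cube)
    moreover have "x ^ 3 / y \<le> D ^ 3"
    proof -
      have "y \<ge> 1" using de by (simp add: y_def)
      then have "x ^ 3 / y \<le> x ^ 3 / 1" using xy by (intro divide_left_mono) auto
      then show ?thesis using x3 by simp
    qed
    then have "x ^ 3 / y / x \<le> D ^ 3 / x" "x ^ 3 / y / y \<le> D ^ 3 / y"
      using xy by (intro divide_right_mono; simp)+
    ultimately show ?thesis by simp
  qed
  then have "P * (x ^ 2 * y ^ 2) * recip_max3 b \<le> D ^ 3 / x * recip_max3 b"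
    "P * (x ^ 2 * (x * y)) * recip_max3 b \<le> D ^ 3 / y * recip_max3 b"
    using recip_max3_nonneg by (blast intro: mult_right_mono)+
  then show "weight3 N (d\<^sup>2) (scale3 e b) * (real_of_int d ^ 2 * real_of_int e ^ 2) \<le> D ^ 3 / real_of_int d * recip_max3 b"
    "weight3 N (d\<^sup>2) (scale3 e b) * (real_of_int d ^ 2 * (real_of_int d * real_of_int e)) \<le> D ^ 3 / real_of_int e * recip_max3 b"
    unfolding w3 x_def[symmetric] y_def[symmetric] by (simp_all only: mult_ac)
qed

text \<open>After \<open>a = e * b\<close> the part with \<open>e\<^sup>2\<close> decays like
  \<open>1 / d\<close> and is summed harmonically over \<open>d\<close>. The part with
  \<open>d * e\<close> decays only in \<open>e\<close>, but forces \<open>d\<close> to divide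
  \<open>e\<^sup>2 * norm_sq b\<close>, so for fixed \<open>e\<close> and \<open>b\<close> at most
  \<open>T\<close> moduli remain. In the bound, \<open>T ^ 2\<close> comes from counting survivors
  and the third \<open>T\<close> from counting \<open>e\<close> or \<open>d\<close>; three of the
  harmonic sums come from \<open>b\<close>, each with a factor 3, and one from \<open>d\<close> or
  \<open>e\<close>. The two parts together give \<open>54 = 2 * 27\<close>.\<close>

lemma sum_cube_count_error_le:
  fixes N :: nat and D T :: real and k :: int
  assumes N: "N \<ge> 1" and D: "1 \<le> D" "D \<le> real N" "real N ^ 2 \<le> D ^ 3" "real N * D \<le> D ^ 3"
    and T: "\<And>n. 0 < n \<Longrightarrow> n \<le> 3 * int N ^ 6 \<Longrightarrow> real (tau n) \<le> T"
  shows "(\<Sum>d | 0 < d \<and> real_of_int d \<le> D \<and> squarefree d.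
      \<bar>real (cube_count N k (d\<^sup>2)) - real (residue_count k (d\<^sup>2)) / real_of_int d ^ 6 * real N ^ 3\<bar>)
    \<le> 54 * (4 * \<bar>real_of_int k\<bar> + 2) * T ^ 3 * D ^ 3 * hsum (int N ^ 2) ^ 4"
proof -
  define Ds where "Ds = {d::int. 0 < d \<and> real_of_int d \<le> D \<and> squarefree d}"
  define err where "err d = \<bar>real (cube_count N k (d\<^sup>2)) - real (residue_count k (d\<^sup>2)) / real_of_int d ^ 6 * real N ^ 3\<bar>" for d :: int
  define K where "K = 4 * \<bar>real_of_int k\<bar> + 2"
  define A where "A d = freqs (d\<^sup>2) \<times> freqs (d\<^sup>2) \<times> freqs (d\<^sup>2) - {(0, 0, 0)}" for d
  define V where "V d = {e. 0 < e \<and> e dvd d}" for d :: int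
  \<comment> \<open>As \<open>d \<le> N\<close>, all frequencies at modulus \<open>d\<^sup>2\<close>
    are at most \<open>N ^ 2\<close> in absolute value; the range \<open>B\<close> thus serves every
    \<open>d\<close> and \<open>e\<close>.\<close>
  define Q where "Q = int N ^ 2"
  define B where "B = {-Q..Q} \<times> {-Q..Q} \<times> {-Q..Q} - {(0, 0, 0)}"
  \<comment> \<open>The two summands are the two bounds of \<open>weight3_scale_le\<close>.\<close>
  define F where "F d e b = (D ^ 3 / real_of_int d + of_bool (d dvd e\<^sup>2 * norm_sq b) * (D ^ 3 / real_of_int e)) * recip_max3 b" for d e b
  have Q1: "Q \<ge> 1" using N by (simp add: Q_def)
  have finB: "finite B" by (simp add: B_def)
  have finA: "finite (A d)" for d by (simp add: A_def)
  have d_le: "d \<le> int N" if "d \<in> Ds" for d using that D(2) by (simp add: Ds_def)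
  have DsN: "Ds \<subseteq> {1..int N}" using d_le by (auto simp: Ds_def)
  then have finDs: "finite Ds" by (rule finite_subset) simp
  have d0: "d > 0" "squarefree d" "real_of_int d \<le> D" if "d \<in> Ds" for d using that by (auto simp: Ds_def)
  have finV: "finite (V d)" if "d \<in> Ds" for d unfolding V_def using d0[OF that] by (intro finite_pos_divisors) auto
  have VN: "V d \<subseteq> {1..int N}" if "d \<in> Ds" for d
    using d_le[OF that] d0[OF that] by (auto simp: V_def dest: zdvd_imp_le)
  have N6: "int N \<le> 3 * int N ^ 6"
  proof -
    have "int N ^ 1 \<le> int N ^ 6" using N by (intro power_increasing) auto
    moreover have "int N ^ 6 \<ge> 0" by simp
    ultimately show ?thesis unfolding power_one_right by linarith
  qed
  have tauT: "real (tau d) \<le> T" if "d \<in> Ds" for d using T[of d] d_le[OF that] d0[OF that] N6 by linarith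
  have T1: "T \<ge> 1" using T[of 1] tau_pos[of 1] N N6 by fastforce
  have D3: "D ^ 3 \<ge> 0" using D by simp
  have F0: "F d e b \<ge> 0" if "d > 0" "e > 0" for d e b
    using that D3 by (simp add: F_def recip_max3_nonneg)
  have err_le: "err d \<le> K * T ^ 2 * (\<Sum>e\<in>V d. \<Sum>b\<in>B. F d e b)" if dD: "d \<in> Ds" for d
  proof -
    note d = d0[OF dD]
    define E where "E a = {e \<in> V d. dvd3 e a}" for a
    define h where "h e = (\<lambda>(x, y, z). (x div e, y div e, z div e))" for e :: int
    have finE: "finite (E a)" for a using finV[OF dD] by (simp add: E_def)
    have freq_le: "weight3 N (d\<^sup>2) a * (real_of_int (d\<^sup>2) * card (survivors k d a)) \<le> K * T ^ 2 * (\<Sum>e\<in>E a. F d e (h e a))"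
      if a: "a \<in> A d" for a
    proof -
      have w0: "weight3 N (d\<^sup>2) a \<ge> 0" using d by (cases a) (simp add: weight3_def weight_nonneg)
      have "card (survivors k d a) \<le> K * (real (tau d))\<^sup>2 * (\<Sum>e\<in>E a. real_of_int (e\<^sup>2 + of_bool (d dvd norm_sq a) * d * e))"
        using card_survivors_le[OF d(1,2), of k a] by (simp add: K_def E_def V_def conj_assoc)
      also have "\<dots> \<le> K * T ^ 2 * (\<Sum>e\<in>E a. real_of_int (e\<^sup>2 + of_bool (d dvd norm_sq a) * d * e))"
        using tauT[OF dD] d by (intro mult_right_mono mult_left_mono power_mono sum_nonneg) (auto simp: K_def E_def V_def)
      finally have "weight3 N (d\<^sup>2) a * (real_of_int (d\<^sup>2) * card (survivors k d a)) \<le>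
         weight3 N (d\<^sup>2) a * (real_of_int (d\<^sup>2) * (K * T ^ 2 * (\<Sum>e\<in>E a. real_of_int (e\<^sup>2 + of_bool (d dvd norm_sq a) * d * e))))"
        using w0 by (intro mult_left_mono) auto
      also have "\<dots> = K * T ^ 2 * (\<Sum>e\<in>E a. weight3 N (d\<^sup>2) a * (real_of_int (d\<^sup>2) * real_of_int (e\<^sup>2 + of_bool (d dvd norm_sq a) * d * e)))"
        by (simp add: sum_distrib_left mult_ac)
      also have "\<dots> \<le> K * T ^ 2 * (\<Sum>e\<in>E a. F d e (h e a))"
      proof (intro mult_left_mono sum_mono)
        fix e assume e: "e \<in> E a"
        then have e0: "0 < e" "e dvd d" "dvd3 e a" by (auto simp: E_def V_def)
        have ed: "e \<le> d" using e0 d by (auto dest: zdvd_imp_le)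
        have ah: "a = scale3 e (h e a)" using e0 by (cases a) (simp add: dvd3_def scale3_def h_def)
        then have h0: "h e a \<noteq> (0, 0, 0)" using a by (auto simp: A_def scale3_def)
        note * = weight3_scale_le[OF e0(1) ed d(3) D(3,4) h0]
        have dv: "d dvd norm_sq a \<longleftrightarrow> d dvd e\<^sup>2 * norm_sq (h e a)" using norm_sq_scale3[of e "h e a"] ah by simp
        have "weight3 N (d\<^sup>2) a * (real_of_int (d\<^sup>2) * real_of_int (e\<^sup>2 + of_bool (d dvd norm_sq a) * d * e))
          = weight3 N (d\<^sup>2) a * (real_of_int d ^ 2 * real_of_int e ^ 2) +
            of_bool (d dvd norm_sq a) * (weight3 N (d\<^sup>2) a * (real_of_int d ^ 2 * (real_of_int d * real_of_int e)))"
          by (simp add: algebra_simps)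
        also have "\<dots> \<le> D ^ 3 / real_of_int d * recip_max3 (h e a) + of_bool (d dvd norm_sq a) * (D ^ 3 / real_of_int e * recip_max3 (h e a))"
          using * ah by (intro add_mono mult_left_mono) auto
        also have "\<dots> = F d e (h e a)" by (simp add: F_def dv algebra_simps)
        finally show "weight3 N (d\<^sup>2) a * (real_of_int (d\<^sup>2) * real_of_int (e\<^sup>2 + of_bool (d dvd norm_sq a) * d * e)) \<le> F d e (h e a)" .
      qed (auto simp: K_def)
      finally show ?thesis .
    qed
    have "err d \<le> (\<Sum>a\<in>A d. weight3 N (d\<^sup>2) a * (real_of_int (d\<^sup>2) * card (survivors k d a)))"
      unfolding err_def A_def by (rule cube_count_error_le[OF d(1)])
    also have "\<dots> \<le> (\<Sum>a\<in>A d. K * T ^ 2 * (\<Sum>e\<in>E a. F d e (h e a)))" by (intro sum_mono freq_le)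
    also have "\<dots> = K * T ^ 2 * (\<Sum>a\<in>A d. \<Sum>e | e \<in> V d \<and> dvd3 e a. F d e (h e a))" by (simp add: sum_distrib_left E_def)
    \<comment> \<open>With \<open>e\<close> outermost, every frequency divisible by \<open>e\<close>
      becomes \<open>e * b\<close>, and the sum over \<open>b\<close> may be extended to
      \<open>B\<close>.\<close>
    also have "(\<Sum>a\<in>A d. \<Sum>e | e \<in> V d \<and> dvd3 e a. F d e (h e a)) = (\<Sum>e\<in>V d. \<Sum>a | a \<in> A d \<and> dvd3 e a. F d e (h e a))"
      by (rule sum.swap_restrict[OF finA finV[OF dD]])
    also have "K * T ^ 2 * \<dots> \<le> K * T ^ 2 * (\<Sum>e\<in>V d. \<Sum>b\<in>B. F d e b)"
    proof (intro mult_left_mono sum_mono)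
      fix e assume e: "e \<in> V d"
      then have e0: "0 < e" by (simp add: V_def)
      have ah: "a = scale3 e (h e a)" if "dvd3 e a" for a
        using that e0 by (cases a) (simp add: dvd3_def scale3_def h_def)
      have inj: "inj_on (h e) {a. a \<in> A d \<and> dvd3 e a}" using ah by (intro inj_onI) (metis mem_Collect_eq)
      have sub: "h e ` {a. a \<in> A d \<and> dvd3 e a} \<subseteq> B"
      proof
        fix b assume "b \<in> h e ` {a. a \<in> A d \<and> dvd3 e a}"
        then obtain a where a: "a \<in> A d" "dvd3 e a" "b = h e a" by blast
        have d2: "d\<^sup>2 \<le> Q" unfolding Q_def using d_le[OF dD] d by (intro power_mono) auto
        have rng: "x div e \<in> {-Q..Q}" if x: "x \<in> freqs (d\<^sup>2)" "e dvd x" for x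
        proof -
          obtain y where y: "x = e * y" using x(2) by (elim dvdE)
          have "\<bar>y\<bar> \<le> \<bar>x\<bar>" unfolding y abs_mult using e0 by (simp add: mult_le_cancel_right1)
          then have "\<bar>y\<bar> \<le> Q" using abs_freqs_le[OF x(1)] d2 by linarith
          then show ?thesis using y e0 by auto
        qed
        have "b \<noteq> (0, 0, 0)" using ah[OF a(2)] a by (auto simp: A_def scale3_def)
        then show "b \<in> B" using a(1,2) unfolding a(3)
          by (cases a) (auto simp: A_def B_def h_def dvd3_def intro!: rng simp del: atLeastAtMost_iff)
      qed
      have "(\<Sum>a | a \<in> A d \<and> dvd3 e a. F d e (h e a)) = (\<Sum>b\<in>h e ` {a. a \<in> A d \<and> dvd3 e a}. F d e b)"
        using sum.reindex[OF inj, of "F d e"] by (simp add: o_def)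
      also have "\<dots> \<le> (\<Sum>b\<in>B. F d e b)" using F0[OF d(1) e0] by (intro sum_mono2[OF finB sub]) auto
      finally show "(\<Sum>a | a \<in> A d \<and> dvd3 e a. F d e (h e a)) \<le> (\<Sum>b\<in>B. F d e b)" .
    qed (auto simp: K_def)
    finally show ?thesis .
  qed
  define I3 where "I3 = (\<Sum>b\<in>B. recip_max3 b)"
  have I30: "I3 \<ge> 0" unfolding I3_def by (intro sum_nonneg recip_max3_nonneg)
  have I3: "I3 \<le> 27 * hsum Q ^ 3"
  proof -
    have "I3 \<le> (\<Sum>b\<in>{-Q..Q} \<times> {-Q..Q} \<times> {-Q..Q}. recip_max3 b)"
      unfolding I3_def B_def by (intro sum_mono2) (auto simp: recip_max3_nonneg)
    also have "\<dots> = (\<Sum>b\<in>{-Q..Q}. recip_max b) * ((\<Sum>b\<in>{-Q..Q}. recip_max b) * (\<Sum>b\<in>{-Q..Q}. recip_max b))"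
      by (simp add: recip_max3_def sum_triple_mult)
    also have "\<dots> \<le> (3 * hsum Q) * ((3 * hsum Q) * (3 * hsum Q))"
      using sum_recip_max_le[OF Q1] by (intro mult_mono mult_nonneg_nonneg sum_nonneg) (auto simp: recip_max_nonneg hsum_nonneg)
    finally show ?thesis by (simp add: power3_eq_cube)
  qed
  have part1: "(\<Sum>d\<in>Ds. \<Sum>e\<in>V d. \<Sum>b\<in>B. D ^ 3 / real_of_int d * recip_max3 b) \<le> T * D ^ 3 * I3 * hsum (int N)"
  proof -
    have "(\<Sum>d\<in>Ds. \<Sum>e\<in>V d. \<Sum>b\<in>B. D ^ 3 / real_of_int d * recip_max3 b) = (\<Sum>d\<in>Ds. real (tau d) * (D ^ 3 / real_of_int d * I3))"
      by (simp add: I3_def sum_distrib_left tau_def V_def)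
    also have "\<dots> \<le> (\<Sum>d\<in>Ds. T * (D ^ 3 / real_of_int d * I3))"
      using tauT d0 D3 I30 by (intro sum_mono mult_right_mono) (auto intro!: mult_nonneg_nonneg divide_nonneg_pos)
    also have "\<dots> \<le> (\<Sum>d\<in>{1..int N}. T * (D ^ 3 / real_of_int d * I3))"
      using DsN D3 I30 T1 by (intro sum_mono2) (auto intro!: mult_nonneg_nonneg divide_nonneg_pos)
    also have "\<dots> = T * D ^ 3 * I3 * hsum (int N)" by (simp add: hsum_def sum_distrib_left mult_ac)
    finally show ?thesis .
  qed
  have part2: "(\<Sum>d\<in>Ds. \<Sum>e\<in>V d. \<Sum>b\<in>B. of_bool (d dvd e\<^sup>2 * norm_sq b) * (D ^ 3 / real_of_int e) * recip_max3 b) \<le> T * D ^ 3 * I3 * hsum (int N)"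
  proof -
    have "(\<Sum>d\<in>Ds. \<Sum>e\<in>V d. \<Sum>b\<in>B. of_bool (d dvd e\<^sup>2 * norm_sq b) * (D ^ 3 / real_of_int e) * recip_max3 b)
       \<le> (\<Sum>d\<in>Ds. \<Sum>e\<in>{1..int N}. \<Sum>b\<in>B. of_bool (d dvd e\<^sup>2 * norm_sq b) * (D ^ 3 / real_of_int e) * recip_max3 b)"
      using VN D3 by (intro sum_mono sum_mono2) (auto intro!: sum_nonneg mult_nonneg_nonneg divide_nonneg_pos recip_max3_nonneg)
    also have "\<dots> = (\<Sum>e\<in>{1..int N}. \<Sum>d\<in>Ds. \<Sum>b\<in>B. of_bool (d dvd e\<^sup>2 * norm_sq b) * (D ^ 3 / real_of_int e) * recip_max3 b)"
      by (rule sum.swap)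
    also have "\<dots> = (\<Sum>e\<in>{1..int N}. \<Sum>b\<in>B. \<Sum>d\<in>Ds. of_bool (d dvd e\<^sup>2 * norm_sq b) * ((D ^ 3 / real_of_int e) * recip_max3 b))"
      by (subst sum.swap) (simp add: mult.assoc)
    also have "\<dots> \<le> (\<Sum>e\<in>{1..int N}. \<Sum>b\<in>B. T * ((D ^ 3 / real_of_int e) * recip_max3 b))"
    proof (intro sum_mono)
      fix e b assume e: "e \<in> {1..int N}" and b: "b \<in> B"
      have np: "e\<^sup>2 * norm_sq b > 0" using e b norm_sq_pos[of b] by (auto simp: B_def)
      have "norm_sq b \<le> 3 * Q\<^sup>2"
      proof -
        have "x\<^sup>2 \<le> Q\<^sup>2" if "x \<in> {-Q..Q}" for x
          using that by (simp add: abs_le_square_iff[symmetric] abs_le_iff)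
        then have "x\<^sup>2 + y\<^sup>2 + z\<^sup>2 \<le> 3 * Q\<^sup>2" if "x \<in> {-Q..Q}" "y \<in> {-Q..Q}" "z \<in> {-Q..Q}" for x y z
          using that by (smt (verit))
        then show ?thesis using b by (auto simp: B_def norm_sq_def simp del: atLeastAtMost_iff)
      qed
      \<comment> \<open>This is where the range \<open>3 * N ^ 6\<close> in the assumption on
        \<open>T\<close> comes from.\<close>
      then have "e\<^sup>2 * norm_sq b \<le> (int N)\<^sup>2 * (3 * Q\<^sup>2)"
        using e norm_sq_pos[of b] b by (intro mult_mono power_mono) (auto simp: B_def less_imp_le)
      also have "\<dots> = 3 * int N ^ 6" by (simp add: Q_def flip: power_mult power_add)
      finally have "real (tau (e\<^sup>2 * norm_sq b)) \<le> T" using np by (intro T)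
      moreover have "card {d \<in> Ds. d dvd e\<^sup>2 * norm_sq b} \<le> tau (e\<^sup>2 * norm_sq b)"
        unfolding tau_def using np by (intro card_mono finite_pos_divisors) (auto simp: Ds_def)
      ultimately have "real (card {d \<in> Ds. d dvd e\<^sup>2 * norm_sq b}) \<le> T" by linarith
      moreover have "(\<Sum>d\<in>Ds. of_bool (d dvd e\<^sup>2 * norm_sq b) * ((D ^ 3 / real_of_int e) * recip_max3 b))
         = real (card {d \<in> Ds. d dvd e\<^sup>2 * norm_sq b}) * ((D ^ 3 / real_of_int e) * recip_max3 b)"
        unfolding sum_distrib_right[symmetric] using finDs by (simp add: Int_def)
      moreover have "(D ^ 3 / real_of_int e) * recip_max3 b \<ge> 0" using e D3 recip_max3_nonneg[of b] by simp
      ultimately show "(\<Sum>d\<in>Ds. of_bool (d dvd e\<^sup>2 * norm_sq b) * ((D ^ 3 / real_of_int e) * recip_max3 b)) \<le> T * ((D ^ 3 / real_of_int e) * recip_max3 b)"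
        by (simp only: mult_right_mono)
    qed
    also have "\<dots> = T * D ^ 3 * I3 * hsum (int N)"
      by (simp add: hsum_def I3_def sum_distrib_left sum_distrib_right mult_ac) (rule sum.swap)
    finally show ?thesis .
  qed
  have "(\<Sum>d\<in>Ds. err d) \<le> (\<Sum>d\<in>Ds. K * T ^ 2 * (\<Sum>e\<in>V d. \<Sum>b\<in>B. F d e b))" by (intro sum_mono err_le)
  also have "\<dots> = K * T ^ 2 * ((\<Sum>d\<in>Ds. \<Sum>e\<in>V d. \<Sum>b\<in>B. D ^ 3 / real_of_int d * recip_max3 b)
     + (\<Sum>d\<in>Ds. \<Sum>e\<in>V d. \<Sum>b\<in>B. of_bool (d dvd e\<^sup>2 * norm_sq b) * (D ^ 3 / real_of_int e) * recip_max3 b))"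
    by (simp only: F_def distrib_right sum.distrib sum_distrib_left[symmetric])
  also have "\<dots> \<le> K * T ^ 2 * (T * D ^ 3 * I3 * hsum (int N) + T * D ^ 3 * I3 * hsum (int N))"
    using part1 part2 by (intro mult_left_mono add_mono) (auto simp: K_def)
  also have "\<dots> = 2 * K * T ^ 3 * D ^ 3 * (I3 * hsum (int N))" by (simp add: power2_eq_square power3_eq_cube algebra_simps)
  also have "I3 * hsum (int N) \<le> (27 * hsum Q ^ 3) * hsum Q"
  proof -
    have "int N ^ 1 \<le> int N ^ 2" using N by (intro power_increasing) auto
    then show ?thesis using I3 I30 hsum_nonneg by (intro mult_mono hsum_mono) (auto simp: Q_def)
  qed
  then have "2 * K * T ^ 3 * D ^ 3 * (I3 * hsum (int N)) \<le> 2 * K * T ^ 3 * D ^ 3 * ((27 * hsum Q ^ 3) * hsum Q)"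
    using T1 D3 by (intro mult_left_mono) (auto simp: K_def)
  also have "\<dots> = 54 * K * T ^ 3 * D ^ 3 * hsum Q ^ 4" by (simp add: power_numeral_reduce mult_ac)
  finally show ?thesis by (simp add: Ds_def err_def K_def Q_def)
qed

section \<open>Local densities and the Euler product\<close>

definition density :: "int \<Rightarrow> int \<Rightarrow> real" where
  "density k d = real (residue_count k (d\<^sup>2)) / real_of_int d ^ 6"

lemma density_nonneg: "density k d \<ge> 0"
  by (simp add: density_def)

text \<open>The two counts use the representatives 1 to \<open>q\<close> and 0 to
  \<open>q - 1\<close>; exchanging \<open>q\<close> and 0 in each coordinate matches them.\<close>

lemma lambda_count_eq_residue_count:
  assumes "q > 0"
  shows "lambda_count q k = residue_count k (int q)"
proof -
  define Q where "Q = int q"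
  have Q: "Q > 0" using assms by (simp add: Q_def)
  define f where "f = (\<lambda>(x, y, z). (x mod Q, y mod Q, z mod Q))"
  define l where "l x = (if x = 0 then Q else x)" for x
  define g where "g = (\<lambda>(x, y, z). (l x, l y, l z))"
  have lm: "l (x mod Q) = x" if "x \<in> {1..Q}" for x
    using that Q by (cases "x = Q") (auto simp: l_def)
  have ml: "l x mod Q = x" "l x \<in> {1..Q}" if "x \<in> {0..<Q}" for x
    using that Q by (auto simp: l_def)
  have inv: "[x\<^sup>2 + y\<^sup>2 + z\<^sup>2 + k = x'\<^sup>2 + y'\<^sup>2 + z'\<^sup>2 + k] (mod Q)"
    if "[x = x'] (mod Q)" "[y = y'] (mod Q)" "[z = z'] (mod Q)" for x y z x' y' z'
    using that by (intro cong_add cong_pow cong_refl)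
  have "bij_betw f {(x, y, z). x \<in> {1..Q} \<and> y \<in> {1..Q} \<and> z \<in> {1..Q} \<and> [x\<^sup>2 + y\<^sup>2 + z\<^sup>2 + k = 0] (mod Q)}
     {y \<in> box Q. Q dvd norm_sq y + k}"
  proof (rule bij_betw_byWitness[of _ g])
    show "f ` {(x, y, z). x \<in> {1..Q} \<and> y \<in> {1..Q} \<and> z \<in> {1..Q} \<and> [x\<^sup>2 + y\<^sup>2 + z\<^sup>2 + k = 0] (mod Q)}
       \<subseteq> {y \<in> box Q. Q dvd norm_sq y + k}"
    proof (rule image_subsetI)
      fix p assume "p \<in> {(x, y, z). x \<in> {1..Q} \<and> y \<in> {1..Q} \<and> z \<in> {1..Q} \<and> [x\<^sup>2 + y\<^sup>2 + z\<^sup>2 + k = 0] (mod Q)}"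
      then obtain x y z where p: "p = (x, y, z)" "[x\<^sup>2 + y\<^sup>2 + z\<^sup>2 + k = 0] (mod Q)" by auto
      then have "Q dvd x\<^sup>2 + y\<^sup>2 + z\<^sup>2 + k" by (simp add: cong_0_iff)
      moreover have "[x mod Q = x] (mod Q)" for x by (simp add: cong_def)
      ultimately have "Q dvd (x mod Q)\<^sup>2 + (y mod Q)\<^sup>2 + (z mod Q)\<^sup>2 + k"
        using inv[of "x mod Q" x "y mod Q" y "z mod Q" z] by (simp add: cong_dvd_iff)
      then show "f p \<in> {y \<in> box Q. Q dvd norm_sq y + k}" using Q by (simp add: p f_def box_def norm_sq_def)
    qed
    show "g ` {y \<in> box Q. Q dvd norm_sq y + k} \<subseteq> {(x, y, z). x \<in> {1..Q} \<and> y \<in> {1..Q} \<and> z \<in> {1..Q} \<and> [x\<^sup>2 + y\<^sup>2 + z\<^sup>2 + k = 0] (mod Q)}"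
    proof (rule image_subsetI)
      fix p assume pR: "p \<in> {y \<in> box Q. Q dvd norm_sq y + k}"
      obtain a b c where p: "p = (a, b, c)" by (cases p)
      define x y z where "x = l a" and "y = l b" and "z = l c"
      note abc_defs = x_def y_def z_def
      have abc: "a \<in> {0..<Q}" "b \<in> {0..<Q}" "c \<in> {0..<Q}" and dv: "Q dvd norm_sq (a, b, c) + k"
        using pR by (auto simp: box_def p)
      have "[l x = x] (mod Q)" if "x \<in> {0..<Q}" for x using ml(1)[OF that] that by (simp add: cong_def)
      then have "[x\<^sup>2 + y\<^sup>2 + z\<^sup>2 + k = a\<^sup>2 + b\<^sup>2 + c\<^sup>2 + k] (mod Q)" unfolding abc_defs using abc by (intro inv)
      moreover have "[a\<^sup>2 + b\<^sup>2 + c\<^sup>2 + k = 0] (mod Q)" using dv by (simp add: cong_0_iff norm_sq_def)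
      ultimately have "[x\<^sup>2 + y\<^sup>2 + z\<^sup>2 + k = 0] (mod Q)" by (rule cong_trans)
      then show "g p \<in> {(x, y, z). x \<in> {1..Q} \<and> y \<in> {1..Q} \<and> z \<in> {1..Q} \<and> [x\<^sup>2 + y\<^sup>2 + z\<^sup>2 + k = 0] (mod Q)}"
        using ml(2) abc by (simp add: g_def p abc_defs del: atLeastAtMost_iff atLeastLessThan_iff)
    qed
  qed (auto simp: f_def g_def box_def lm ml simp del: atLeastAtMost_iff atLeastLessThan_iff)
  then show ?thesis unfolding lambda_count_def residue_count_def Q_def[symmetric] by (rule bij_betw_same_card)
qed

text \<open>The Chinese remainder theorem, applied in each of the three coordinates.\<close>

lemma residue_count_mult:
  fixes m n :: int
  assumes mn: "coprime m n" "m > 0" "n > 0"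
  shows "residue_count k (m * n) = residue_count k m * residue_count k n"
proof -
  define R where "R q = {y \<in> box q. q dvd norm_sq y + k}" for q
  define red where "red q = (\<lambda>(x, y, z). (x mod q, y mod q, z mod q))" for q :: int
  have mod_dvd: "q dvd norm_sq (red q y) + k \<longleftrightarrow> q dvd norm_sq y + k" for q y
  proof -
    obtain y1 y2 y3 where y: "y = (y1, y2, y3)" by (cases y)
    have "[(y1 mod q)\<^sup>2 + (y2 mod q)\<^sup>2 + (y3 mod q)\<^sup>2 + k = y1\<^sup>2 + y2\<^sup>2 + y3\<^sup>2 + k] (mod q)"
      by (intro cong_add cong_pow cong_refl) (simp_all add: cong_def)
    then show ?thesis by (simp add: y red_def norm_sq_def cong_dvd_iff)
  qed
  have red_box: "red q y \<in> box q" if "q > 0" for q y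
    using that by (cases y) (simp add: red_def box_def)
  have uniq: "x = y" if "x \<in> {0..<m * n}" "y \<in> {0..<m * n}" "x mod m = y mod m" "x mod n = y mod n" for x y
  proof -
    have "m dvd x - y" "n dvd x - y" using that by (simp_all add: mod_eq_dvd_iff)
    then have "m * n dvd x - y" using mn(1) by (intro divides_mult)
    then have "x mod (m * n) = y mod (m * n)" by (simp add: mod_eq_dvd_iff)
    then show ?thesis using that by simp
  qed
  have "bij_betw (\<lambda>y. (red m y, red n y)) (R (m * n)) (R m \<times> R n)"
    unfolding bij_betw_def
  proof
    show "inj_on (\<lambda>y. (red m y, red n y)) (R (m * n))"
      unfolding inj_on_def R_def box_def red_def by (auto intro!: uniq)
    show "(\<lambda>y. (red m y, red n y)) ` R (m * n) = R m \<times> R n"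
    proof
      show "(\<lambda>y. (red m y, red n y)) ` R (m * n) \<subseteq> R m \<times> R n"
      proof
        fix p assume "p \<in> (\<lambda>y. (red m y, red n y)) ` R (m * n)"
        then obtain y where y: "p = (red m y, red n y)" "m * n dvd norm_sq y + k" by (auto simp: R_def)
        then have "m dvd norm_sq y + k" "n dvd norm_sq y + k" by (meson dvd_mult_left dvd_mult_right)+
        then show "p \<in> R m \<times> R n" using y red_box mn by (simp add: R_def mod_dvd)
      qed
      show "R m \<times> R n \<subseteq> (\<lambda>y. (red m y, red n y)) ` R (m * n)"
      proof
        fix p assume "p \<in> R m \<times> R n"
        then obtain a1 a2 a3 b1 b2 b3 where p: "p = ((a1, a2, a3), (b1, b2, b3))" "(a1, a2, a3) \<in> R m" "(b1, b2, b3) \<in> R n"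
          by auto
        define crt where "crt a b = (SOME x. [x = a] (mod m) \<and> [x = b] (mod n)) mod (m * n)" for a b
        have crt: "crt a b mod m = a" "crt a b mod n = b" if "a \<in> {0..<m}" "b \<in> {0..<n}" for a b
        proof -
          define x where "x = (SOME x. [x = a] (mod m) \<and> [x = b] (mod n))"
          have "[x = a] (mod m) \<and> [x = b] (mod n)"
            unfolding x_def using binary_chinese_remainder_int[OF mn(1)] by (rule someI_ex)
          then have "x mod m = a" "x mod n = b" using that by (auto simp: cong_def)
          moreover have "crt a b = x mod (m * n)" by (simp add: crt_def x_def)
          ultimately show "crt a b mod m = a" "crt a b mod n = b" by (simp_all add: mod_mod_cancel)
        qed
        define y where "y = (crt a1 b1, crt a2 b2, crt a3 b3)"
        have rm: "red m y = (a1, a2, a3)" "red n y = (b1, b2, b3)"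
          using p(2,3) by (auto simp: R_def box_def red_def y_def crt simp del: atLeastLessThan_iff)
        have "m dvd norm_sq y + k" "n dvd norm_sq y + k" using mod_dvd[of m y] mod_dvd[of n y] rm p by (auto simp: R_def)
        then have "m * n dvd norm_sq y + k" using mn(1) by (intro divides_mult)
        moreover have "y \<in> box (m * n)" using mn by (simp add: y_def box_def crt_def)
        ultimately have "y \<in> R (m * n)" by (simp add: R_def)
        then show "p \<in> (\<lambda>y. (red m y, red n y)) ` R (m * n)" using rm p(1) by (intro image_eqI[of _ _ y]) simp_all
      qed
    qed
  qed
  then have "card (R (m * n)) = card (R m \<times> R n)" by (rule bij_betw_same_card)
  then show ?thesis by (simp add: R_def residue_count_def card_cartesian_product)
qed

lemma density_prod_primes:
  assumes "finite P" "\<And>p. p \<in> P \<Longrightarrow> prime (p::int)"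
  shows "density k (\<Prod>P) = (\<Prod>p\<in>P. density k p)"
  using assms
proof (induction P rule: finite_induct)
  case empty
  have "{y \<in> box 1. 1 dvd norm_sq y + k} = {(0, 0, 0)}" by (auto simp: box_def)
  then show ?case by (simp add: density_def residue_count_def)
next
  case (insert p P)
  have "coprime p (\<Prod>P)"
  proof (rule prod_coprime_right)
    fix r assume "r \<in> P"
    then show "coprime p r" using insert by (intro primes_coprime) auto
  qed
  then have cop: "coprime (p\<^sup>2) ((\<Prod>P)\<^sup>2)" by simp
  have pos: "p > 0" "\<Prod>P > 0" using insert.prems by (auto intro!: prod_pos simp: prime_gt_0_int)
  have "residue_count k ((p * \<Prod>P)\<^sup>2) = residue_count k (p\<^sup>2) * residue_count k ((\<Prod>P)\<^sup>2)"
    unfolding power_mult_distrib using cop pos by (intro residue_count_mult) auto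
  then have "density k (p * \<Prod>P) = density k p * density k (\<Prod>P)"
    by (simp add: density_def power_mult_distrib)
  then show ?case using insert by simp
qed

lemma density_le:
  fixes d :: int
  assumes d: "d > 0" "squarefree d"
  shows "density k d \<le> 2 * (4 * \<bar>real_of_int k\<bar> + 2) * real (tau d) ^ 3 / real_of_int d ^ 2"
proof -
  define K where "K = 4 * \<bar>real_of_int k\<bar> + 2"
  define V where "V = {e. 0 < e \<and> e dvd d}"
  have "dot (0, 0, 0) y = 0" for y by (cases y) (simp add: dot_def)
  then have "real (residue_count k (d\<^sup>2)) \<le> real_of_int (d\<^sup>2) * card (survivors k d (0, 0, 0))"
    using norm_exp_sum_le[OF d(1), where k=k and b="(0, 0, 0)"] by (simp add: residue_count_def)
  also have "card (survivors k d (0, 0, 0)) \<le> K * (real (tau d))\<^sup>2 * (\<Sum>e\<in>V. real_of_int (e\<^sup>2 + d * e))"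
    using card_survivors_le[OF d, of k "(0, 0, 0)"] by (simp add: K_def V_def dvd3_def norm_sq_def)
  also have "(\<Sum>e\<in>V. real_of_int (e\<^sup>2 + d * e)) \<le> (\<Sum>e\<in>V. 2 * real_of_int d ^ 2)"
  proof (rule sum_mono)
    fix e assume "e \<in> V"
    then have e: "0 < e" "e \<le> d" using d by (auto simp: V_def dest: zdvd_imp_le)
    have "e\<^sup>2 \<le> d\<^sup>2" "d * e \<le> d\<^sup>2" using e by (auto simp: power2_eq_square intro: mult_mono)
    then have "e\<^sup>2 + d * e \<le> 2 * d\<^sup>2" by simp
    then have "real_of_int (e\<^sup>2 + d * e) \<le> real_of_int (2 * d\<^sup>2)" by (simp only: of_int_le_iff)
    then show "real_of_int (e\<^sup>2 + d * e) \<le> 2 * real_of_int d ^ 2" by simp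
  qed
  also have "(\<Sum>e\<in>V. 2 * real_of_int d ^ 2) = real (tau d) * (2 * real_of_int d ^ 2)" by (simp add: tau_def V_def)
  finally have "real (residue_count k (d\<^sup>2)) \<le> real_of_int (d\<^sup>2) * (K * (real (tau d))\<^sup>2 * (real (tau d) * (2 * real_of_int d ^ 2)))"
    by (auto simp: K_def mult_left_mono)
  also have "\<dots> = (2 * K * real (tau d) ^ 3 / real_of_int d ^ 2) * real_of_int d ^ 6"
    using d by (simp add: field_simps power_numeral_reduce)
  finally show ?thesis using d by (simp add: density_def K_def divide_le_eq)
qed

section \<open>Moebius sums as alternating sums over sets of primes\<close>

lemma prime_factors_prod_primes:
  assumes "finite T" "\<And>p. p \<in> T \<Longrightarrow> prime (p::int)"
  shows "prime_factors (\<Prod>T) = T"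
proof -
  have "prime_factors (\<Prod>p\<in>T. p) = \<Union>((prime_factors \<circ> (\<lambda>p. p)) ` T)"
    by (rule prime_factors_prod) (use assms(1) assms(2)[of 0] in auto)
  also have "\<dots> = T" using assms by (auto simp: prime_prime_factors)
  finally show ?thesis .
qed

lemma prod_prime_factors_squarefree:
  assumes "squarefree d" "d > (0::int)"
  shows "\<Prod>(prime_factors d) = d"
proof -
  have "\<Prod>(prime_factors d) = (\<Prod>p\<in>prime_factors d. p ^ multiplicity p d)"
    using assms squarefree_factorial_semiring'[of d] by (intro prod.cong) auto
  also have "\<dots> = d" using assms prod_prime_factors[of d] by simp
  finally show ?thesis .
qed

text \<open>This agrees with the Moebius function only at square-free \<open>d\<close>, and every
  sum below is restricted to those.\<close>

definition moebius :: "int \<Rightarrow> real" where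
  "moebius d = (-1) ^ card (prime_factors d)"

lemma abs_moebius [simp]: "\<bar>moebius d\<bar> = 1"
  by (simp add: moebius_def power_abs)

lemma bij_betw_prime_sets:
  assumes P: "finite P" "\<And>p. p \<in> P \<Longrightarrow> prime (p::int)"
  shows "bij_betw (\<lambda>T. \<Prod>T) (Pow P) {d. 0 < d \<and> squarefree d \<and> prime_factors d \<subseteq> P}"
proof (rule bij_betw_byWitness[of _ prime_factors])
  show "(\<lambda>T. \<Prod>T) ` Pow P \<subseteq> {d. 0 < d \<and> squarefree d \<and> prime_factors d \<subseteq> P}"
  proof clarify
    fix T assume T: "T \<subseteq> P"
    have "squarefree (\<Prod>T)"
      using T P by (intro squarefree_prod_coprime squarefree_prime primes_coprime) auto
    moreover have "\<Prod>T > 0" using T P by (intro prod_pos) (auto simp: prime_gt_0_int)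
    ultimately show "0 < \<Prod>T \<and> squarefree (\<Prod>T) \<and> prime_factors (\<Prod>T) \<subseteq> P"
      using T P prime_factors_prod_primes[of T] by (auto dest: finite_subset)
  qed
qed (use P in \<open>auto simp: prod_prime_factors_squarefree intro!: prime_factors_prod_primes intro: finite_subset\<close>)

lemma sum_moebius_prime_sets:
  assumes P: "finite P" "\<And>p. p \<in> P \<Longrightarrow> prime (p::int)"
  shows "(\<Sum>d | 0 < d \<and> squarefree d \<and> prime_factors d \<subseteq> P. moebius d * f d) = (\<Sum>T\<in>Pow P. (-1) ^ card T * f (\<Prod>T))"
proof -
  have "(\<Sum>T\<in>Pow P. (-1) ^ card T * f (\<Prod>T)) = (\<Sum>T\<in>Pow P. moebius (\<Prod>T) * f (\<Prod>T))"
  proof (rule sum.cong[OF refl])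
    fix T assume "T \<in> Pow P"
    then have "prime_factors (\<Prod>T) = T" using P by (intro prime_factors_prod_primes) (auto dest: finite_subset)
    then show "(-1) ^ card T * f (\<Prod>T) = moebius (\<Prod>T) * f (\<Prod>T)" by (simp add: moebius_def)
  qed
  also have "\<dots> = (\<Sum>d | 0 < d \<and> squarefree d \<and> prime_factors d \<subseteq> P. moebius d * f d)"
    using bij_betw_prime_sets[OF P] by (rule sum.reindex_bij_betw)
  finally show ?thesis ..
qed

text \<open>\<open>d\<^sup>2\<close> divides \<open>n\<close> exactly if \<open>d\<close> divides
  \<open>square_part n\<close>. The sum is therefore alternating over all sets of primes dividing
  \<open>square_part n\<close>, and expands a product of factors \<open>1 - 1\<close>.\<close>

lemma sum_moebius_square_divisors:
  fixes n :: int
  assumes n: "n \<noteq> 0"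
  shows "(\<Sum>d | 0 < d \<and> squarefree d \<and> d\<^sup>2 dvd n. moebius d) = of_bool (squarefree n)"
proof -
  define s where "s = square_part n"
  have s0: "s \<noteq> 0" using n by (simp add: s_def)
  define P where "P = prime_factors s"
  have P: "finite P" "\<And>p. p \<in> P \<Longrightarrow> prime p" by (auto simp: P_def)
  have "d\<^sup>2 dvd n \<longleftrightarrow> prime_factors d \<subseteq> P" if d: "0 < d" "squarefree d" for d
  proof -
    have "d\<^sup>2 dvd n \<longleftrightarrow> d dvd s" by (simp add: s_def dvd_square_part_iff)
    also have "\<dots> \<longleftrightarrow> prime_factors d \<subseteq> P"
    proof
      assume "prime_factors d \<subseteq> P"
      then have "\<Prod>(prime_factors d) dvd \<Prod>P" using P by (intro prod_dvd_prod_subset) auto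
      also have "\<Prod>P dvd (\<Prod>p\<in>P. p ^ multiplicity p s)"
        using s0 by (intro prod_dvd_prod) (auto simp: P_def prime_factors_multiplicity intro: dvd_power)
      also have "\<dots> dvd s" using prod_prime_factors[OF s0] by (simp add: P_def)
      finally show "d dvd s" using d by (simp add: prod_prime_factors_squarefree)
    qed (use s0 in \<open>auto simp: P_def dest: dvd_prime_factors\<close>)
    finally show ?thesis .
  qed
  then have "{d. 0 < d \<and> squarefree d \<and> d\<^sup>2 dvd n} = {d. 0 < d \<and> squarefree d \<and> prime_factors d \<subseteq> P}" by blast
  then have "(\<Sum>d | 0 < d \<and> squarefree d \<and> d\<^sup>2 dvd n. moebius d) = (\<Sum>T\<in>Pow P. (-1) ^ card T)"
    using sum_moebius_prime_sets[OF P, of "\<lambda>_. 1"] by simp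
  also have "\<dots> = (\<Prod>p\<in>P. 1 - 1 :: real)"
    using prod_diff_conv_sum[OF P(1), of "\<lambda>_. 1::real" "\<lambda>_. 1"] by simp
  also have "\<dots> = of_bool (P = {})" using P(1) by (simp add: card_gt_0_iff)
  also have "P = {} \<longleftrightarrow> squarefree n"
  proof -
    have "squarefree n \<longleftrightarrow> (\<forall>p. prime p \<longrightarrow> \<not> p dvd s)"
      using squarefree_factorial_semiring[OF n] by (simp add: s_def dvd_square_part_iff)
    also have "\<dots> \<longleftrightarrow> P = {}" using s0 by (auto simp: P_def prime_factors_dvd)
    finally show ?thesis ..
  qed
  finally show ?thesis .
qed

text \<open>Expanding the finite product gives one term for each set of primes up to
  \<open>B\<close>, and multiplicativity of the density turns it into a Moebius term.\<close>

lemma prod_euler_factor_eq: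
  "(\<Prod>n\<le>B. euler_factor k n) = (\<Sum>d | 0 < d \<and> squarefree d \<and> prime_factors d \<subseteq> {p. prime p \<and> p \<le> int B}. moebius d * density k d)"
proof -
  define P where "P = {p::int. prime p \<and> p \<le> int B}"
  have finP: "finite P" by (rule finite_subset[of _ "{0..int B}"]) (auto simp: P_def prime_ge_0_int)
  have P: "\<And>p. p \<in> P \<Longrightarrow> prime p" by (simp add: P_def)
  have "(\<Prod>n\<le>B. euler_factor k n) = (\<Prod>n | n \<le> B \<and> prime n. 1 - density k (int n))"
  proof (rule prod.mono_neutral_cong_right)
    show "\<And>n. n \<in> {n. n \<le> B \<and> prime n} \<Longrightarrow> euler_factor k n = 1 - density k (int n)"
      by (simp add: euler_factor_def density_def lambda_count_eq_residue_count prime_gt_0_nat)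
  qed (auto simp: euler_factor_def)
  also have "\<dots> = (\<Prod>p\<in>P. 1 - density k p)"
    by (rule prod.reindex_bij_witness[of _ nat int]) (auto simp: P_def prime_ge_0_int nat_le_iff)
  also have "\<dots> = (\<Sum>T\<in>Pow P. (-1) ^ card T * (\<Prod>p\<in>T. density k p) * (\<Prod>p\<in>P - T. 1))"
    using prod_diff_conv_sum[OF finP, of "\<lambda>_. 1::real" "density k"] by simp
  also have "\<dots> = (\<Sum>T\<in>Pow P. (-1) ^ card T * density k (\<Prod>T))"
  proof (rule sum.cong[OF refl])
    fix T assume "T \<in> Pow P"
    then have "density k (\<Prod>T) = (\<Prod>p\<in>T. density k p)"
      using P finP by (intro density_prod_primes) (auto dest: finite_subset)
    then show "(-1) ^ card T * (\<Prod>p\<in>T. density k p) * (\<Prod>p\<in>P - T. 1) = (-1) ^ card T * density k (\<Prod>T)" by simp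
  qed
  also have "\<dots> = (\<Sum>d | 0 < d \<and> squarefree d \<and> prime_factors d \<subseteq> P. moebius d * density k d)"
    using sum_moebius_prime_sets[OF finP P, of "density k"] by simp
  finally show ?thesis by (simp add: P_def)
qed

section \<open>Truncation of the Moebius sum\<close>

text \<open>A bound for all finite sets at once lets one constant serve every tail and every
  truncated sum.\<close>

lemma sum_powr_le:
  fixes \<delta> :: real
  assumes "\<delta> > 0"
  shows "\<exists>Z\<ge>0. \<forall>G::int set. finite G \<longrightarrow> (\<forall>d\<in>G. 0 < d) \<longrightarrow> (\<Sum>d\<in>G. real_of_int d powr (-1 - \<delta>)) \<le> Z"
proof (intro exI conjI allI impI)
  have sm: "summable (\<lambda>n. real n powr (-1 - \<delta>))" using assms by (simp add: summable_real_powr_iff)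
  show "0 \<le> (\<Sum>n. real n powr (-1 - \<delta>))" by (rule suminf_nonneg[OF sm]) simp
  fix G :: "int set" assume G: "finite G" "\<forall>d\<in>G. 0 < d"
  have "(\<Sum>d\<in>G. real_of_int d powr (-1 - \<delta>)) = (\<Sum>n\<in>nat ` G. real n powr (-1 - \<delta>))"
    using G by (subst sum.reindex) (auto simp: inj_on_def intro!: sum.cong)
  also have "\<dots> \<le> (\<Sum>n. real n powr (-1 - \<delta>))" using G by (intro sum_le_suminf[OF sm]) auto
  finally show "(\<Sum>d\<in>G. real_of_int d powr (-1 - \<delta>)) \<le> (\<Sum>n. real n powr (-1 - \<delta>))" .
qed

lemma density_le_powr:
  fixes \<delta> :: real
  assumes "\<delta> > 0"
  shows "\<exists>C\<ge>0. \<forall>d>0. squarefree d \<longrightarrow> density k d \<le> C * real_of_int d powr (\<delta> - 2)"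
proof -
  obtain C where C: "C \<ge> 1" "\<And>n. n > 0 \<Longrightarrow> real (tau n) \<le> C * real_of_int n powr (\<delta> / 3)"
    using tau_le_powr[of "\<delta> / 3"] assms by auto
  define K where "K = 2 * (4 * \<bar>real_of_int k\<bar> + 2)"
  have "density k d \<le> K * C ^ 3 * real_of_int d powr (\<delta> - 2)" if d: "d > 0" "squarefree d" for d
  proof -
    have "density k d \<le> K * real (tau d) ^ 3 / real_of_int d ^ 2" using density_le[OF d] by (simp add: K_def)
    also have "\<dots> \<le> K * (C * real_of_int d powr (\<delta> / 3)) ^ 3 / real_of_int d ^ 2"
      using C(2)[OF d(1)] by (intro divide_right_mono mult_left_mono power_mono) (auto simp: K_def)
    also have "\<dots> = K * C ^ 3 * (real_of_int d powr \<delta> / real_of_int d powr 2)"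
      using d by (simp add: power_mult_distrib powr_power)
    also have "\<dots> = K * C ^ 3 * real_of_int d powr (\<delta> - 2)" by (simp add: powr_diff)
    finally show ?thesis .
  qed
  then show ?thesis using C by (intro exI[of _ "K * C ^ 3"]) (auto simp: K_def)
qed

lemma convergent_prod_euler_factor: "convergent_prod (euler_factor k)"
proof -
  obtain C where C: "C \<ge> 0" "\<And>d. d > 0 \<Longrightarrow> squarefree d \<Longrightarrow> density k d \<le> C * real_of_int d powr (1 / 2 - 2)"
    using density_le_powr[of "1 / 2" k] by auto
  have "summable (\<lambda>n. norm (euler_factor k n - 1))"
  proof (rule summable_comparison_test')
    have "summable (\<lambda>n. real n powr (1 / 2 - 2))" by (simp add: summable_real_powr_iff)
    then show "summable (\<lambda>n. C * real n powr (1 / 2 - 2))" by (rule summable_mult)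
    fix n :: nat
    show "norm (norm (euler_factor k n - 1)) \<le> C * real n powr (1 / 2 - 2)"
    proof (cases "prime n")
      case True
      then have n0: "n > 0" by (simp add: prime_gt_0_nat)
      have "euler_factor k n = 1 - density k (int n)"
        using True n0 by (simp add: euler_factor_def density_def lambda_count_eq_residue_count)
      moreover have "density k (int n) \<le> C * real_of_int (int n) powr (1 / 2 - 2)"
        using True n0 by (intro C squarefree_prime) auto
      ultimately show ?thesis using density_nonneg[of k "int n"] by simp
    qed (use C in \<open>simp add: euler_factor_def\<close>)
  qed
  then have "abs_convergent_prod (euler_factor k)" by (simp only: abs_convergent_prod_conv_summable)
  then show ?thesis by (rule abs_convergent_prod_imp_convergent_prod)
qed

definition sqfree_upto :: "real \<Rightarrow> int set" where
  "sqfree_upto D = {d. 0 < d \<and> real_of_int d \<le> D \<and> squarefree d}"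

lemma sqfree_upto_subset: "sqfree_upto D \<subseteq> {1..\<lfloor>D\<rfloor>}"
  by (auto simp: sqfree_upto_def le_floor_iff)

lemma finite_sqfree_upto: "finite (sqfree_upto D)"
  using sqfree_upto_subset by (rule finite_subset) simp

lemma card_sqfree_upto_le: "D \<ge> 0 \<Longrightarrow> real (card (sqfree_upto D)) \<le> D"
  using card_mono[OF _ sqfree_upto_subset[of D]] by simp linarith

text \<open>Rankin's trick: split off \<open>d powr (-1 - \<delta>)\<close>; the remaining power has
  nonpositive exponent and is largest at \<open>D\<close>.\<close>

lemma sum_powr_tail_le:
  fixes \<delta> :: real
  assumes G: "finite G" "\<And>d. d \<in> G \<Longrightarrow> D < real_of_int d" and D: "D \<ge> 1" and \<alpha>: "\<alpha> + 1 + \<delta> \<le> 0"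
    and Z: "\<forall>G::int set. finite G \<longrightarrow> (\<forall>d\<in>G. 0 < d) \<longrightarrow> (\<Sum>d\<in>G. real_of_int d powr (-1 - \<delta>)) \<le> Z"
  shows "(\<Sum>d\<in>G. real_of_int d powr \<alpha>) \<le> D powr (\<alpha> + 1 + \<delta>) * Z"
proof -
  have "real_of_int d powr \<alpha> \<le> D powr (\<alpha> + 1 + \<delta>) * real_of_int d powr (-1 - \<delta>)" if "d \<in> G" for d
  proof -
    have "real_of_int d powr \<alpha> = real_of_int d powr (\<alpha> + 1 + \<delta>) * real_of_int d powr (-1 - \<delta>)"
      by (simp flip: powr_add)
    also have "real_of_int d powr (\<alpha> + 1 + \<delta>) \<le> D powr (\<alpha> + 1 + \<delta>)"
      using G(2)[OF that] D \<alpha> by (intro powr_mono2') auto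
    finally show ?thesis by (simp add: mult_right_mono)
  qed
  then have "(\<Sum>d\<in>G. real_of_int d powr \<alpha>) \<le> (\<Sum>d\<in>G. D powr (\<alpha> + 1 + \<delta>) * real_of_int d powr (-1 - \<delta>))"
    by (rule sum_mono)
  also have "\<dots> = D powr (\<alpha> + 1 + \<delta>) * (\<Sum>d\<in>G. real_of_int d powr (-1 - \<delta>))" by (simp add: sum_distrib_left)
  also have "(\<Sum>d\<in>G. real_of_int d powr (-1 - \<delta>)) \<le> Z"
  proof -
    have "\<forall>d\<in>G. 0 < d" using G(2) D by (metis of_int_0_less_iff less_le_trans less_trans zero_less_one)
    then show ?thesis using Z G(1) by blast
  qed
  finally show ?thesis by (simp add: mult_left_mono)
qed

text \<open>A partial product over primes up to \<open>B\<close> is a Moebius sum that contains all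
  square-free \<open>d \<le> D\<close> once \<open>B \<ge> D\<close>. The surplus is part of a tail
  beyond \<open>D\<close>, bounded uniformly in \<open>B\<close>, so the bound passes to the
  limit.\<close>

lemma prodinf_euler_factor_approx:
  fixes \<delta> :: real
  assumes \<delta>: "0 < \<delta>" "\<delta> \<le> 1 / 2"
  shows "\<exists>C\<ge>0. \<forall>D\<ge>1. \<bar>(\<Prod>p. euler_factor k p) - (\<Sum>d\<in>sqfree_upto D. moebius d * density k d)\<bar> \<le> C * D powr (2 * \<delta> - 1)"
proof -
  obtain C where C: "C \<ge> 0" "\<And>d. d > 0 \<Longrightarrow> squarefree d \<Longrightarrow> density k d \<le> C * real_of_int d powr (\<delta> - 2)"
    using density_le_powr[of \<delta> k] \<delta> by auto
  obtain Z where Z: "Z \<ge> 0" "\<forall>G::int set. finite G \<longrightarrow> (\<forall>d\<in>G. 0 < d) \<longrightarrow> (\<Sum>d\<in>G. real_of_int d powr (-1 - \<delta>)) \<le> Z"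
    using sum_powr_le[of \<delta>] \<delta> by auto
  have "\<bar>(\<Prod>p. euler_factor k p) - (\<Sum>d\<in>sqfree_upto D. moebius d * density k d)\<bar> \<le> C * Z * D powr (2 * \<delta> - 1)" if D: "D \<ge> 1" for D
  proof (rule LIMSEQ_le_const2)
    show "(\<lambda>B. \<bar>(\<Prod>n\<le>B. euler_factor k n) - (\<Sum>d\<in>sqfree_upto D. moebius d * density k d)\<bar>) \<longlonglongrightarrow>
        \<bar>(\<Prod>p. euler_factor k p) - (\<Sum>d\<in>sqfree_upto D. moebius d * density k d)\<bar>"
      by (intro tendsto_intros convergent_prod_LIMSEQ convergent_prod_euler_factor)
    show "\<exists>B0. \<forall>B\<ge>B0. \<bar>(\<Prod>n\<le>B. euler_factor k n) - (\<Sum>d\<in>sqfree_upto D. moebius d * density k d)\<bar> \<le> C * Z * D powr (2 * \<delta> - 1)"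
    proof (intro exI allI impI)
      fix B assume B: "nat \<lceil>D\<rceil> \<le> B"
      define P where "P = {p::int. prime p \<and> p \<le> int B}"
      define I where "I = {d. 0 < d \<and> squarefree d \<and> prime_factors d \<subseteq> P}"
      have finP: "finite P" by (rule finite_subset[of _ "{0..int B}"]) (auto simp: P_def prime_ge_0_int)
      have P: "\<And>p. p \<in> P \<Longrightarrow> prime p" by (simp add: P_def)
      have finI: "finite I" using bij_betw_finite[OF bij_betw_prime_sets[OF finP P]] finP by (simp add: I_def)
      have sub: "sqfree_upto D \<subseteq> I"
      proof
        fix d assume d: "d \<in> sqfree_upto D"
        have "p \<in> P" if "p \<in> prime_factors d" for p
        proof -
          have "p \<le> d" using that d by (auto simp: sqfree_upto_def prime_factors_dvd intro: zdvd_imp_le)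
          also have "d \<le> int B" using d B D unfolding sqfree_upto_def by simp
          finally show ?thesis using that by (auto simp: P_def)
        qed
        then show "d \<in> I" using d by (auto simp: I_def sqfree_upto_def)
      qed
      have "(\<Prod>n\<le>B. euler_factor k n) - (\<Sum>d\<in>sqfree_upto D. moebius d * density k d) = (\<Sum>d\<in>I - sqfree_upto D. moebius d * density k d)"
        using sum_diff[OF finI sub, of "\<lambda>d. moebius d * density k d"]
        unfolding prod_euler_factor_eq P_def[symmetric] I_def[symmetric] by simp
      also have "\<bar>\<dots>\<bar> \<le> (\<Sum>d\<in>I - sqfree_upto D. density k d)"
        using density_nonneg by (intro order.trans[OF sum_abs]) (simp add: abs_mult)
      also have "\<dots> \<le> (\<Sum>d\<in>I - sqfree_upto D. C * real_of_int d powr (\<delta> - 2))"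
        by (intro sum_mono C) (auto simp: I_def)
      also have "\<dots> = C * (\<Sum>d\<in>I - sqfree_upto D. real_of_int d powr (\<delta> - 2))" by (simp add: sum_distrib_left)
      also have "\<dots> \<le> C * (D powr ((\<delta> - 2) + 1 + \<delta>) * Z)"
        using C(1) finI \<delta> D Z(2) by (intro mult_left_mono sum_powr_tail_le) (auto simp: I_def sqfree_upto_def)
      also have "(\<delta> - 2) + 1 + \<delta> = 2 * \<delta> - 1" by simp
      finally show "\<bar>(\<Prod>n\<le>B. euler_factor k n) - (\<Sum>d\<in>sqfree_upto D. moebius d * density k d)\<bar> \<le> C * Z * D powr (2 * \<delta> - 1)"
        by (simp add: mult_ac)
    qed
  qed
  then show ?thesis using C Z by (intro exI[of _ "C * Z"]) auto
qed

definition sqfree_count :: "nat \<Rightarrow> int \<Rightarrow> real" where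
  "sqfree_count N k = (\<Sum>x\<in>{1..int N} \<times> {1..int N} \<times> {1..int N}. of_bool (squarefree (norm_sq x + k)))"

lemma S3_eq_sqfree_count: "H \<ge> 0 \<Longrightarrow> real (S3 H k) = sqfree_count (nat \<lfloor>H\<rfloor>) k"
  by (simp add: S3_def sqfree_count_def moebius_sq_def norm_sq_def sum.cartesian_product split_def of_bool_def if_distrib cong: if_cong)

text \<open>Points with \<open>F x = 0\<close> are divisible by every square and are treated apart:
  there are at most \<open>R\<close>, each with a truncated sum of size at most \<open>D\<close>. At
  the other points the omitted \<open>d\<close> satisfy \<open>F x = d\<^sup>2 * j\<close> with few
  \<open>j\<close>, and each value of \<open>F\<close> is taken at most \<open>R\<close>
  times.\<close>

lemma sqfree_count_truncate:
  fixes N :: nat and k :: int and D R \<delta> :: real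
  assumes N: "N \<ge> 1" and D: "D \<ge> 1" and \<delta>: "0 < \<delta>" "\<delta> \<le> 1" and R: "R \<ge> 0"
    and rep: "\<And>n. real (card {x \<in> {1..int N} \<times> {1..int N} \<times> {1..int N}. norm_sq x = n}) \<le> R"
    and Z: "\<forall>G::int set. finite G \<longrightarrow> (\<forall>d\<in>G. 0 < d) \<longrightarrow> (\<Sum>d\<in>G. real_of_int d powr (-1 - \<delta>)) \<le> Z"
  shows "\<bar>sqfree_count N k - (\<Sum>d\<in>sqfree_upto D. moebius d * cube_count N k (d\<^sup>2))\<bar>
     \<le> D * R + 2 * ((3 + \<bar>real_of_int k\<bar>) * real N ^ 2) * R * (D powr (\<delta> - 1) * Z)"
proof -
  define X where "X = {1..int N} \<times> {1..int N} \<times> {1..int N}"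
  have finX: "finite X" by (simp add: X_def)
  define F where "F x = norm_sq x + k" for x
  define M where "M = 3 * int N ^ 2 + \<bar>k\<bar>"
  define L where "L = {d::int. D < real_of_int d \<and> d \<le> M}"
  have finL: "finite L"
  proof (rule finite_subset)
    show "L \<subseteq> {0..M}" using D by (auto simp: L_def)
  qed simp
  have L0: "d > 0" if "d \<in> L" for d using that D by (auto simp: L_def)
  have FM: "\<bar>F x\<bar> \<le> M" if "x \<in> X" for x
  proof -
    obtain x1 x2 x3 where x: "x = (x1, x2, x3)" by (cases x)
    have "x1\<^sup>2 \<le> (int N)\<^sup>2" "x2\<^sup>2 \<le> (int N)\<^sup>2" "x3\<^sup>2 \<le> (int N)\<^sup>2"
      using that by (auto simp: X_def x intro!: power_mono)
    moreover have "0 \<le> x1\<^sup>2" "0 \<le> x2\<^sup>2" "0 \<le> x3\<^sup>2" by simp_all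
    ultimately show ?thesis unfolding F_def norm_sq_def M_def x prod.case by linarith
  qed
  have rep': "real (card {x \<in> X. F x = n}) \<le> R" for n
    using rep[of "n - k"] by (simp add: X_def F_def eq_diff_eq)
  have pointwise: "\<bar>of_bool (squarefree (F x)) - (\<Sum>d\<in>sqfree_upto D. of_bool (d\<^sup>2 dvd F x) * moebius d)\<bar>
      \<le> of_bool (F x = 0) * D + (\<Sum>d\<in>L. of_bool (F x \<noteq> 0 \<and> d\<^sup>2 dvd F x))" if x: "x \<in> X" for x
  proof (cases "F x = 0")
    case True
    have "\<bar>\<Sum>d\<in>sqfree_upto D. of_bool (d\<^sup>2 dvd F x) * moebius d\<bar> \<le> (\<Sum>d\<in>sqfree_upto D. 1)"
      by (rule order.trans[OF sum_abs]) (intro sum_mono, simp add: abs_mult)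
    also have "\<dots> \<le> D" using card_sqfree_upto_le[of D] D by simp
    finally show ?thesis using True by simp
  next
    case False
    define G where "G = {d. 0 < d \<and> squarefree d \<and> d\<^sup>2 dvd F x}"
    have dM: "d \<le> M" if "d \<in> G" for d
    proof -
      have d: "0 < d" "d\<^sup>2 dvd F x" using that by (auto simp: G_def)
      have "d \<le> d\<^sup>2" using d by (simp add: power2_eq_square mult_le_cancel_left1)
      also have "d\<^sup>2 \<le> \<bar>F x\<bar>" using d False by (metis dvd_abs_iff dvd_imp_le_int abs_abs abs_of_nonneg zero_le_power2)
      also have "\<dots> \<le> M" by (rule FM[OF x])
      finally show ?thesis .
    qed
    have finG: "finite G"
    proof (rule finite_subset)
      show "G \<subseteq> {0..M}" using dM by (auto simp: G_def)
    qed simp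
    have "(\<Sum>d\<in>sqfree_upto D. of_bool (d\<^sup>2 dvd F x) * moebius d) = (\<Sum>d\<in>G \<inter> sqfree_upto D. moebius d)"
      using finite_sqfree_upto[of D] by (intro sum.mono_neutral_cong_right) (auto simp: G_def sqfree_upto_def)
    moreover have "of_bool (squarefree (F x)) = (\<Sum>d\<in>G. moebius d)"
      using sum_moebius_square_divisors[OF False] by (simp add: G_def)
    moreover have "(\<Sum>d\<in>G. moebius d) = (\<Sum>d\<in>G \<inter> sqfree_upto D. moebius d) + (\<Sum>d\<in>G - sqfree_upto D. moebius d)"
      using finG by (rule sum.Int_Diff)
    ultimately have "\<bar>of_bool (squarefree (F x)) - (\<Sum>d\<in>sqfree_upto D. of_bool (d\<^sup>2 dvd F x) * moebius d)\<bar>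
       = \<bar>\<Sum>d\<in>G - sqfree_upto D. moebius d\<bar>" by simp
    also have "\<dots> \<le> (\<Sum>d\<in>G - sqfree_upto D. of_bool (F x \<noteq> 0 \<and> d\<^sup>2 dvd F x))"
      using False by (intro order.trans[OF sum_abs] sum_mono) (auto simp: G_def)
    also have "\<dots> \<le> (\<Sum>d\<in>L. of_bool (F x \<noteq> 0 \<and> d\<^sup>2 dvd F x))"
      using dM by (intro sum_mono2 finL) (auto simp: L_def sqfree_upto_def G_def)
    finally show ?thesis using False by simp
  qed
  have multiples: "real (card {x \<in> X. F x \<noteq> 0 \<and> d\<^sup>2 dvd F x}) \<le> 2 * (real_of_int M * real_of_int d powr -2) * R" if d: "d \<in> L" for d
  proof -
    note d0 = L0[OF d]
    define m where "m = M div d\<^sup>2"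
    have m0: "m \<ge> 0" using d0 by (simp add: m_def M_def pos_imp_zdiv_nonneg_iff)
    \<comment> \<open>Negative cofactors can occur because \<open>k\<close> may be negative; 0 is
      left out because \<open>F x\<close> is nonzero.\<close>
    define Ms where "Ms = {-m..m} - {0}"
    have cardMs: "card Ms = nat (2 * m)" using m0 by (simp add: Ms_def card_Diff_singleton)
    have "{x \<in> X. F x \<noteq> 0 \<and> d\<^sup>2 dvd F x} \<subseteq> (\<Union>j\<in>Ms. {x \<in> X. F x = d\<^sup>2 * j})"
    proof
      fix x assume "x \<in> {x \<in> X. F x \<noteq> 0 \<and> d\<^sup>2 dvd F x}"
      then have x: "x \<in> X" "F x \<noteq> 0" "d\<^sup>2 dvd F x" by auto
      then obtain j where j: "F x = d\<^sup>2 * j" by (elim dvdE)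
      have "d\<^sup>2 * \<bar>j\<bar> \<le> M" using FM[OF x(1)] j by (simp add: abs_mult)
      then have "\<bar>j\<bar> \<le> m" unfolding m_def using zdiv_mono1[of "d\<^sup>2 * \<bar>j\<bar>" M "d\<^sup>2"] d0 by simp
      then have "j \<in> Ms" using x j by (auto simp: Ms_def)
      then show "x \<in> (\<Union>j\<in>Ms. {x \<in> X. F x = d\<^sup>2 * j})" using x j by blast
    qed
    then have "card {x \<in> X. F x \<noteq> 0 \<and> d\<^sup>2 dvd F x} \<le> card (\<Union>j\<in>Ms. {x \<in> X. F x = d\<^sup>2 * j})"
      using finX by (intro card_mono) (auto simp: Ms_def)
    also have "\<dots> \<le> (\<Sum>j\<in>Ms. card {x \<in> X. F x = d\<^sup>2 * j})" by (rule card_UN_le) (simp add: Ms_def)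
    finally have "real (card {x \<in> X. F x \<noteq> 0 \<and> d\<^sup>2 dvd F x}) \<le> (\<Sum>j\<in>Ms. real (card {x \<in> X. F x = d\<^sup>2 * j}))"
      by (simp only: of_nat_le_iff flip: of_nat_sum)
    also have "\<dots> \<le> (\<Sum>j\<in>Ms. R)" by (intro sum_mono rep')
    also have "\<dots> = 2 * real_of_int m * R" using cardMs m0 by simp
    also have "real_of_int m \<le> real_of_int M * real_of_int d powr -2"
    proof -
      have "real_of_int m \<le> real_of_int M / real_of_int (d\<^sup>2)" unfolding m_def by (rule real_of_int_div4)
      then show ?thesis using d0 by (simp add: powr_minus divide_inverse)
    qed
    finally show ?thesis using R by (simp add: mult_right_mono)
  qed
  have "(\<Sum>d\<in>sqfree_upto D. moebius d * cube_count N k (d\<^sup>2)) = (\<Sum>d\<in>sqfree_upto D. \<Sum>x\<in>X. of_bool (d\<^sup>2 dvd F x) * moebius d)"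
  proof (rule sum.cong[OF refl])
    fix d
    have "{x \<in> X. d\<^sup>2 dvd F x} = X \<inter> {x. d\<^sup>2 dvd F x}" by blast
    then have "cube_count N k (d\<^sup>2) = card (X \<inter> {x. d\<^sup>2 dvd F x})" by (simp only: cube_count_def X_def F_def)
    then show "moebius d * cube_count N k (d\<^sup>2) = (\<Sum>x\<in>X. of_bool (d\<^sup>2 dvd F x) * moebius d)"
      using finX by (simp flip: sum_distrib_right)
  qed
  also have "\<dots> = (\<Sum>x\<in>X. \<Sum>d\<in>sqfree_upto D. of_bool (d\<^sup>2 dvd F x) * moebius d)" by (rule sum.swap)
  finally have "sqfree_count N k - (\<Sum>d\<in>sqfree_upto D. moebius d * cube_count N k (d\<^sup>2)) =
     (\<Sum>x\<in>X. of_bool (squarefree (F x)) - (\<Sum>d\<in>sqfree_upto D. of_bool (d\<^sup>2 dvd F x) * moebius d))"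
    by (simp add: sqfree_count_def X_def F_def sum_subtractf)
  also have "\<bar>\<dots>\<bar> \<le> (\<Sum>x\<in>X. of_bool (F x = 0) * D + (\<Sum>d\<in>L. of_bool (F x \<noteq> 0 \<and> d\<^sup>2 dvd F x)))"
    by (rule order.trans[OF sum_abs]) (intro sum_mono pointwise)
  also have "\<dots> = (\<Sum>x\<in>X. of_bool (F x = 0)) * D + (\<Sum>d\<in>L. \<Sum>x\<in>X. of_bool (F x \<noteq> 0 \<and> d\<^sup>2 dvd F x))"
    by (simp only: sum.distrib sum_distrib_right sum.swap[of _ X L])
  also have "\<dots> = real (card {x \<in> X. F x = 0}) * D + (\<Sum>d\<in>L. real (card {x \<in> X. F x \<noteq> 0 \<and> d\<^sup>2 dvd F x}))"
  proof -
    have "(\<Sum>x\<in>X. of_bool (P x)) = real (card {x \<in> X. P x})" for P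
      using finX by (simp add: Int_def)
    then show ?thesis by simp
  qed
  also have "\<dots> \<le> R * D + (\<Sum>d\<in>L. 2 * (real_of_int M * real_of_int d powr -2) * R)"
    using D by (intro add_mono mult_right_mono rep' sum_mono multiples) auto
  also have "(\<Sum>d\<in>L. 2 * (real_of_int M * real_of_int d powr -2) * R) = 2 * real_of_int M * R * (\<Sum>d\<in>L. real_of_int d powr -2)"
    by (simp add: sum_distrib_left mult_ac)
  also have "\<dots> \<le> 2 * ((3 + \<bar>real_of_int k\<bar>) * real N ^ 2) * R * (D powr (-2 + 1 + \<delta>) * Z)"
  proof (intro mult_mono mult_nonneg_nonneg sum_nonneg)
    have "real N ^ 2 \<ge> 1" using N by simp
    then have "\<bar>real_of_int k\<bar> * 1 \<le> \<bar>real_of_int k\<bar> * real N ^ 2" by (intro mult_left_mono) auto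
    then show "real_of_int M \<le> (3 + \<bar>real_of_int k\<bar>) * real N ^ 2" by (simp add: M_def distrib_right)
    show "(\<Sum>d\<in>L. real_of_int d powr -2) \<le> D powr (-2 + 1 + \<delta>) * Z"
      using finL D \<delta> Z by (intro sum_powr_tail_le) (auto simp: L_def)
  qed (use R in \<open>auto simp: M_def\<close>)
  finally show ?thesis by (simp add: mult_ac)
qed

lemma hsum_le_powr:
  assumes Z: "\<forall>G::int set. finite G \<longrightarrow> (\<forall>d\<in>G. 0 < d) \<longrightarrow> (\<Sum>d\<in>G. real_of_int d powr (-1 - \<delta>)) \<le> Z"
    and \<delta>: "\<delta> > 0"
  shows "hsum n \<le> real_of_int n powr \<delta> * Z"
proof -
  have "hsum n \<le> (\<Sum>j\<in>{1..n}. real_of_int n powr \<delta> * real_of_int j powr (-1 - \<delta>))"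
    unfolding hsum_def
  proof (rule sum_mono)
    fix j assume j: "j \<in> {1..n}"
    have "1 / real_of_int j = real_of_int j powr \<delta> * real_of_int j powr (-1 - \<delta>)"
      using j by (simp add: powr_minus divide_inverse flip: powr_add)
    also have "\<dots> \<le> real_of_int n powr \<delta> * real_of_int j powr (-1 - \<delta>)"
      using j \<delta> by (intro mult_right_mono powr_mono2) auto
    finally show "1 / real_of_int j \<le> real_of_int n powr \<delta> * real_of_int j powr (-1 - \<delta>)" .
  qed
  also have "\<dots> = real_of_int n powr \<delta> * (\<Sum>j\<in>{1..n}. real_of_int j powr (-1 - \<delta>))" by (simp add: sum_distrib_left)
  also have "\<dots> \<le> real_of_int n powr \<delta> * Z" using Z by (intro mult_left_mono) auto
  finally show ?thesis .
qed

section \<open>The asymptotic formula\<close>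

lemma card_norm_sq_eq_le:
  fixes \<delta> :: real
  assumes "\<delta> > 0"
  shows "\<exists>C\<ge>0. \<forall>N>0. \<forall>n. real (card {x \<in> {1..int N} \<times> {1..int N} \<times> {1..int N}. norm_sq x = n}) \<le> C * real N powr (1 + \<delta>)"
proof -
  have "{x \<in> {1..int N} \<times> {1..int N} \<times> {1..int N}. norm_sq x = n} =
    {(x, y, z). x \<in> {1..int N} \<and> y \<in> {1..int N} \<and> z \<in> {1..int N} \<and> x\<^sup>2 + y\<^sup>2 + z\<^sup>2 = n}" for N n
    by (auto simp: norm_sq_def)
  then show ?thesis using card_sum_three_squares_le[OF assms] by simp
qed

text \<open>The exponent is \<open>26 = 3 * 6 + 4 * 2\<close>: the divisor bound up to
  \<open>3 * N ^ 6\<close>, cubed, and the harmonic sum up to \<open>N ^ 2\<close>, to the fourth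
  power.\<close>

lemma tau_hsum_powr_bound:
  fixes \<delta> :: real
  assumes \<delta>: "0 < \<delta>" "\<delta> \<le> 1"
  shows "\<exists>C\<ge>0. \<forall>N\<ge>1. \<exists>T\<ge>0. (\<forall>n. 0 < n \<longrightarrow> n \<le> 3 * int N ^ 6 \<longrightarrow> real (tau n) \<le> T) \<and>
     T ^ 3 * hsum (int N ^ 2) ^ 4 \<le> C * real N powr (26 * \<delta>)"
proof -
  obtain C where C: "C \<ge> 1" "\<And>n. n > 0 \<Longrightarrow> real (tau n) \<le> C * real_of_int n powr \<delta>"
    using tau_le_powr[of \<delta>] \<delta> by auto
  obtain Z where Z: "Z \<ge> 0" "\<forall>G::int set. finite G \<longrightarrow> (\<forall>d\<in>G. 0 < d) \<longrightarrow> (\<Sum>d\<in>G. real_of_int d powr (-1 - \<delta>)) \<le> Z"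
    using sum_powr_le[of \<delta>] \<delta> by auto
  show ?thesis
  proof (rule exI[of _ "27 * C ^ 3 * Z ^ 4"], intro conjI allI impI)
    show "0 \<le> 27 * C ^ 3 * Z ^ 4" using C Z by simp
    fix N :: nat assume N: "N \<ge> 1"
    define T where "T = 3 * C * real N powr (6 * \<delta>)"
    have T0: "T \<ge> 0" using C by (simp add: T_def)
    have tau: "real (tau n) \<le> T" if n: "0 < n" "n \<le> 3 * int N ^ 6" for n
    proof -
      have "real_of_int n \<le> real_of_int (3 * int N ^ 6)" using n(2) by (simp only: of_int_le_iff)
      then have "real_of_int n powr \<delta> \<le> (3 * real N ^ 6) powr \<delta>" using n \<delta> by (intro powr_mono2) auto
      also have "\<dots> = 3 powr \<delta> * real N powr (6 * \<delta>)"
      proof -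
        have "real N ^ 6 = real N powr 6" using N by simp
        then show ?thesis by (simp add: powr_mult powr_powr del: powr_numeral)
      qed
      also have "\<dots> \<le> 3 powr 1 * real N powr (6 * \<delta>)" using \<delta> by (intro mult_right_mono powr_mono) auto
      finally have "C * real_of_int n powr \<delta> \<le> C * (3 * real N powr (6 * \<delta>))" using C(1) by simp
      then show ?thesis using C(2)[OF n(1)] by (simp add: T_def mult_ac)
    qed
    have "hsum (int N ^ 2) \<le> real_of_int (int N ^ 2) powr \<delta> * Z" by (rule hsum_le_powr[OF Z(2) \<delta>(1)])
    also have "real_of_int (int N ^ 2) powr \<delta> = real N powr (2 * \<delta>)"
    proof -
      have "real_of_int (int N ^ 2) = real N powr 2" using N by simp
      then show ?thesis by (simp only: powr_powr)
    qed
    finally have "T ^ 3 * hsum (int N ^ 2) ^ 4 \<le> T ^ 3 * (real N powr (2 * \<delta>) * Z) ^ 4"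
      using T0 hsum_nonneg by (intro mult_left_mono power_mono) auto
    also have "\<dots> = 27 * C ^ 3 * Z ^ 4 * (real N powr (18 * \<delta>) * real N powr (8 * \<delta>))"
      using N by (simp add: T_def power_mult_distrib powr_power mult_ac)
    also have "real N powr (18 * \<delta>) * real N powr (8 * \<delta>) = real N powr (26 * \<delta>)"
      by (simp flip: powr_add)
    finally have "T ^ 3 * hsum (int N ^ 2) ^ 4 \<le> 27 * C ^ 3 * Z ^ 4 * real N powr (26 * \<delta>)" .
    then show "\<exists>T\<ge>0. (\<forall>n. 0 < n \<longrightarrow> n \<le> 3 * int N ^ 6 \<longrightarrow> real (tau n) \<le> T) \<and>
       T ^ 3 * hsum (int N ^ 2) ^ 4 \<le> 27 * C ^ 3 * Z ^ 4 * real N powr (26 * \<delta>)"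
      using T0 tau by blast
  qed
qed

lemma sqfree_count_asymptotic:
  fixes k :: int and \<epsilon> :: real
  assumes \<epsilon>: "\<epsilon> > 0"
  shows "\<exists>C\<ge>0. \<forall>N\<ge>1. \<bar>sqfree_count N k - (\<Prod>p. euler_factor k p) * real N ^ 3\<bar> \<le> C * real N powr (9 / 4 + \<epsilon>)"
proof -
  \<comment> \<open>The largest loss is \<open>26 * \<delta>\<close>, from
    \<open>tau_hsum_powr_bound\<close>; the cap 1/2 is required by
    \<open>prodinf_euler_factor_approx\<close>.\<close>
  define \<delta> where "\<delta> = min (1 / 2) (\<epsilon> / 26)"
  have \<delta>: "0 < \<delta>" "\<delta> \<le> 1 / 2" "26 * \<delta> \<le> \<epsilon>" using \<epsilon> by (auto simp: \<delta>_def)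
  define K where "K = 4 * \<bar>real_of_int k\<bar> + 2"
  obtain C1 where C1: "C1 \<ge> 0" "\<And>N n. N > 0 \<Longrightarrow> real (card {x \<in> {1..int N} \<times> {1..int N} \<times> {1..int N}. norm_sq x = n}) \<le> C1 * real N powr (1 + \<delta>)"
    using card_norm_sq_eq_le[OF \<delta>(1)] by blast
  obtain C2 where C2: "C2 \<ge> 0" "\<And>N. N \<ge> 1 \<Longrightarrow> \<exists>T\<ge>0. (\<forall>n. 0 < n \<longrightarrow> n \<le> 3 * int N ^ 6 \<longrightarrow> real (tau n) \<le> T) \<and>
     T ^ 3 * hsum (int N ^ 2) ^ 4 \<le> C2 * real N powr (26 * \<delta>)"
    using tau_hsum_powr_bound[of \<delta>] \<delta> by auto
  obtain C3 where C3: "C3 \<ge> 0" "\<And>D. D \<ge> 1 \<Longrightarrow> \<bar>(\<Prod>p. euler_factor k p) - (\<Sum>d\<in>sqfree_upto D. moebius d * density k d)\<bar> \<le> C3 * D powr (2 * \<delta> - 1)"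
    using prodinf_euler_factor_approx[OF \<delta>(1,2), of k] by blast
  obtain Z where Z: "Z \<ge> 0" "\<forall>G::int set. finite G \<longrightarrow> (\<forall>d\<in>G. 0 < d) \<longrightarrow> (\<Sum>d\<in>G. real_of_int d powr (-1 - \<delta>)) \<le> Z"
    using sum_powr_le[of \<delta>] \<delta> by auto
  define Pinf where "Pinf = (\<Prod>p. euler_factor k p)"
  define A where "A = C1 + 2 * (3 + \<bar>real_of_int k\<bar>) * C1 * Z + 54 * K * C2 + C3"
  have "\<bar>sqfree_count N k - Pinf * real N ^ 3\<bar> \<le> A * real N powr (9 / 4 + \<epsilon>)" if N: "N \<ge> 1" for N
  proof -
    define D where "D = real N powr (3 / 4)"
    have N1: "real N \<ge> 1" using N by simp
    have pw: "real N powr a \<le> real N powr (9 / 4 + \<epsilon>)" if "a \<le> 9 / 4 + \<epsilon>" for a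
      using that N1 by (rule powr_mono)
    have D1: "D \<ge> 1" unfolding D_def using N1 by (simp add: ge_one_powr_ge_zero)
    have DN: "D \<le> real N" unfolding D_def using powr_mono[of "3 / 4" 1 "real N"] N1 by simp
    have D3: "D ^ 3 = real N powr (9 / 4)" unfolding D_def using N1 by (simp add: powr_power)
    have ND2: "real N ^ 2 \<le> D ^ 3" unfolding D3 using powr_mono[of 2 "9 / 4" "real N"] N1 by simp
    have NDD: "real N * D \<le> D ^ 3"
    proof -
      have "real N * D = real N powr (1 + 3 / 4)" unfolding D_def powr_add using N1 by simp
      then show ?thesis unfolding D3 using powr_mono[of "1 + 3 / 4" "9 / 4" "real N"] N1 by simp
    qed
    define R where "R = C1 * real N powr (1 + \<delta>)"
    have R0: "R \<ge> 0" using C1(1) by (simp add: R_def)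
    obtain T where T: "T \<ge> 0" "\<And>n. 0 < n \<Longrightarrow> n \<le> 3 * int N ^ 6 \<Longrightarrow> real (tau n) \<le> T"
      "T ^ 3 * hsum (int N ^ 2) ^ 4 \<le> C2 * real N powr (26 * \<delta>)"
      using C2(2)[OF N] by blast
    define cnt where "cnt d = real (cube_count N k (d\<^sup>2))" for d
    have "\<bar>sqfree_count N k - (\<Sum>d\<in>sqfree_upto D. moebius d * cnt d)\<bar>
       \<le> D * R + 2 * ((3 + \<bar>real_of_int k\<bar>) * real N ^ 2) * R * (D powr (\<delta> - 1) * Z)"
      unfolding cnt_def using N D1 \<delta> R0 Z(2) C1(2) by (intro sqfree_count_truncate) (auto simp: R_def)
    also have "D * R = C1 * real N powr (7 / 4 + \<delta>)"
      unfolding D_def R_def by (simp add: powr_add[symmetric] mult.left_commute)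
    also have "2 * ((3 + \<bar>real_of_int k\<bar>) * real N ^ 2) * R * (D powr (\<delta> - 1) * Z)
        = 2 * (3 + \<bar>real_of_int k\<bar>) * C1 * Z * (real N powr 2 * real N powr (1 + \<delta>) * real N powr (3 / 4 * (\<delta> - 1)))"
      unfolding D_def R_def powr_powr using N1 by simp
    also have "real N powr 2 * real N powr (1 + \<delta>) * real N powr (3 / 4 * (\<delta> - 1)) = real N powr (9 / 4 + 7 / 4 * \<delta>)"
      unfolding powr_add[symmetric] by (rule arg_cong[of _ _ "(powr) (real N)"]) (simp add: field_simps)
    also have "C1 * real N powr (7 / 4 + \<delta>) + 2 * (3 + \<bar>real_of_int k\<bar>) * C1 * Z * real N powr (9 / 4 + 7 / 4 * \<delta>)
        \<le> C1 * real N powr (9 / 4 + \<epsilon>) + 2 * (3 + \<bar>real_of_int k\<bar>) * C1 * Z * real N powr (9 / 4 + \<epsilon>)"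
      using C1(1) Z(1) \<delta> by (intro add_mono mult_left_mono pw) auto
    finally have step1: "\<bar>sqfree_count N k - (\<Sum>d\<in>sqfree_upto D. moebius d * cnt d)\<bar>
      \<le> C1 * real N powr (9 / 4 + \<epsilon>) + 2 * (3 + \<bar>real_of_int k\<bar>) * C1 * Z * real N powr (9 / 4 + \<epsilon>)" .
    have "\<bar>(\<Sum>d\<in>sqfree_upto D. moebius d * cnt d) - (\<Sum>d\<in>sqfree_upto D. moebius d * density k d) * real N ^ 3\<bar>
       = \<bar>\<Sum>d\<in>sqfree_upto D. moebius d * (cnt d - density k d * real N ^ 3)\<bar>"
      by (simp add: sum_distrib_right right_diff_distrib sum_subtractf mult.assoc)
    also have "\<dots> \<le> (\<Sum>d\<in>sqfree_upto D. \<bar>cnt d - density k d * real N ^ 3\<bar>)"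
      by (rule order.trans[OF sum_abs]) (simp add: abs_mult)
    also have "\<dots> \<le> 54 * K * T ^ 3 * D ^ 3 * hsum (int N ^ 2) ^ 4"
      unfolding cnt_def density_def sqfree_upto_def K_def
      using sum_cube_count_error_le[OF N D1 DN ND2 NDD T(2)] by simp
    also have "\<dots> = 54 * K * D ^ 3 * (T ^ 3 * hsum (int N ^ 2) ^ 4)" by simp
    also have "\<dots> \<le> 54 * K * D ^ 3 * (C2 * real N powr (26 * \<delta>))"
      using T(3) D1 by (intro mult_left_mono) (auto simp: K_def)
    also have "\<dots> = 54 * K * C2 * real N powr (9 / 4 + 26 * \<delta>)" unfolding D3 by (simp add: powr_add)
    also have "\<dots> \<le> 54 * K * C2 * real N powr (9 / 4 + \<epsilon>)"
      using C2(1) \<delta> by (intro mult_left_mono pw) (auto simp: K_def)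
    finally have step2: "\<bar>(\<Sum>d\<in>sqfree_upto D. moebius d * cnt d) - (\<Sum>d\<in>sqfree_upto D. moebius d * density k d) * real N ^ 3\<bar>
      \<le> 54 * K * C2 * real N powr (9 / 4 + \<epsilon>)" .
    have "\<bar>(\<Sum>d\<in>sqfree_upto D. moebius d * density k d) * real N ^ 3 - Pinf * real N ^ 3\<bar>
       = \<bar>Pinf - (\<Sum>d\<in>sqfree_upto D. moebius d * density k d)\<bar> * real N ^ 3"
      by (simp add: left_diff_distrib[symmetric] abs_mult abs_minus_commute)
    also have "\<dots> \<le> C3 * D powr (2 * \<delta> - 1) * real N ^ 3"
      using C3(2)[OF D1] by (intro mult_right_mono) (auto simp: Pinf_def)
    also have "\<dots> = C3 * (real N powr (3 / 4 * (2 * \<delta> - 1)) * real N powr 3)"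
      unfolding D_def powr_powr using N1 by simp
    also have "real N powr (3 / 4 * (2 * \<delta> - 1)) * real N powr 3 = real N powr (9 / 4 + 3 / 2 * \<delta>)"
      unfolding powr_add[symmetric] by (rule arg_cong[of _ _ "(powr) (real N)"]) (simp add: field_simps)
    also have "C3 * \<dots> \<le> C3 * real N powr (9 / 4 + \<epsilon>)"
      using C3(1) \<delta> by (intro mult_left_mono pw) auto
    finally have step3: "\<bar>(\<Sum>d\<in>sqfree_upto D. moebius d * density k d) * real N ^ 3 - Pinf * real N ^ 3\<bar> \<le> C3 * real N powr (9 / 4 + \<epsilon>)" .
    \<comment> \<open>Three errors add up: cutting the Moebius sum at \<open>D\<close>, replacing
      counts by densities, and completing the density sum to the product.\<close>
    have "\<bar>sqfree_count N k - Pinf * real N ^ 3\<bar> \<le> (C1 * real N powr (9 / 4 + \<epsilon>) + 2 * (3 + \<bar>real_of_int k\<bar>) * C1 * Z * real N powr (9 / 4 + \<epsilon>))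
       + 54 * K * C2 * real N powr (9 / 4 + \<epsilon>) + C3 * real N powr (9 / 4 + \<epsilon>)"
      using step1 step2 step3 by linarith
    also have "\<dots> = A * real N powr (9 / 4 + \<epsilon>)" by (simp add: A_def algebra_simps)
    finally show ?thesis .
  qed
  moreover have "A \<ge> 0" using C1(1) C2(1) C3(1) Z(1) by (simp add: A_def K_def)
  ultimately show ?thesis unfolding Pinf_def by blast
qed

text \<open>Convergence is asserted as well because \<open>prodinf\<close> denotes a meaningful
  value only for convergent products.\<close>

theorem theorem1p2:
  fixes k :: int and \<epsilon> :: real
  assumes "\<epsilon> > 0"
  shows "convergent_prod (euler_factor k) \<and>
         (\<lambda>H::real. real (S3 H k) - (\<Prod>p. euler_factor k p) * H ^ 3)
           \<in> O[at_top](\<lambda>H. H powr (9 / 4 + \<epsilon>))"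
proof
  show "convergent_prod (euler_factor k)" by (rule convergent_prod_euler_factor)
  define Pinf where "Pinf = (\<Prod>p. euler_factor k p)"
  obtain C where C: "C \<ge> 0" "\<And>N. N \<ge> 1 \<Longrightarrow> \<bar>sqfree_count N k - Pinf * real N ^ 3\<bar> \<le> C * real N powr (9 / 4 + \<epsilon>)"
    using sqfree_count_asymptotic[OF assms, of k] unfolding Pinf_def by blast
  have bound: "\<bar>real (S3 H k) - Pinf * H ^ 3\<bar> \<le> (C + 3 * \<bar>Pinf\<bar>) * H powr (9 / 4 + \<epsilon>)" if H: "H \<ge> 1" for H
  proof -
    define N where "N = nat \<lfloor>H\<rfloor>"
    have N: "N \<ge> 1" "real N \<le> H" "H \<le> real N + 1" "real N \<ge> 1" using H by (auto simp: N_def le_nat_floor)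
    have "\<bar>sqfree_count N k - Pinf * real N ^ 3\<bar> \<le> C * real N powr (9 / 4 + \<epsilon>)" by (rule C(2)[OF N(1)])
    also have "\<dots> \<le> C * H powr (9 / 4 + \<epsilon>)" using C(1) N assms by (intro mult_left_mono powr_mono2) auto
    finally have 1: "\<bar>sqfree_count N k - Pinf * real N ^ 3\<bar> \<le> C * H powr (9 / 4 + \<epsilon>)" .
    \<comment> \<open>Passing from \<open>N\<close>, the floor of \<open>H\<close>, back to
      \<open>H\<close> changes the main term by \<open>O(H ^ 2)\<close>, which is below the error
      term.\<close>
    have "H ^ 3 - real N ^ 3 = (H - real N) * (H ^ 2 + H * real N + real N ^ 2)"
      by (simp add: power2_eq_square power3_eq_cube algebra_simps)
    also have "\<dots> \<le> 1 * (H ^ 2 + H * H + H ^ 2)"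
      using N H by (intro mult_mono add_mono power_mono) auto
    also have "\<dots> = 3 * H powr 2" using H by (simp add: power2_eq_square)
    also have "\<dots> \<le> 3 * H powr (9 / 4 + \<epsilon>)" using H assms by (intro mult_left_mono powr_mono) auto
    finally have "H ^ 3 - real N ^ 3 \<le> 3 * H powr (9 / 4 + \<epsilon>)" .
    moreover have "real N ^ 3 \<le> H ^ 3" using N by (intro power_mono) auto
    ultimately have "\<bar>real N ^ 3 - H ^ 3\<bar> \<le> 3 * H powr (9 / 4 + \<epsilon>)" by linarith
    then have "\<bar>Pinf\<bar> * \<bar>real N ^ 3 - H ^ 3\<bar> \<le> \<bar>Pinf\<bar> * (3 * H powr (9 / 4 + \<epsilon>))" by (intro mult_left_mono) auto
    then have 2: "\<bar>Pinf * real N ^ 3 - Pinf * H ^ 3\<bar> \<le> 3 * \<bar>Pinf\<bar> * H powr (9 / 4 + \<epsilon>)"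
      by (simp add: abs_mult right_diff_distrib[symmetric] mult_ac)
    have "real (S3 H k) = sqfree_count N k" using S3_eq_sqfree_count[of H k] H by (simp add: N_def)
    then have "\<bar>real (S3 H k) - Pinf * H ^ 3\<bar> \<le> C * H powr (9 / 4 + \<epsilon>) + 3 * \<bar>Pinf\<bar> * H powr (9 / 4 + \<epsilon>)"
      using 1 2 by linarith
    then show ?thesis by (simp add: distrib_right)
  qed
  show "(\<lambda>H. real (S3 H k) - (\<Prod>p. euler_factor k p) * H ^ 3) \<in> O[at_top](\<lambda>H. H powr (9 / 4 + \<epsilon>))"
  proof (rule bigoI)
    show "\<forall>\<^sub>F H in at_top. norm (real (S3 H k) - (\<Prod>p. euler_factor k p) * H ^ 3) \<le> (C + 3 * \<bar>Pinf\<bar>) * norm (H powr (9 / 4 + \<epsilon>))"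
      using eventually_ge_at_top[of 1] by eventually_elim (use bound in \<open>simp add: Pinf_def\<close>)
  qed
qed

end
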